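(* Let $F$ be Thompson's group and $H_1=\{f\in F: 1\notin\overline{supp}(f)\}$. There is a convergent sequence of marked groups $(G_n)_{n<\omega}$, where $G_n=(F,(g_n,x_0,x_1))$ and $g_n\in F$ for $n<\omega$, such that $$\lim_{n\to\infty}G_n=\big(F\ast_{H_1},(g,x_0,x_1)\big),$$ where $F\ast_{H_1}=\langle F,g\mid ghg^{-1}=h,\ h\in H_1\rangle$ is the HNN-extension of $F$ centralizing $H_1$ with stable letter $g$.
   Context: Thompson's group $F$ is the group, under composition, of all strictly increasing continuous piecewise-linear functions from $[0,1]$ onto itself which are differentiable except at finitely many dyadic rationals and all of whose slopes are integer powers of $2$. It is generated by $x_0,x_1$, where $x_0(t)=t/2$ on $[0,\frac12]$, $t-\frac14$ on $[\frac12,\frac34]$, $2t-1$ on $[\frac34,1]$; and $x_1(t)=t$ on $[0,\frac12]$, $\frac t2+\frac14$ on $[\frac12,\frac34]$, $t-\frac18$ on $[\frac34,\frac78]$, $2t-1$ on $[\frac78,1]$. For $f\in F$, $supp(f)=\{t\in[0,1]: f(t)\neq t\}$ and $\overline{supp}(f)$ is its closure in $[0,1]$. A marked group $(G,S)$ is a group $G$ with a finite ordered tuple of generators $S=(s_1,\ldots,s_m)$. On the set $\mathcal{G}_m$ of groups marked by $m$ generators (up to isomorphism of marked groups) two marked groups are at distance at most $e^{-R}$ if they have exactly the same relations of length at most $R$. Convergence and limits are with respect to this metric. *)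

theory Defs
  imports "HOL-Analysis.Analysis" "HOL-Algebra.Bij" "HOL-Algebra.Generated_Groups"
begin

section \<open>Words, marked groups and their distance\<close>

text \<open>
  The letter (x, True) stands for the generator x and (x, False) for its formal inverse.
  Words are arbitrary lists of letters, not only freely reduced ones.
\<close>

type_synonym 'x word = "('x \<times> bool) list"

definition words :: "'x set \<Rightarrow> 'x word set" where
  "words X = lists (X \<times> UNIV)"

definition word_value :: "('a, 'b) monoid_scheme \<Rightarrow> ('x \<Rightarrow> 'a) \<Rightarrow> 'x word \<Rightarrow> 'a" where
  "word_value G s w =
     foldr (\<lambda>(x, pos) a. (if pos then s x else inv\<^bsub>G\<^esub> (s x)) \<otimes>\<^bsub>G\<^esub> a) w \<one>\<^bsub>G\<^esub>"

definition marked_groups :: "nat \<Rightarrow> ('a monoid \<times> 'a list) set" where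
  "marked_groups m = {(G, S). group G \<and> length S = m \<and> set S \<subseteq> carrier G
                              \<and> generate G (set S) = carrier G}"

definition relations_upto :: "nat \<Rightarrow> 'a monoid \<times> 'a list \<Rightarrow> nat word set" where
  "relations_upto R M = (case M of (G, S) \<Rightarrow>
     {w \<in> words {..<length S}. length w \<le> R \<and> word_value G (\<lambda>i. S ! i) w = \<one>\<^bsub>G\<^esub>})"

text \<open>
  The distance is the least one for which marked groups with the same relations of length
  at most R are at distance at most exp (-R).  It does not distinguish isomorphic marked
  groups, so it lives on representatives, and these may have different element types.
  The set below always contains exp 0, as the empty word is a relation of every marked group.
\<close>

definition marked_dist :: "'a monoid \<times> 'a list \<Rightarrow> 'b monoid \<times> 'b list \<Rightarrow> real" where
  "marked_dist M N = Inf {exp (- real R) | R. relations_upto R M = relations_upto R N}"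

definition marked_limit ::
  "nat \<Rightarrow> (nat \<Rightarrow> 'a monoid \<times> 'a list) \<Rightarrow> 'b monoid \<times> 'b list \<Rightarrow> bool" where
  "marked_limit m M N \<longleftrightarrow>
     (\<forall>n. M n \<in> marked_groups m) \<and> N \<in> marked_groups m \<and>
     (\<lambda>n. marked_dist (M n) N) \<longlonglongrightarrow> 0"

section \<open>Group presentations and HNN-extensions\<close>

text \<open>
  The group with generators X and relations u = v for (u, v) in Rel: words over X modulo
  the least congruence that contains Rel and cancels adjacent inverse letters.
\<close>

inductive_set presentation_rel :: "'x set \<Rightarrow> ('x word \<times> 'x word) set \<Rightarrow> ('x word \<times> 'x word) set"
  for X Rel where
  refl: "u \<in> words X \<Longrightarrow> (u, u) \<in> presentation_rel X Rel"
| sym: "(u, v) \<in> presentation_rel X Rel \<Longrightarrow> (v, u) \<in> presentation_rel X Rel"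
| trans: "(u, v) \<in> presentation_rel X Rel \<Longrightarrow> (v, w) \<in> presentation_rel X Rel \<Longrightarrow>
          (u, w) \<in> presentation_rel X Rel"
| append: "(u, u') \<in> presentation_rel X Rel \<Longrightarrow> (v, v') \<in> presentation_rel X Rel \<Longrightarrow>
           (u @ v, u' @ v') \<in> presentation_rel X Rel"
| cancel: "x \<in> X \<Longrightarrow> ([(x, pos), (x, \<not> pos)], []) \<in> presentation_rel X Rel"
| relation: "(u, v) \<in> Rel \<Longrightarrow> u \<in> words X \<Longrightarrow> v \<in> words X \<Longrightarrow>
             (u, v) \<in> presentation_rel X Rel"

definition presented_group :: "'x set \<Rightarrow> ('x word \<times> 'x word) set \<Rightarrow> 'x word set monoid" where
  "presented_group X Rel =
     \<lparr>carrier = words X // presentation_rel X Rel,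
      mult = \<lambda>A B. \<Union>u\<in>A. \<Union>v\<in>B. presentation_rel X Rel `` {u @ v},
      one = presentation_rel X Rel `` {[]}\<rparr>"

text \<open>
  The HNN-extension of G centralizing H.  The generator Some a stands for the element a of G,
  and None for the stable letter t; G itself is presented by its multiplication table,
  and t h = h t is imposed, as t h t^(-1) = h, for all h in H.
\<close>

definition hnn_gens :: "('a, 'b) monoid_scheme \<Rightarrow> 'a option set" where
  "hnn_gens G = insert None (Some ` carrier G)"

definition hnn_rels ::
  "('a, 'b) monoid_scheme \<Rightarrow> 'a set \<Rightarrow> ('a option word \<times> 'a option word) set" where
  "hnn_rels G H =
     {([(Some a, True), (Some b, True)], [(Some (a \<otimes>\<^bsub>G\<^esub> b), True)]) | a b.
        a \<in> carrier G \<and> b \<in> carrier G}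
     \<union> {([(None, True), (Some h, True), (None, False)], [(Some h, True)]) | h. h \<in> H}"

definition hnn_centralizing ::
  "('a, 'b) monoid_scheme \<Rightarrow> 'a set \<Rightarrow> 'a option word set monoid" where
  "hnn_centralizing G H = presented_group (hnn_gens G) (hnn_rels G H)"

definition hnn_base :: "('a, 'b) monoid_scheme \<Rightarrow> 'a set \<Rightarrow> 'a \<Rightarrow> 'a option word set" where
  "hnn_base G H a = presentation_rel (hnn_gens G) (hnn_rels G H) `` {[(Some a, True)]}"

definition hnn_stable :: "('a, 'b) monoid_scheme \<Rightarrow> 'a set \<Rightarrow> 'a option word set" where
  "hnn_stable G H = presentation_rel (hnn_gens G) (hnn_rels G H) `` {[(None, True)]}"

section \<open>Thompson's group F\<close>

definition dyadic :: "real set" where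
  "dyadic = {of_int k / 2 ^ n | (k::int) (n::nat). True}"

text \<open>B is the set of breakpoints; f is affine on every interval with no breakpoint inside.\<close>

definition piecewise_linear :: "(real \<Rightarrow> real) \<Rightarrow> bool" where
  "piecewise_linear f \<longleftrightarrow>
     (\<exists>B. finite B \<and>
        (\<forall>a b. 0 \<le> a \<and> a < b \<and> b \<le> 1 \<and> {a<..<b} \<inter> B = {} \<longrightarrow>
           (\<exists>m c. \<forall>t\<in>{a..b}. f t = m * t + c)))"

definition thompson_functions :: "(real \<Rightarrow> real) set" where
  "thompson_functions =
     {f \<in> extensional {0..1}.
        f ` {0..1} = {0..1} \<and> strict_mono_on {0..1} f \<and> continuous_on {0..1} f
        \<and> piecewise_linear f
        \<and> (\<exists>D \<subseteq> dyadic. finite D \<and> (\<forall>t\<in>{0..1} - D. f differentiable (at t within {0..1})))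
        \<and> (\<forall>t\<in>{0..1}. \<forall>d. (f has_real_derivative d) (at t within {0..1}) \<longrightarrow>
             (\<exists>k::int. d = 2 powi k))}"

text \<open>The product of f and g in BijGroup is the composition: first g, then f.\<close>

definition thompson_F :: "(real \<Rightarrow> real) monoid" where
  "thompson_F = (BijGroup {0..1}) \<lparr>carrier := thompson_functions\<rparr>"

definition x0 :: "real \<Rightarrow> real" where
  "x0 = (\<lambda>t\<in>{0..1}. if t \<le> 1/2 then t / 2 else if t \<le> 3/4 then t - 1/4 else 2 * t - 1)"

definition x1 :: "real \<Rightarrow> real" where
  "x1 = (\<lambda>t\<in>{0..1}. if t \<le> 1/2 then t else if t \<le> 3/4 then t / 2 + 1/4
                    else if t \<le> 7/8 then t - 1/8 else 2 * t - 1)"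

definition supp :: "(real \<Rightarrow> real) \<Rightarrow> real set" where
  "supp f = {t \<in> {0..1}. f t \<noteq> t}"

definition H1 :: "(real \<Rightarrow> real) set" where
  "H1 = {f \<in> carrier thompson_F. 1 \<notin> closure (supp f)}"

end

theory Submission
  imports Defs
begin

text \<open>
  Near 1, in the coordinate u = t - 1, an element of F is a scaling by a power of 2, and H1
  consists of the elements whose scaling factor is 1.  If the support of g n shrinks to 1, then
  every element of H1 eventually commutes with g n, so every relation of the HNN-extension
  eventually holds in G n.  Conversely, a word which is not trivial in the HNN-extension equals
  an element of F other than 1 or an alternating product of powers of g and elements outside H1,
  and the latter acts near 1 by alternating powers of g n and nontrivial scalings.
  Given finitely many such alternating products, a generic dyadic piecewise-linear map G of the
  negative half-line with bounded support makes each of them move some point (a version of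
  Abert's argument that separating actions satisfy no identities); scaling G down to a small
  neighbourhood of 1 gives g n.  Since every word is equal to a normal form which is eventually
  nontrivial, Britton's lemma is not needed.

  That x0 and x1 generate F is proved with tree diagrams: every partition of [0,1] into standard
  dyadic intervals is mapped to a right comb by a product of conjugates of x0 and x1.
\<close>

section \<open>Dyadic piecewise-linear homeomorphisms of the real line\<close>

text \<open>Only slopes at 1 enter the genericity argument, so an alternating product is recorded by
  finitely many signs and integers. Such data can be enumerated, and the n-th stable letter has to
  deal with the first n + 1 of them only. The obstacle is that a germ describes an element of F only
  near 1, in a neighbourhood depending on the element, so a moving point must be inside it whenever
  an element of F is applied. Scalings by powers of 2 commute with homotheties, hence a generic map
  can be conjugated down to any small scale together with the points that it moves.

  Elements of F are continued by the identity to the whole line: there inverses are total functions,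
  composition is plain, and affine changes of coordinate belong to the same group. This requires
  affine pieces with dyadic constant terms, of which the definition of F does not speak. They come
  from f 0 = 0, since between neighbouring dyadic breakpoints f grows by a power of 2 times a dyadic
  length.\<close>

text \<open>HOL-Algebra takes over the notation inv for inverses in a monoid.\<close>

abbreviation inverse_fun :: "(real \<Rightarrow> real) \<Rightarrow> real \<Rightarrow> real" where
  "inverse_fun \<equiv> inv_into UNIV"


section \<open>Arithmetic of dyadic rationals\<close>

lemma dyadic_of_int [simp]: "of_int k \<in> dyadic"
  unfolding dyadic_def by (auto intro!: exI[of _ k] exI[of _ "0::nat"])

lemma dyadic_frac: "of_int k / 2 ^ n \<in> dyadic"
  unfolding dyadic_def by blast

lemma dyadic_numerals [simp]: "0 \<in> dyadic" "1 \<in> dyadic" "numeral m \<in> dyadic"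
  using dyadic_of_int[of 0] dyadic_of_int[of 1] dyadic_of_int[of "numeral m"] by auto

lemma dyadic_uminus [simp]: "- c \<in> dyadic" if "c \<in> dyadic"
  using that dyadic_frac[of "- k" for k] unfolding dyadic_def by force

lemma dyadic_add:
  assumes "c \<in> dyadic" "d \<in> dyadic" shows "c + d \<in> dyadic"
proof -
  obtain k l :: int and n m :: nat where kl: "c = of_int k / 2 ^ n" "d = of_int l / 2 ^ m"
    using assms unfolding dyadic_def by auto
  have "c + d = of_int (k * 2 ^ m + l * 2 ^ n) / 2 ^ (n + m)"
    by (simp add: kl field_simps power_add)
  then show ?thesis using dyadic_frac by metis
qed

lemma dyadic_diff: "c - d \<in> dyadic" if "c \<in> dyadic" "d \<in> dyadic"
  using dyadic_add[OF that(1) dyadic_uminus[OF that(2)]] by simp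

lemma dyadic_mult:
  assumes "c \<in> dyadic" "d \<in> dyadic" shows "c * d \<in> dyadic"
proof -
  obtain k l :: int and n m :: nat where kl: "c = of_int k / 2 ^ n" "d = of_int l / 2 ^ m"
    using assms unfolding dyadic_def by auto
  have "c * d = of_int (k * l) / 2 ^ (n + m)"
    by (simp add: kl field_simps power_add)
  then show ?thesis using dyadic_frac by metis
qed

lemma dyadic_powi [simp]: "2 powi k \<in> dyadic"
  using dyadic_frac[of "2 ^ nat k" 0] dyadic_frac[of 1 "nat (- k)"]
  by (cases "k \<ge> 0") (auto simp: power_int_def field_simps)

text \<open>Only interior points are compared with \<open>D\<close>, so a piece may begin or end at
  a breakpoint. Slopes that are powers of 2 and dyadic constant terms make each piece preserve
  dyadic rationals in both directions, which closes the class under composition and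
  inversion.\<close>

definition pl_on :: "real set \<Rightarrow> (real \<Rightarrow> real) \<Rightarrow> bool" where
  "pl_on D f \<longleftrightarrow> (\<forall>a b. a < b \<and> {a<..<b} \<inter> D = {} \<longrightarrow>
     (\<exists>k::int. \<exists>c\<in>dyadic. \<forall>t\<in>{a..b}. f t = 2 powi k * t + c))"

definition PL2 :: "(real \<Rightarrow> real) set" where
  "PL2 = {f. strict_mono f \<and> surj f \<and> (\<exists>D\<subseteq>dyadic. finite D \<and> pl_on D f)}"

lemma PL2_bij: "f \<in> PL2 \<Longrightarrow> bij f"
  by (auto simp: PL2_def bij_def strict_mono_imp_inj_on)

lemma PL2_inv:
  assumes "f \<in> PL2"
  shows "inverse_fun f (f t) = t" "f (inverse_fun f t) = t"
  using PL2_bij[OF assms] by (simp_all add: bij_is_inj bij_is_surj surj_f_inv_f)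

lemma PL2_less: "f \<in> PL2 \<Longrightarrow> f s < f t \<longleftrightarrow> s < t"
  by (simp add: PL2_def strict_mono_less)

lemma PL2_le: "f \<in> PL2 \<Longrightarrow> f s \<le> f t \<longleftrightarrow> s \<le> t"
  by (simp add: PL2_def strict_mono_less_eq)

lemma PL2_eq: "f \<in> PL2 \<Longrightarrow> f s = f t \<longleftrightarrow> s = t"
  by (simp add: PL2_def strict_mono_eq)

lemma PL2_continuous: "f \<in> PL2 \<Longrightarrow> continuous_on UNIV f"
  by (rule continuous_onI_mono) (auto simp: PL2_def strict_mono_less_eq)

lemma gap_right:
  fixes t :: real assumes "finite D" obtains b where "t < b" "{t<..<b} \<inter> D = {}"
proof (cases "D \<inter> {t<..} = {}")
  case True then show ?thesis by (intro that[of "t + 1"]) auto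
next
  case False
  then have "Min (D \<inter> {t<..}) \<in> D \<inter> {t<..}" using assms by (intro Min_in) auto
  moreover have "{t<..<Min (D \<inter> {t<..})} \<inter> D = {}" using assms by (auto simp: Min_le leD)
  ultimately show ?thesis by (intro that[of "Min (D \<inter> {t<..})"]) auto
qed

lemma gap_left:
  fixes t :: real assumes "finite D" obtains a where "a < t" "{a<..<t} \<inter> D = {}"
proof -
  obtain b where b: "- t < b" "{- t<..<b} \<inter> uminus ` D = {}"
    using gap_right[of "uminus ` D" "- t"] assms by auto
  have "{- b<..<t} \<inter> D = {}"
  proof (rule ccontr)
    assume "{- b<..<t} \<inter> D \<noteq> {}"
    then obtain d where "d \<in> D" "- b < d" "d < t" by auto
    then have "- d \<in> {- t<..<b} \<inter> uminus ` D" by auto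
    then show False using b by blast
  qed
  then show ?thesis using b by (intro that[of "- b"]) auto
qed

lemma PL2_affine_right:
  assumes "f \<in> PL2"
  shows "\<exists>b k. \<exists>c\<in>dyadic. t < b \<and> (\<forall>s\<in>{t..b}. f s = 2 powi k * s + c)"
proof -
  obtain D where D: "finite D" "pl_on D f" using assms unfolding PL2_def by auto
  then obtain b where "t < b" "{t<..<b} \<inter> D = {}" using gap_right by blast
  then show ?thesis using D unfolding pl_on_def by blast
qed

lemma PL2_affine_left:
  assumes "f \<in> PL2"
  shows "\<exists>a k. \<exists>c\<in>dyadic. a < t \<and> (\<forall>s\<in>{a..t}. f s = 2 powi k * s + c)"
proof -
  obtain D where D: "finite D" "pl_on D f" using assms unfolding PL2_def by auto
  then obtain a where "a < t" "{a<..<t} \<inter> D = {}" using gap_left by blast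
  then show ?thesis using D unfolding pl_on_def by blast
qed

text \<open>Every point is the left end of an affine piece, and there t = 2^(-k) * (f t - c) is
  solved within the dyadic rationals.\<close>

lemma PL2_dyadic:
  assumes "f \<in> PL2" shows "f t \<in> dyadic \<longleftrightarrow> t \<in> dyadic"
proof -
  obtain b k c where *: "t < b" "c \<in> dyadic" "\<forall>s\<in>{t..b}. f s = 2 powi k * s + c"
    using PL2_affine_right[OF assms] by blast
  then have eq: "f t = 2 powi k * t + c" by auto
  then have t: "t = 2 powi (- k) * (f t - c)" by (simp add: power_int_minus field_simps)
  show ?thesis
  proof
    assume "f t \<in> dyadic"
    then have "2 powi (- k) * (f t - c) \<in> dyadic" by (intro dyadic_mult dyadic_diff *(2)) simp
    then show "t \<in> dyadic" by (subst t)
  qed (use eq *(2) in \<open>simp add: dyadic_add dyadic_mult\<close>)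
qed

lemma PL2_inv_dyadic:
  assumes "f \<in> PL2" shows "inverse_fun f t \<in> dyadic \<longleftrightarrow> t \<in> dyadic"
  using PL2_dyadic[OF assms, of "inverse_fun f t"] by (simp add: PL2_inv[OF assms])

text \<open>The composite can break only where \<open>g\<close> does or where \<open>g\<close> lands
  on a breakpoint of \<open>f\<close>; by monotonicity \<open>g\<close> maps an interval avoiding
  both kinds into a gap of \<open>f\<close>.\<close>

lemma PL2_comp:
  assumes f: "f \<in> PL2" and g: "g \<in> PL2" shows "f \<circ> g \<in> PL2"
proof -
  obtain D where D: "D \<subseteq> dyadic" "finite D" "pl_on D f" using f unfolding PL2_def by auto
  obtain E where E: "E \<subseteq> dyadic" "finite E" "pl_on E g" using g unfolding PL2_def by auto
  have "pl_on (E \<union> inverse_fun g ` D) (f \<circ> g)"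
    unfolding pl_on_def
  proof (intro allI impI, elim conjE)
    fix a b :: real assume ab: "a < b" "{a<..<b} \<inter> (E \<union> inverse_fun g ` D) = {}"
    then obtain k c where c: "c \<in> dyadic" "\<forall>t\<in>{a..b}. g t = 2 powi k * t + c"
      using E unfolding pl_on_def by (metis Int_Un_distrib Un_empty)
    have "{g a<..<g b} \<inter> D = {}"
    proof (rule ccontr)
      assume "{g a<..<g b} \<inter> D \<noteq> {}"
      then obtain d where d: "d \<in> D" "g a < d" "d < g b" by auto
      have "a < inverse_fun g d \<and> inverse_fun g d < b"
        using d PL2_less[OF g, of a "inverse_fun g d"] PL2_less[OF g, of "inverse_fun g d" b] by (simp add: PL2_inv[OF g])
      then show False using d ab by auto
    qed
    then obtain l e where e: "e \<in> dyadic" "\<forall>t\<in>{g a..g b}. f t = 2 powi l * t + e"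
      using D ab unfolding pl_on_def by (metis PL2_less[OF g])
    have "\<forall>t\<in>{a..b}. (f \<circ> g) t = 2 powi (l + k) * t + (2 powi l * c + e)"
    proof
      fix t assume t: "t \<in> {a..b}"
      then have "g t \<in> {g a..g b}" by (simp add: PL2_le[OF g])
      then have "f (g t) = 2 powi l * g t + e" using e by blast
      moreover have "g t = 2 powi k * t + c" using c t by blast
      ultimately show "(f \<circ> g) t = 2 powi (l + k) * t + (2 powi l * c + e)"
        by (simp add: power_int_add distrib_left mult.assoc)
    qed
    moreover have "2 powi l * c + e \<in> dyadic" by (intro dyadic_add dyadic_mult c e dyadic_powi)
    ultimately show "\<exists>k. \<exists>c\<in>dyadic. \<forall>t\<in>{a..b}. (f \<circ> g) t = 2 powi k * t + c" by blast
  qed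
  moreover have "E \<union> inverse_fun g ` D \<subseteq> dyadic" using D E PL2_inv_dyadic[OF g] by auto
  moreover have "surj (f \<circ> g)" using PL2_bij[OF f] PL2_bij[OF g] by (intro bij_is_surj bij_comp)
  moreover have "strict_mono (f \<circ> g)"
    unfolding strict_mono_def by (simp add: PL2_less[OF f] PL2_less[OF g])
  ultimately show ?thesis using D E unfolding PL2_def by blast
qed

lemma PL2_inv_mem:
  assumes f: "f \<in> PL2" shows "inverse_fun f \<in> PL2"
proof -
  obtain D where D: "D \<subseteq> dyadic" "finite D" "pl_on D f" using f unfolding PL2_def by auto
  have "pl_on (f ` D) (inverse_fun f)"
    unfolding pl_on_def
  proof (intro allI impI, elim conjE)
    fix a b :: real assume ab: "a < b" "{a<..<b} \<inter> f ` D = {}"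
    have *: "inverse_fun f s < inverse_fun f t \<longleftrightarrow> s < t" "inverse_fun f s \<le> inverse_fun f t \<longleftrightarrow> s \<le> t" for s t
      using PL2_less[OF f, of "inverse_fun f s" "inverse_fun f t"] PL2_le[OF f, of "inverse_fun f s" "inverse_fun f t"] PL2_inv[OF f] by auto
    have "{inverse_fun f a<..<inverse_fun f b} \<inter> D = {}"
    proof (rule ccontr)
      assume "{inverse_fun f a<..<inverse_fun f b} \<inter> D \<noteq> {}"
      then obtain d where d: "d \<in> D" "inverse_fun f a < d" "d < inverse_fun f b" by auto
      then have "a < f d" "f d < b"
        using PL2_less[OF f, of "inverse_fun f a" d] PL2_less[OF f, of d "inverse_fun f b"] PL2_inv[OF f] by auto
      then show False using d ab by auto
    qed
    then obtain k c where c: "c \<in> dyadic" "\<forall>t\<in>{inverse_fun f a..inverse_fun f b}. f t = 2 powi k * t + c"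
      using D ab * unfolding pl_on_def by metis
    have "\<forall>t\<in>{a..b}. inverse_fun f t = 2 powi (- k) * t + (2 powi (- k) * (- c))"
    proof
      fix t assume "t \<in> {a..b}"
      then have "inverse_fun f t \<in> {inverse_fun f a..inverse_fun f b}" using * by simp
      then have "t = 2 powi k * inverse_fun f t + c" using c by (metis PL2_inv(2)[OF f])
      then show "inverse_fun f t = 2 powi (- k) * t + (2 powi (- k) * (- c))"
        by (simp add: power_int_minus field_simps)
    qed
    moreover have "2 powi (- k) * (- c) \<in> dyadic" by (intro dyadic_mult c dyadic_powi dyadic_uminus)
    ultimately show "\<exists>k. \<exists>c\<in>dyadic. \<forall>t\<in>{a..b}. inverse_fun f t = 2 powi k * t + c" by blast
  qed
  moreover have "f ` D \<subseteq> dyadic" using D PL2_dyadic[OF f] by auto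
  moreover have "surj (inverse_fun f)" using f PL2_bij bij_imp_bij_inv bij_is_surj by blast
  moreover have "strict_mono (inverse_fun f)"
    unfolding strict_mono_def using PL2_less[OF f, of "inverse_fun f s" "inverse_fun f t" for s t]
    by (simp add: PL2_inv[OF f])
  ultimately show ?thesis
    unfolding PL2_def mem_Collect_eq using D(2) by (intro conjI exI[of _ "f ` D"]) simp_all
qed

lemma PL2_affine:
  assumes "c \<in> dyadic" shows "(\<lambda>t. 2 powi k * t + c) \<in> PL2"
proof -
  have "\<exists>t. s = 2 powi k * t + c" for s
    by (rule exI[of _ "(s - c) / 2 powi k"]) simp
  then have "surj (\<lambda>t. 2 powi k * t + c)" unfolding surj_def by blast
  moreover have "pl_on {} (\<lambda>t. 2 powi k * t + c)" using assms unfolding pl_on_def by blast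
  moreover have "strict_mono (\<lambda>t. 2 powi k * t + c)"
    unfolding strict_mono_def by (simp add: zero_less_power_int)
  ultimately show ?thesis unfolding PL2_def by blast
qed

lemma PL2_id: "id \<in> PL2"
  using PL2_affine[of 0 0] by (simp add: id_def)

definition F_ext :: "(real \<Rightarrow> real) set" where
  "F_ext = {f \<in> PL2. \<forall>t. t \<notin> {0<..<1} \<longrightarrow> f t = t}"

lemma F_ext_PL2: "f \<in> F_ext \<Longrightarrow> f \<in> PL2"
  by (simp add: F_ext_def)

lemma F_ext_ends:
  assumes "f \<in> F_ext"
  shows "t \<le> 0 \<Longrightarrow> f t = t" "t \<ge> 1 \<Longrightarrow> f t = t"
  using assms by (auto simp: F_ext_def)

lemma F_ext_in_unit:
  assumes "f \<in> F_ext" shows "f t \<in> {0..1} \<longleftrightarrow> t \<in> {0..1}"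
  using PL2_le[OF F_ext_PL2[OF assms], of 0 t] PL2_le[OF F_ext_PL2[OF assms], of t 1]
    F_ext_ends(1)[OF assms, of 0] F_ext_ends(2)[OF assms, of 1]
  by auto

lemma F_ext_id: "id \<in> F_ext"
  using PL2_id by (auto simp: F_ext_def)

lemma F_ext_comp: "f \<in> F_ext \<Longrightarrow> g \<in> F_ext \<Longrightarrow> f \<circ> g \<in> F_ext"
  using PL2_comp by (auto simp: F_ext_def)

lemma F_ext_inv:
  assumes "f \<in> F_ext" shows "inverse_fun f \<in> F_ext"
proof -
  have "inverse_fun f t = t" if "t \<notin> {0<..<1}" for t
    using that assms PL2_inv(1)[OF F_ext_PL2[OF assms], of t] by (auto simp: F_ext_def)
  then show ?thesis using assms PL2_inv_mem by (auto simp: F_ext_def)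
qed

section \<open>Thompson's group as a group of homeomorphisms of the line\<close>

abbreviation restr :: "(real \<Rightarrow> real) \<Rightarrow> real \<Rightarrow> real" where
  "restr f \<equiv> restrict f {0..1}"

lemma gap_mono: "{a<..<b} \<inter> D = {} \<Longrightarrow> a \<le> c \<Longrightarrow> d \<le> b \<Longrightarrow> {c<..<d} \<inter> D = {}"
  for a b c d :: real
  unfolding disjoint_iff greaterThanLessThan_iff by (meson order.strict_trans1 order.strict_trans2)

lemma gap_notin: "{a<..<b} \<inter> D = {} \<Longrightarrow> a < x \<Longrightarrow> x < b \<Longrightarrow> x \<notin> D"
  for a b x :: real
  unfolding disjoint_iff greaterThanLessThan_iff by blast

text \<open>Derivative and affine formula both restrict to the nondegenerate interval {a..b}, where
  derivatives are unique even at an endpoint; so a slope can be read off from one side.\<close>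

lemma affine_deriv_unique:
  fixes f :: "real \<Rightarrow> real"
  assumes "(f has_real_derivative d) (at t within S)" "a < b" "{a..b} \<subseteq> S" "t \<in> {a..b}"
    and aff: "\<forall>s\<in>{a..b}. f s = m * s + c"
  shows "d = m"
proof -
  have "(f has_real_derivative d) (at t within {a..b})"
    using assms DERIV_subset by blast
  moreover have "((\<lambda>s. m * s + c) has_real_derivative m) (at t within {a..b})"
    by (auto intro!: derivative_eq_intros)
  then have "(f has_real_derivative m) (at t within {a..b})"
    by (rule has_field_derivative_transform_within[of _ _ _ _ 1]) (use assms in auto)
  ultimately show ?thesis
    using assms vector_derivative_unique_within_closed_interval[of a b t f d m]
    by (auto simp: has_real_derivative_iff_has_vector_derivative)
qed

lemma restr_F_ext_mem:
  assumes f: "f \<in> F_ext" shows "restr f \<in> thompson_functions"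
proof -
  have fP: "f \<in> PL2" using f by (rule F_ext_PL2)
  obtain D where D: "D \<subseteq> dyadic" "finite D" "pl_on D f" using fP unfolding PL2_def by auto
  have "restr f ` {0..1} = {0..1}"
  proof (intro equalityI subsetI)
    fix t :: real assume t: "t \<in> {0..1}"
    then have "inverse_fun f t \<in> {0..1}"
      using F_ext_in_unit[OF F_ext_inv[OF f], of t] by simp
    then show "t \<in> restr f ` {0..1}"
      by (intro image_eqI[of _ _ "inverse_fun f t"]) (simp_all add: PL2_inv[OF fP])
  next
    fix s assume "s \<in> restr f ` {0..1}"
    then obtain t where "t \<in> {0..1}" "s = f t" by auto
    then show "s \<in> {0..1}" using F_ext_in_unit[OF f, of t] by blast
  qed
  moreover have "strict_mono_on {0..1} (restr f)"
    unfolding strict_mono_on_def using PL2_less[OF fP] by (simp)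
  moreover have "continuous_on {0..1} (restr f)"
    using continuous_on_subset[OF PL2_continuous[OF fP], of "{0..1}"]
    by (subst continuous_on_cong[OF HOL.refl, of _ _ f]) simp_all
  moreover have "piecewise_linear (restr f)"
    unfolding piecewise_linear_def
  proof (intro exI[of _ D] conjI allI impI, goal_cases)
    case (2 a b)
    then obtain k c where "\<forall>t\<in>{a..b}. f t = 2 powi k * t + c"
      using D(3) unfolding pl_on_def by blast
    then show ?case using 2 by (intro exI[of _ "2 powi k"] exI[of _ c]) auto
  qed (fact D)
  moreover have "restr f differentiable (at t within {0..1})" if t: "t \<in> {0..1} - D" for t
  proof -
    obtain a where a: "a < t" "{a<..<t} \<inter> D = {}" using gap_left[OF D(2)] by blast
    obtain b where b: "t < b" "{t<..<b} \<inter> D = {}" using gap_right[OF D(2)] by blast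
    have "{a<..<b} \<inter> D = {}"
    proof (rule ccontr)
      assume "{a<..<b} \<inter> D \<noteq> {}"
      then obtain d where d: "d \<in> D" "a < d" "d < b" by auto
      then have "d < t \<or> d > t" using t by (cases d t rule: linorder_cases) auto
      then show False using d a b by auto
    qed
    then obtain k c where kc: "\<forall>s\<in>{a..b}. f s = 2 powi k * s + c"
      using D(3) a(1) b(1) unfolding pl_on_def by (metis order.strict_trans)
    have "((\<lambda>s. 2 powi k * s + c) has_real_derivative 2 powi k) (at t within {0..1})"
      by (auto intro!: derivative_eq_intros)
    then have "(restr f has_real_derivative 2 powi k) (at t within {0..1})"
    proof (rule has_field_derivative_transform_within[of _ _ _ _ "min (t - a) (b - t)"])
      fix s assume "s \<in> {0..1}" "dist s t < min (t - a) (b - t)"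
      then have "s \<in> {a..b}" "restr f s = f s"
        by (auto simp: dist_real_def abs_if split: if_splits)
      then show "2 powi k * s + c = restr f s" using kc by simp
    qed (use a b t in auto)
    then show ?thesis using real_differentiable_def by blast
  qed
  moreover have "\<exists>k::int. d = 2 powi k"
    if t: "t \<in> {0..1}" and d: "(restr f has_real_derivative d) (at t within {0..1})" for t d
  \<comment> \<open>One side of t suffices: the piece to its right, or at t = 1 the piece to its
    left, clipped to stay inside [0, 1].\<close>
  proof (cases "t < 1")
    case True
    obtain b k c where b: "t < b" "\<forall>s\<in>{t..b}. f s = 2 powi k * s + c"
      using PL2_affine_right[OF fP] by blast
    have "d = 2 powi k"
      by (rule affine_deriv_unique[OF d, of t "min b 1" _ c]) (use b t True in auto)
    then show ?thesis by blast
  next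
    case False
    obtain a k c where b: "a < t" "\<forall>s\<in>{a..t}. f s = 2 powi k * s + c"
      using PL2_affine_left[OF fP] by blast
    have "d = 2 powi k"
      by (rule affine_deriv_unique[OF d, of "max a 0" t _ c]) (use b t False in auto)
    then show ?thesis by blast
  qed
  ultimately show ?thesis
    unfolding thompson_functions_def mem_Collect_eq using D(1,2)
    by (intro conjI ballI allI impI exI[of _ D] restrict_extensional) (assumption | blast)+
qed

definition extend_by_id :: "(real \<Rightarrow> real) \<Rightarrow> real \<Rightarrow> real" where
  "extend_by_id f t = (if t \<in> {0..1} then f t else t)"

text \<open>The points in \<open>piecewise_linear\<close> are arbitrary reals, so they are removed
  by induction on their number in the interval: outside \<open>D\<close> the derivative at such a
  point equals the slopes on both sides, which glues the two pieces. The derivative at the midpoint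
  then makes the slope a power of 2.\<close>

lemma thompson_affine:
  assumes f: "f \<in> thompson_functions" and D: "finite D"
    "\<forall>t\<in>{0..1} - D. f differentiable (at t within {0..1})"
    and ab: "0 \<le> a" "a < b" "b \<le> 1" "{a<..<b} \<inter> D = {}"
  shows "\<exists>(k::int) c. \<forall>t\<in>{a..b}. f t = 2 powi k * t + c"
proof -
  have "piecewise_linear f" using f unfolding thompson_functions_def by simp
  then obtain B where B: "finite B"
      "\<forall>a b. 0 \<le> a \<and> a < b \<and> b \<le> 1 \<and> {a<..<b} \<inter> B = {} \<longrightarrow>
         (\<exists>m c. \<forall>t\<in>{a..b}. f t = m * t + c)"
    unfolding piecewise_linear_def by (elim exE conjE)
  have "\<exists>m c. \<forall>t\<in>{a..b}. f t = m * t + c" using ab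
  proof (induction "card ({a<..<b} \<inter> B)" arbitrary: a b rule: less_induct)
    case less
    show ?case
    proof (cases "{a<..<b} \<inter> B = {}")
      case True then show ?thesis using B(2) less.prems by simp
    next
      case False
      then obtain p where p: "p \<in> B" "a < p" "p < b" by auto
      have gaps: "{a<..<p} \<inter> D = {}" "{p<..<b} \<inter> D = {}"
        using gap_mono[OF less.prems(4), of a p] gap_mono[OF less.prems(4), of p b] p(2,3) by simp_all
      have fin: "finite ({a<..<b} \<inter> B)" using B(1) by simp
      have "card ({a<..<p} \<inter> B) < card ({a<..<b} \<inter> B)"
        by (rule psubset_card_mono[OF fin]) (use p in auto)
      then obtain m c where mc: "\<forall>t\<in>{a..p}. f t = m * t + c"
        using less.hyps[of a p] less.prems(1,3) p(2,3) gaps(1) by auto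
      have "card ({p<..<b} \<inter> B) < card ({a<..<b} \<inter> B)"
        by (rule psubset_card_mono[OF fin]) (use p in auto)
      then obtain n d where nd: "\<forall>t\<in>{p..b}. f t = n * t + d"
        using less.hyps[of p b] less.prems(1,3) p(2,3) gaps(2) by auto
      have "p \<in> {0..1} - D" using less.prems(1,3) p(2,3) gap_notin[OF less.prems(4)] by simp
      then obtain e where e: "(f has_real_derivative e) (at p within {0..1})"
        using D(2) real_differentiable_def by blast
      have "e = m" by (rule affine_deriv_unique[OF e, of a p m c]) (use p less.prems mc in auto)
      moreover have "e = n" by (rule affine_deriv_unique[OF e, of p b n d]) (use p less.prems nd in auto)
      moreover have "m * p + c = n * p + d" using mc nd p by (metis atLeastAtMost_iff less_imp_le order_refl)
      ultimately have "\<forall>t\<in>{a..b}. f t = m * t + c" using mc nd p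
        by (metis add_left_cancel atLeastAtMost_iff linear)
      then show ?thesis by blast
    qed
  qed
  then obtain m c where mc: "\<forall>t\<in>{a..b}. f t = m * t + c" by blast
  have "(a + b) / 2 \<in> {0..1} - D"
    using ab(1-3) gap_notin[OF ab(4), of "(a + b) / 2"] by (simp add: field_simps)
  then obtain e where e: "(f has_real_derivative e) (at ((a + b) / 2) within {0..1})"
    using D(2) real_differentiable_def by blast
  have "e = m" by (rule affine_deriv_unique[OF e, of a b m c]) (use ab mc in auto)
  moreover have "\<exists>k::int. e = 2 powi k"
    using f e ab unfolding thompson_functions_def by auto
  ultimately show ?thesis using mc by blast
qed

lemma extend_by_id_F_ext:
  assumes f: "f \<in> thompson_functions" shows "extend_by_id f \<in> F_ext"
proof -
  let ?g = "extend_by_id f"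
  obtain D where D: "D \<subseteq> dyadic" "finite D"
      "\<forall>t\<in>{0..1} - D. f differentiable (at t within {0..1})"
    using f unfolding thompson_functions_def by auto
  have img: "f ` {0..1} = {0..1}" and mono: "strict_mono_on {0..1} f"
    using f unfolding thompson_functions_def by auto
  have unit: "f t \<in> {0..1}" if "t \<in> {0..1}" for t using img that by blast
  have less: "f s < f t" if "s \<in> {0..1}" "t \<in> {0..1}" "s < t" for s t
    using mono that by (auto simp: strict_mono_on_def)
  have f0: "f 0 = 0"
  proof -
    obtain t where "t \<in> {0..1}" "f t = 0" using img by (metis atLeastAtMost_iff image_iff order_refl zero_le_one)
    then show ?thesis using less[of 0 t] unit[of 0] by (cases "t = 0") auto
  qed
  have f1: "f 1 = 1"
  proof -
    obtain t where "t \<in> {0..1}" "f t = 1" using img by (metis atLeastAtMost_iff image_iff order_refl zero_le_one)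
    then show ?thesis using less[of t 1] unit[of 1] by (cases "t = 1") auto
  qed
  \<comment> \<open>Adding 0 and 1 gives the induction along the breakpoints a start with known
    value and prevents a gap from straddling an end of [0, 1].\<close>
  define E where "E = D \<inter> {0..1} \<union> {0, 1}"
  have E: "finite E" "E \<subseteq> dyadic" "E \<subseteq> {0..1}" "0 \<in> E" "1 \<in> E"
    using D unfolding E_def by auto
  \<comment> \<open>A gap may begin at a non-dyadic a. Enlarged to the left up to a point y of
    \<open>E\<close>, it has the constant term f y - 2^k * y, computed from dyadic data.\<close>
  have prev: "\<exists>y\<in>E. y \<le> a \<and> {y<..<b} \<inter> E = {}"
    if "0 \<le> a" "{a<..<b} \<inter> E = {}" for a b
  proof -
    have ne: "E \<inter> {..a} \<noteq> {}" "finite (E \<inter> {..a})" using E that by auto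
    have "Max (E \<inter> {..a}) \<in> E \<inter> {..a}" using ne by (intro Max_in)
    moreover have "{Max (E \<inter> {..a})<..<b} \<inter> E = {}"
    proof (rule ccontr)
      assume "{Max (E \<inter> {..a})<..<b} \<inter> E \<noteq> {}"
      then obtain e where e: "e \<in> E" "Max (E \<inter> {..a}) < e" "e < b" by auto
      then have "\<not> e \<le> a" using Max_ge[OF ne(2), of e] by auto
      then show False using e gap_notin[OF that(2), of e] by simp
    qed
    ultimately show ?thesis by blast
  qed
  have aff: "\<exists>(k::int) c. \<forall>t\<in>{a..b}. f t = 2 powi k * t + c"
    if "0 \<le> a" "a < b" "b \<le> 1" "{a<..<b} \<inter> E = {}" for a b
  proof (rule thompson_affine[OF f D(2,3) that(1-3)])
    show "{a<..<b} \<inter> D = {}" using that unfolding E_def by fastforce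
  qed
  have dy: "f x \<in> dyadic" if "x \<in> E" for x
    using that
  proof (induction "card {e \<in> E. e < x}" arbitrary: x rule: less_induct)
    case less
    show ?case
    proof (cases "x = 0")
      case True then show ?thesis using f0 by simp
    next
      case False
      then have x: "0 < x" "x \<le> 1" using less.prems E by force+
      obtain a where a: "a < x" "{a<..<x} \<inter> E = {}" using gap_left[OF E(1)] by blast
      have "{max a 0<..<x} \<inter> E = {}" by (rule gap_mono[OF a(2)]) simp_all
      then obtain y where y: "y \<in> E" "y \<le> max a 0" "{y<..<x} \<inter> E = {}"
        using prev[of "max a 0" x] by auto
      have yx: "0 \<le> y" "y < x" using y E a x by auto
      have "card {e \<in> E. e < y} < card {e \<in> E. e < x}"
        by (rule psubset_card_mono) (use E y yx in auto)
      then have "f y \<in> dyadic" using less.hyps y by blast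
      moreover obtain k :: int and c where kc: "\<forall>t\<in>{y..x}. f t = 2 powi k * t + c"
        using aff[of y x] yx x y by blast
      then have "f y = 2 powi k * y + c" "f x = 2 powi k * x + c" using yx by auto
      then have "f x = f y + 2 powi k * (x - y)" by (simp add: algebra_simps)
      moreover have "x \<in> dyadic" "y \<in> dyadic" using E y less.prems by auto
      ultimately show ?thesis by (simp add: dyadic_add dyadic_mult dyadic_diff)
    qed
  qed
  have gid: "?g t = t" if "t \<notin> {0<..<1}" for t
    using that f0 f1 by (cases "t = 0 \<or> t = 1") (auto simp: extend_by_id_def)
  have "pl_on E ?g"
    unfolding pl_on_def
  proof (intro allI impI, elim conjE)
    fix a b :: real assume ab: "a < b" "{a<..<b} \<inter> E = {}"
    have "\<not> (a < 0 \<and> 0 < b)" "\<not> (a < 1 \<and> 1 < b)"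
      using gap_notin[OF ab(2)] E(4,5) by blast+
    then consider "b \<le> 0" | "1 \<le> a" | "0 \<le> a" "b \<le> 1" by linarith
    then show "\<exists>k. \<exists>c\<in>dyadic. \<forall>t\<in>{a..b}. ?g t = 2 powi k * t + c"
    proof cases
      case 1
      then have "\<forall>t\<in>{a..b}. ?g t = 2 powi 0 * t + 0" using gid by simp
      then show ?thesis using dyadic_numerals(1) by blast
    next
      case 2
      then have "\<forall>t\<in>{a..b}. ?g t = 2 powi 0 * t + 0" using gid by simp
      then show ?thesis using dyadic_numerals(1) by blast
    next
      case 3
      obtain y where y: "y \<in> E" "y \<le> a" "{y<..<b} \<inter> E = {}"
        using prev[OF 3(1) ab(2)] by blast
      then have y0: "0 \<le> y" using E by auto
      then obtain k :: int and c where kc: "\<forall>t\<in>{y..b}. f t = 2 powi k * t + c"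
        using aff[of y b] y ab 3 by force
      then have "c = f y - 2 powi k * y" using y ab by auto
      then have "c \<in> dyadic" using dy[OF y(1)] y E by (auto intro!: dyadic_diff dyadic_mult)
      moreover have "\<forall>t\<in>{a..b}. ?g t = 2 powi k * t + c"
        using kc y 3 by (auto simp: extend_by_id_def)
      ultimately show ?thesis by blast
    qed
  qed
  moreover have "strict_mono ?g"
  proof (rule strict_monoI)
    fix s t :: real assume st: "s < t"
    show "?g s < ?g t"
      using st less[of s t] unit[of s] unit[of t] less[of 0 t] less[of s 1] f0 f1
      by (cases "s \<in> {0..1}"; cases "t \<in> {0..1}"; force simp: extend_by_id_def)
  qed
  moreover have "surj ?g"
    unfolding surj_def
  proof
    fix y show "\<exists>x. y = ?g x"
    proof (cases "y \<in> {0..1}")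
      case True
      then obtain x where "x \<in> {0..1}" "y = f x" using img by blast
      then show ?thesis by (intro exI[of _ x]) (auto simp: extend_by_id_def)
    qed (intro exI[of _ y], auto simp: extend_by_id_def)
  qed
  ultimately have "?g \<in> PL2" using E unfolding PL2_def by blast
  with gid show ?thesis unfolding F_ext_def by blast
qed

lemma restr_extend_by_id:
  assumes "f \<in> thompson_functions" shows "restr (extend_by_id f) = f"
proof
  fix t show "restr (extend_by_id f) t = f t"
    using assms by (cases "t \<in> {0..1}") (auto simp: thompson_functions_def extend_by_id_def extensional_def)
qed

text \<open>Together with \<open>thompson_mult\<close>, this turns computations in F into plain
  composition on the line.\<close>

lemma carrier_thompson_F: "carrier thompson_F = restr ` F_ext"
proof -
  have "f \<in> restr ` F_ext" if "f \<in> thompson_functions" for f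
    using restr_extend_by_id[OF that] extend_by_id_F_ext[OF that] by (metis image_eqI)
  then show ?thesis using restr_F_ext_mem by (auto simp: thompson_F_def simp del: restrict_apply)
qed

lemma restr_carrier: "f \<in> F_ext \<Longrightarrow> restr f \<in> carrier thompson_F"
  unfolding carrier_thompson_F by (rule imageI)

lemma restr_Bij:
  assumes f: "f \<in> F_ext" shows "restr f \<in> Bij {0..1}"
proof -
  have fP: "f \<in> PL2" using f by (rule F_ext_PL2)
  have "restr f ` {0..1} = {0..1}" "strict_mono_on {0..1} (restr f)"
    using restr_F_ext_mem[OF f] unfolding thompson_functions_def by auto
  then show ?thesis unfolding Bij_def bij_betw_def
    using strict_mono_on_imp_inj_on[of "{0..1}" "restr f"] by (simp del: image_restrict_eq inj_on_restrict_eq)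
qed

lemma thompson_mult:
  assumes "f \<in> F_ext" "g \<in> F_ext"
  shows "restr f \<otimes>\<^bsub>thompson_F\<^esub> restr g = restr (f \<circ> g)"
proof -
  have "restr f \<otimes>\<^bsub>thompson_F\<^esub> restr g = compose {0..1} (restr f) (restr g)"
    using restr_Bij assms by (simp add: thompson_F_def BijGroup_def)
  also have "\<dots> = restr (f \<circ> g)"
    using F_ext_in_unit[OF assms(2)] by (auto simp: compose_def restrict_def fun_eq_iff)
  finally show ?thesis .
qed

lemma thompson_one: "\<one>\<^bsub>thompson_F\<^esub> = restr id"
  by (simp add: thompson_F_def BijGroup_def id_def)

lemma PL2_inverse_comp:
  assumes "f \<in> PL2" shows "inverse_fun f \<circ> f = id" "f \<circ> inverse_fun f = id"
  using PL2_inv[OF assms] by auto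

lemma group_thompson_F: "group thompson_F"
proof (rule groupI)
  fix x y z assume "x \<in> carrier thompson_F" "y \<in> carrier thompson_F" "z \<in> carrier thompson_F"
  then show "x \<otimes>\<^bsub>thompson_F\<^esub> y \<otimes>\<^bsub>thompson_F\<^esub> z = x \<otimes>\<^bsub>thompson_F\<^esub> (y \<otimes>\<^bsub>thompson_F\<^esub> z)"
    by (auto simp: carrier_thompson_F thompson_mult F_ext_comp o_assoc)
next
  fix x assume "x \<in> carrier thompson_F"
  then obtain f where f: "f \<in> F_ext" "x = restr f" by (auto simp: carrier_thompson_F)
  have "restr (inverse_fun f) \<otimes>\<^bsub>thompson_F\<^esub> x = \<one>\<^bsub>thompson_F\<^esub>"
    using f by (simp add: thompson_mult thompson_one F_ext_inv PL2_inverse_comp F_ext_PL2)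
  then show "\<exists>y\<in>carrier thompson_F. y \<otimes>\<^bsub>thompson_F\<^esub> x = \<one>\<^bsub>thompson_F\<^esub>"
    using f F_ext_inv by (auto simp: carrier_thompson_F)
qed (use F_ext_comp F_ext_id in \<open>auto simp: carrier_thompson_F thompson_mult thompson_one\<close>)

lemma thompson_inv:
  assumes "f \<in> F_ext"
  shows "inv\<^bsub>thompson_F\<^esub> (restr f) = restr (inverse_fun f)"
proof (rule group.inv_equality[OF group_thompson_F])
  show "restr (inverse_fun f) \<otimes>\<^bsub>thompson_F\<^esub> restr f = \<one>\<^bsub>thompson_F\<^esub>"
    using assms by (simp add: thompson_mult thompson_one F_ext_inv PL2_inverse_comp F_ext_PL2)
qed (intro restr_carrier F_ext_inv assms)+

section \<open>Generation by x0 and x1\<close>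

definition x0_ext :: "real \<Rightarrow> real" where
  "x0_ext t = (if t \<le> 0 then t else if t \<le> 1/2 then t / 2 else if t \<le> 3/4 then t - 1/4
               else if t \<le> 1 then 2 * t - 1 else t)"

definition x0_ext_inv :: "real \<Rightarrow> real" where
  "x0_ext_inv t = (if t \<le> 0 then t else if t \<le> 1/4 then 2 * t else if t \<le> 1/2 then t + 1/4
               else if t \<le> 1 then (t + 1) / 2 else t)"

lemma x0_ext_left: "x0_ext_inv (x0_ext t) = t"
  by (auto simp: x0_ext_def x0_ext_inv_def)

lemma x0_ext_right: "x0_ext (x0_ext_inv t) = t"
  by (auto simp: x0_ext_def x0_ext_inv_def field_simps)

lemma inverse_x0_ext: "inverse_fun x0_ext = x0_ext_inv"
  by (rule inv_equality) (simp_all add: x0_ext_left x0_ext_right)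

lemma dyadic_quarters: "1/2 \<in> dyadic" "3/4 \<in> dyadic" "1/4 \<in> dyadic"
  using dyadic_frac[of 1 1] dyadic_frac[of 3 2] dyadic_frac[of 1 2] by simp_all

lemma x0_ext_PL2: "x0_ext \<in> PL2"
proof -
  let ?D = "{0, 1/2, 3/4, 1} :: real set"
  have "pl_on ?D x0_ext"
    unfolding pl_on_def
  proof (intro allI impI, elim conjE)
    fix a b :: real assume ab: "a < b" "{a<..<b} \<inter> ?D = {}"
    have "\<not> (a < d \<and> d < b)" if "d \<in> ?D" for d
      using gap_notin[OF ab(2), of d] that by blast
    from this[of 0] this[of "1/2"] this[of "3/4"] this[of 1]
    consider "b \<le> 0" | "0 \<le> a" "b \<le> 1/2" | "1/2 \<le> a" "b \<le> 3/4" | "3/4 \<le> a" "b \<le> 1" | "1 \<le> a"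
      by simp linarith
    then show "\<exists>k. \<exists>c\<in>dyadic. \<forall>t\<in>{a..b}. x0_ext t = 2 powi k * t + c"
    proof cases
      case 1 then show ?thesis by (intro exI[of _ 0] bexI[of _ 0]) (auto simp: x0_ext_def)
    next
      case 2 then show ?thesis
        by (intro exI[of _ "-1"] bexI[of _ 0]) (auto simp: x0_ext_def power_int_minus)
    next
      case 3
      have "-(1/4) \<in> dyadic" by (intro dyadic_uminus dyadic_quarters)
      then show ?thesis using 3 by (intro exI[of _ 0] bexI[of _ "-(1/4)"]) (auto simp: x0_ext_def)
    next
      case 4
      have "-1 \<in> dyadic" using dyadic_of_int[of "-1"] by simp
      then show ?thesis using 4 by (intro exI[of _ 1] bexI[of _ "-1"]) (auto simp: x0_ext_def)
    next
      case 5 then show ?thesis by (intro exI[of _ 0] bexI[of _ 0]) (auto simp: x0_ext_def)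
    qed
  qed
  moreover have "strict_mono x0_ext"
    by (rule strict_monoI) (auto simp: x0_ext_def)
  moreover have "surj x0_ext" by (rule surjI, rule x0_ext_right)
  moreover have "?D \<subseteq> dyadic" using dyadic_quarters by simp
  ultimately show ?thesis unfolding PL2_def by blast
qed

lemma x0_ext_F_ext: "x0_ext \<in> F_ext"
  using x0_ext_PL2 by (auto simp: F_ext_def x0_ext_def)

lemma restr_x0_ext: "restr x0_ext = x0"
  by (auto simp: x0_def x0_ext_def restrict_def fun_eq_iff)

text \<open>The conjugate of \<open>f\<close> by the map taking u to a + u / 2^k. It copies
  \<open>x0_ext\<close> to small dyadic intervals, contracts towards 0 (\<open>a\<close> = 0), and
  carries the coordinate u = t - 1 back to t (\<open>a\<close> = 1, \<open>k\<close> = 0).\<close>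

definition rescale :: "real \<Rightarrow> nat \<Rightarrow> (real \<Rightarrow> real) \<Rightarrow> real \<Rightarrow> real" where
  "rescale a k f t = a + f ((t - a) * 2 ^ k) / 2 ^ k"

lemma rescale_PL2:
  assumes "a \<in> dyadic" "f \<in> PL2" shows "rescale a k f \<in> PL2"
proof -
  have "rescale a k f = (\<lambda>t. 2 powi (- int k) * t + a) \<circ> f \<circ> (\<lambda>t. 2 powi int k * t + - (a * 2 powi int k))"
    by (auto simp: rescale_def power_int_minus field_simps)
  moreover have "- (a * 2 powi int k) \<in> dyadic"
    using assms(1) dyadic_powi by (intro dyadic_uminus dyadic_mult)
  ultimately show ?thesis
    using assms by (simp only: PL2_comp PL2_affine)
qed

lemma inverse_rescale:
  assumes "f \<in> PL2" shows "inverse_fun (rescale a k f) = rescale a k (inverse_fun f)"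
  by (rule inv_equality) (simp_all add: rescale_def PL2_inv[OF assms])

text \<open>The usual infinite generating sequence of F: x_i is a copy of x_0 on the last interval
  of length 2^(-i).\<close>

definition x_gen :: "nat \<Rightarrow> real \<Rightarrow> real" where
  "x_gen i = rescale (1 - 1 / 2 ^ i) i x0_ext"

lemma rescale_comb_point:
  "rescale (1 - 1 / 2 ^ i) i f t = 1 - 1 / 2 ^ i + f (1 - (1 - t) * 2 ^ i) / 2 ^ i"
proof -
  have "(t - (1 - 1 / 2 ^ i)) * 2 ^ i = 1 - (1 - t) * 2 ^ i" by (simp add: field_simps)
  then show ?thesis by (simp only: rescale_def)
qed

lemma x_gen_apply: "x_gen i t = 1 - 1 / 2 ^ i + x0_ext (1 - (1 - t) * 2 ^ i) / 2 ^ i"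
  by (simp only: x_gen_def rescale_comb_point)

lemma inverse_x_gen: "inverse_fun (x_gen i) t = 1 - 1 / 2 ^ i + x0_ext_inv (1 - (1 - t) * 2 ^ i) / 2 ^ i"
  by (simp only: x_gen_def inverse_rescale[OF x0_ext_PL2] inverse_x0_ext rescale_comb_point)

lemma comb_point_cancel: "1 - 1 / 2 ^ i + (1 - (1 - t) * 2 ^ i) / 2 ^ i = (t::real)"
  by (simp add: diff_divide_distrib)

lemma dyadic_one_minus: "1 - 1 / 2 ^ i \<in> dyadic"
  using dyadic_frac[of 1 i] by (auto intro!: dyadic_diff)

lemma x_gen_F_ext: "x_gen i \<in> F_ext"
proof -
  have "x_gen i t = t" if "t \<notin> {0<..<1}" for t
  proof (cases "t \<le> 0")
    case True
    then have "1 * 1 \<le> (1 - t) * 2 ^ i" by (intro mult_mono) simp_all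
    then have "x0_ext (1 - (1 - t) * 2 ^ i) = 1 - (1 - t) * 2 ^ i" by (simp add: x0_ext_def)
    then show ?thesis by (simp only: x_gen_apply comb_point_cancel)
  next
    case False
    then have "(1 - t) * 2 ^ i \<le> 0" using that by (simp add: mult_le_0_iff)
    then have "x0_ext (1 - (1 - t) * 2 ^ i) = 1 - (1 - t) * 2 ^ i" by (auto simp: x0_ext_def)
    then show ?thesis by (simp only: x_gen_apply comb_point_cancel)
  qed
  then show ?thesis
    using rescale_PL2[OF dyadic_one_minus x0_ext_PL2] by (auto simp: F_ext_def x_gen_def)
qed

lemma x_gen_0: "x_gen 0 = x0_ext"
  by (auto simp: x_gen_apply)

lemma restr_x_gen_1: "restr (x_gen 1) = x1"
  by (auto simp: x_gen_apply x1_def x0_ext_def restrict_def fun_eq_iff field_simps)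

text \<open>On [3/4, 1] the map \<open>x0_ext\<close> doubles the distance to 1, so conjugation by
  it halves the scale. For i \<ge> 1, x_i moves only points above 1/2, the image of 3/4, so up to
  3/4 both sides are the identity.\<close>

lemma x_gen_Suc:
  assumes "i \<ge> 1" shows "x_gen (Suc i) = inverse_fun x0_ext \<circ> x_gen i \<circ> x0_ext"
proof
  fix t :: real
  consider "t \<le> 3/4" | "3/4 < t" "t \<le> 1" | "1 < t" by linarith
  then show "x_gen (Suc i) t = (inverse_fun x0_ext \<circ> x_gen i \<circ> x0_ext) t"
  proof cases
    case 1
    have le: "x_gen j s = s" if "s \<le> 1 - 1 / 2 ^ j" for j s
    proof -
      have "1 \<le> (1 - s) * 2 ^ j" using that by (simp add: field_simps)
      then have "x0_ext (1 - (1 - s) * 2 ^ j) = 1 - (1 - s) * 2 ^ j" by (simp add: x0_ext_def)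
      then show ?thesis by (simp only: x_gen_apply comb_point_cancel)
    qed
    have i: "(2::real) ^ 1 \<le> 2 ^ i" using assms by (intro power_increasing) simp_all
    have "x0_ext t \<le> 1/2" using 1 by (simp add: x0_ext_def)
    also have "\<dots> \<le> 1 - 1 / 2 ^ i" using i by (simp add: field_simps)
    finally have "x_gen i (x0_ext t) = x0_ext t" by (rule le)
    moreover have "1 / 2 ^ Suc i \<le> (1 / 4 :: real)" using i by (simp add: field_simps)
    then have "t \<le> 1 - 1 / 2 ^ Suc i" using 1 by linarith
    then have "x_gen (Suc i) t = t" by (rule le)
    ultimately show ?thesis by (simp add: PL2_inv[OF x0_ext_PL2])
  next
    case 2
    then have x0: "x0_ext t = 2 * t - 1" by (simp add: x0_ext_def)
    have le: "1/2 \<le> x_gen i (2 * t - 1)" "x_gen i (2 * t - 1) \<le> 1"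
    proof -
      have i: "(2::real) ^ 1 \<le> 2 ^ i" using assms by (intro power_increasing) simp_all
      have mono: "x_gen i s \<le> x_gen i s' \<longleftrightarrow> s \<le> s'" for s s'
        by (rule PL2_le[OF F_ext_PL2[OF x_gen_F_ext]])
      have "1 - (1 - 1/2) * 2 ^ i \<le> (0::real)" using i by simp
      then have "x_gen i (1/2) = 1/2" by (simp add: x_gen_apply x0_ext_def field_simps)
      then show "1/2 \<le> x_gen i (2 * t - 1)" using mono[of "1/2" "2 * t - 1"] 2 by simp
      show "x_gen i (2 * t - 1) \<le> 1"
        using mono[of "2 * t - 1" 1] 2 F_ext_ends(2)[OF x_gen_F_ext, of 1 i] by simp
    qed
    then have "x0_ext_inv (x_gen i (2 * t - 1)) = (x_gen i (2 * t - 1) + 1) / 2"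
      by (auto simp: x0_ext_inv_def)
    also have "\<dots> = x_gen (Suc i) t"
    proof -
      have "1 - (1 - (2 * t - 1)) * 2 ^ i = 1 - (1 - t) * 2 ^ Suc i" by (simp add: algebra_simps)
      then show ?thesis unfolding x_gen_apply by (simp add: field_simps)
    qed
    finally show ?thesis using x0 by (simp add: inverse_x0_ext)
  next
    case 3
    then show ?thesis
      using F_ext_ends(2)[OF x_gen_F_ext, of t] by (simp add: x0_ext_def x0_ext_inv_def inverse_x0_ext)
  qed
qed

definition F_gen :: "(real \<Rightarrow> real) set" where
  "F_gen = {f \<in> F_ext. restr f \<in> generate thompson_F {x0, x1}}"

lemma x0_x1_carrier: "{x0, x1} \<subseteq> carrier thompson_F"
  using restr_carrier[OF x0_ext_F_ext] restr_carrier[OF x_gen_F_ext[of 1]]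
  by (simp only: restr_x0_ext restr_x_gen_1) simp

lemma F_gen_id: "id \<in> F_gen"
  unfolding F_gen_def using generate.one[of thompson_F] F_ext_id by (simp add: thompson_one)

lemma F_gen_comp: "f \<in> F_gen \<Longrightarrow> g \<in> F_gen \<Longrightarrow> f \<circ> g \<in> F_gen"
  unfolding F_gen_def using generate.eng[of _ thompson_F] by (simp add: F_ext_comp flip: thompson_mult)

lemma F_gen_inverse: "f \<in> F_gen \<Longrightarrow> inverse_fun f \<in> F_gen"
  unfolding F_gen_def using group.generate_m_inv_closed[OF group_thompson_F x0_x1_carrier]
  by (simp add: F_ext_inv flip: thompson_inv)

lemma x_gen_F_gen: "x_gen i \<in> F_gen"
proof (induction i)
  case 0
  show ?case unfolding F_gen_def using x0_ext_F_ext
    by (simp add: x_gen_0 restr_x0_ext generate.incl)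
next
  case (Suc i)
  show ?case
  \<comment> \<open>The conjugation recursion starts at x_2; x_1 is a generator itself.\<close>
  proof (cases "i = 0")
    case True
    then show ?thesis unfolding F_gen_def using x_gen_F_ext[of 1]
      by (simp add: restr_x_gen_1[unfolded One_nat_def] generate.incl)
  next
    case False
    have "x0_ext \<in> F_gen" unfolding F_gen_def using x0_ext_F_ext
      by (simp add: restr_x0_ext generate.incl)
    then show ?thesis using Suc False by (simp only: x_gen_Suc F_gen_comp F_gen_inverse Suc_leI not_gr_zero One_nat_def neq0_conv)
  qed
qed

section \<open>Standard dyadic partitions and tree diagrams\<close>

definition std_interval :: "real \<Rightarrow> real \<Rightarrow> bool" where
  "std_interval a b \<longleftrightarrow> (\<exists>(j::int) m. a = j / 2 ^ m \<and> b = (j + 1) / 2 ^ m)"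

definition std_partition :: "nat \<Rightarrow> (nat \<Rightarrow> real) \<Rightarrow> bool" where
  "std_partition N p \<longleftrightarrow> p 0 = 0 \<and> p N = 1 \<and> (\<forall>i<N. std_interval (p i) (p (Suc i)))"

text \<open>The leaves of the right comb, as a binary tree, are the N intervals between these points.\<close>

definition comb :: "nat \<Rightarrow> nat \<Rightarrow> real" where
  "comb N i = (if i < N then 1 - 1 / 2 ^ i else 1)"

lemma std_interval_less: "std_interval a b \<Longrightarrow> a < b"
  by (auto simp: std_interval_def divide_strict_right_mono)

lemma std_partition_mono:
  assumes "std_partition N p" "i \<le> j" "j \<le> N" shows "p i \<le> p j"
  using assms(2,3)
proof (induction j rule: dec_induct)
  case (step n)
  then have "p n < p (Suc n)"
    using assms(1) std_interval_less by (auto simp: std_partition_def)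
  then show ?case using step by simp
qed simp

text \<open>An interval of length 2^(-n) \<ge> 2^(-m) has multiples of 2^(-n) as ends; were n < m,
  both ends would be even multiples of 2^(-m).\<close>

lemma std_interval_odd:
  assumes ab: "std_interval a b" "1 / 2 ^ m \<le> b - a"
    and j: "odd j" "a = of_int j / 2 ^ m \<or> b = of_int j / 2 ^ m"
  shows "b - a = 1 / 2 ^ m"
proof -
  obtain l :: int and n where l: "a = l / 2 ^ n" "b = (l + 1) / 2 ^ n"
    using ab(1) unfolding std_interval_def by auto
  have len: "b - a = 1 / 2 ^ n" by (simp add: l flip: diff_divide_distrib)
  then have "1 / 2 ^ m \<le> (1::real) / 2 ^ n" using ab(2) by simp
  then have "(2::real) ^ n \<le> 2 ^ m" by (simp add: field_simps)
  then have "n \<le> m" by simp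
  then have m: "(2::real) ^ m = 2 ^ n * 2 ^ (m - n)" by (simp flip: power_add)
  have "real_of_int j = real_of_int (l * 2 ^ (m - n)) \<or> real_of_int j = real_of_int ((l + 1) * 2 ^ (m - n))"
  proof -
    have "real_of_int j = a * 2 ^ m \<or> real_of_int j = b * 2 ^ m" using j(2) by auto
    moreover have "a * 2 ^ m = real_of_int (l * 2 ^ (m - n))" by (simp add: l m)
    moreover have "b * 2 ^ m = real_of_int ((l + 1) * 2 ^ (m - n))" by (simp add: l m)
    ultimately show ?thesis by (simp only:)
  qed
  then have "j = l * 2 ^ (m - n) \<or> j = (l + 1) * 2 ^ (m - n)" by (simp only: of_int_eq_iff)
  then have "m - n = 0" using j(1) by (cases "m - n") auto
  then show ?thesis using \<open>n \<le> m\<close> len by simp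
qed

lemma std_interval_merge:
  assumes "even j" "m > 0"
  shows "std_interval (of_int j / 2 ^ m) ((of_int j + 2) / 2 ^ m)"
proof -
  obtain i n where "j = 2 * i" "m = Suc n" using assms by (auto elim: evenE simp: gr0_conv_Suc)
  then show ?thesis
    unfolding std_interval_def by (intro exI[of _ i] exI[of _ n]) (simp add: field_simps)
qed

text \<open>A shortest interval is adjacent to an interval of the same length with which it forms
  a standard dyadic interval.\<close>

lemma std_partition_siblings:
  assumes p: "std_partition N p" and N: "N \<ge> 2"
  shows "\<exists>q. Suc (Suc q) \<le> N \<and> std_interval (p q) (p (Suc (Suc q))) \<and>
    p (Suc q) = (p q + p (Suc (Suc q))) / 2"
proof -
  have std: "std_interval (p k) (p (Suc k))" if "k < N" for k
    using p that unfolding std_partition_def by blast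
  have ends: "p 0 = 0" "p N = 1" using p unfolding std_partition_def by auto
  define len where "len k = p (Suc k) - p k" for k
  have "Min (len ` {..<N}) \<in> len ` {..<N}" using N by (intro Min_in) (auto simp: lessThan_empty_iff)
  then obtain i where i: "i < N" "len i = Min (len ` {..<N})" by auto
  have min: "len i \<le> len k" if "k < N" for k
    unfolding i(2) using that by (intro Min_le) auto
  obtain j :: int and m where jm: "p i = j / 2 ^ m" "p (Suc i) = (j + 1) / 2 ^ m"
    using std[OF i(1)] by (auto simp: std_interval_def)
  have len: "len i = 1 / 2 ^ m" by (simp add: len_def jm flip: diff_divide_distrib)
  \<comment> \<open>Otherwise a shortest interval fills [0, 1] and leaves no room for a second
    one.\<close>
  have m: "m > 0"
  proof (rule ccontr)
    assume "\<not> m > 0"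
    then have "p (Suc i) - p i = 1" using len by (simp add: len_def)
    moreover have "0 \<le> p i" "p (Suc i) \<le> 1"
      using std_partition_mono[OF p, of 0 i] std_partition_mono[OF p, of "Suc i" N] i ends by auto
    ultimately have pi: "p i = 0" "p (Suc i) = 1" by auto
    show False
    proof (cases i)
      case 0
      have "p 1 < p 2" using std_interval_less[OF std[of 1]] N by (simp add: numeral_2_eq_2)
      moreover have "p 2 \<le> p N" by (rule std_partition_mono[OF p]) (use N in auto)
      ultimately show False using pi ends 0 by simp
    next
      case (Suc i')
      have "p 0 < p 1" using std_interval_less[OF std[of 0]] N by simp
      moreover have "p 1 \<le> p i" by (rule std_partition_mono[OF p]) (use Suc i in auto)
      ultimately show False using pi ends by simp
    qed
  qed
  show ?thesis
  \<comment> \<open>In the binary tree, even j means a left child, whose sibling follows, and odd j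
    a right child, whose sibling precedes. The neighbour is at least as long and shares an end with
    odd numerator, so \<open>std_interval_odd\<close> fixes its length.\<close>
  proof (cases "even j")
    case True
    \<comment> \<open>If the interval ended at 1, then j + 1 = 2^m would be even.\<close>
    have "Suc i \<noteq> N"
    proof
      assume "Suc i = N"
      then have "real_of_int (j + 1) = real_of_int (2 ^ m)" using jm(2) ends by (simp add: field_simps)
      then have "j + 1 = 2 ^ m" by (simp only: of_int_eq_iff)
      moreover have "even ((2::int) ^ m)" using m by simp
      ultimately show False using True by (metis even_plus_one_iff)
    qed
    then have iN: "Suc i < N" using i by simp
    have "1 / 2 ^ m \<le> p (Suc (Suc i)) - p (Suc i)"
      using min[OF iN] unfolding len by (simp only: len_def)
    then have "p (Suc (Suc i)) - p (Suc i) = 1 / 2 ^ m"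
      by (rule std_interval_odd[OF std[OF iN], of m "j + 1"]) (use jm True in auto)
    then have eq: "p (Suc (Suc i)) = (j + 2) / 2 ^ m" using jm by (simp add: field_simps)
    have "(real_of_int j + 1) / 2 ^ m = (j / 2 ^ m + (j + 2) / 2 ^ m) / 2" by (simp add: field_simps)
    then show ?thesis
      using std_interval_merge[OF True m] iN
      by (intro exI[of _ i]) (simp only: jm eq Suc_le_eq simp_thms of_int_add of_int_1 of_int_numeral)
  next
    case False
    have "i \<noteq> 0" using False jm(1) ends by (cases i) auto
    then obtain k where k: "i = Suc k" by (cases i) auto
    then have kN: "k < N" using i by simp
    have "p i - p k = 1 / 2 ^ m"
      using std_interval_odd[OF std[OF kN], of m j] min[OF kN] len jm False k by (simp add: len_def)
    then have pk: "p k = of_int (j - 1) / 2 ^ m" using jm by (simp add: field_simps)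
    have "even (j - 1)" using False by simp
    from std_interval_merge[OF this m]
    have "std_interval (p k) (p (Suc (Suc k)))" unfolding k[symmetric] jm(2) pk by (simp add: add.commute)
    moreover have "p (Suc k) = (p k + p (Suc (Suc k))) / 2"
      unfolding k[symmetric] jm pk by (simp add: field_simps)
    ultimately show ?thesis using i k by (intro exI[of _ k]) simp
  qed
qed

text \<open>Parametrising both intervals by [0, 1] hides the slopes: compositions chain at once, and
  the halves arise by replacing u with u / 2 and (1 + u) / 2.\<close>

definition maps_linearly :: "(real \<Rightarrow> real) \<Rightarrow> real \<Rightarrow> real \<Rightarrow> real \<Rightarrow> real \<Rightarrow> bool" where
  "maps_linearly f a b c d \<longleftrightarrow> (\<forall>u\<in>{0..1}. f (a + u * (b - a)) = c + u * (d - c))"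

lemma maps_linearly_comp:
  "maps_linearly f a b c d \<Longrightarrow> maps_linearly g c d e h \<Longrightarrow> maps_linearly (g \<circ> f) a b e h"
  by (simp add: maps_linearly_def)

lemma maps_linearly_id: "maps_linearly id a b a b"
  by (simp add: maps_linearly_def)

lemma maps_linearly_halves:
  assumes "maps_linearly f a b c d"
  shows "maps_linearly f a ((a + b) / 2) c ((c + d) / 2)"
    and "maps_linearly f ((a + b) / 2) b ((c + d) / 2) d"
  unfolding maps_linearly_def
proof safe
  fix u :: real assume u: "u \<in> {0..1}"
  have "u / 2 \<in> {0..1}" "(1 + u) / 2 \<in> {0..1}" using u by auto
  from this[THEN assms[unfolded maps_linearly_def, rule_format]]
  have 1: "f (a + u / 2 * (b - a)) = c + u / 2 * (d - c)"
    and 2: "f (a + (1 + u) / 2 * (b - a)) = c + (1 + u) / 2 * (d - c)" .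
  have 3: "a + u * ((a + b) / 2 - a) = a + u / 2 * (b - a)"
    and 4: "(a + b) / 2 + u * (b - (a + b) / 2) = a + (1 + u) / 2 * (b - a)"
    by (simp_all add: field_simps)
  show "f (a + u * ((a + b) / 2 - a)) = c + u * ((c + d) / 2 - c)"
    unfolding 3 1 by (simp add: field_simps)
  show "f ((a + b) / 2 + u * (b - (a + b) / 2)) = (c + d) / 2 + u * (d - (c + d) / 2)"
    unfolding 4 2 by (simp add: field_simps)
qed

lemma affine_maps_linearly:
  assumes "\<forall>t\<in>{a..b}. f t = m * t + c" "a \<le> b"
  shows "maps_linearly f a b (f a) (f b)"
  unfolding maps_linearly_def
proof
  fix u :: real assume u: "u \<in> {0..1}"
  have "u * (b - a) \<le> 1 * (b - a)" "0 \<le> u * (b - a)"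
    using u assms(2) by (intro mult_right_mono mult_nonneg_nonneg; simp)+
  then have "a + u * (b - a) \<in> {a..b}" by simp
  then show "f (a + u * (b - a)) = f a + u * (f b - f a)"
    using assms by (simp add: algebra_simps)
qed

lemma inverse_x_gen_below:
  assumes "t \<le> 1 - 1 / 2 ^ q" shows "inverse_fun (x_gen q) t = t"
proof -
  have "1 \<le> (1 - t) * 2 ^ q" using assms by (simp add: field_simps)
  then have "x0_ext_inv (1 - (1 - t) * 2 ^ q) = 1 - (1 - t) * 2 ^ q" by (simp add: x0_ext_inv_def)
  then show ?thesis by (simp only: inverse_x_gen comb_point_cancel)
qed

lemma inverse_x_gen_at:
  "inverse_fun (x_gen q) (1 - s / 2 ^ q) = 1 - (1 - x0_ext_inv (1 - s)) / 2 ^ q"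
  by (simp add: inverse_x_gen diff_divide_distrib)

text \<open>In terms of trees: the inverse of x_gen q maps a right comb whose leaf q has been split to
  the right comb with one more leaf.\<close>

lemma inverse_x_gen_comb:
  assumes "Suc q < M"
  shows "i < q \<Longrightarrow> maps_linearly (inverse_fun (x_gen q)) (comb M i) (comb M (Suc i))
           (comb (Suc M) i) (comb (Suc M) (Suc i))"
    and "maps_linearly (inverse_fun (x_gen q)) (comb M q) ((comb M q + comb M (Suc q)) / 2)
           (comb (Suc M) q) (comb (Suc M) (Suc q))"
    and "maps_linearly (inverse_fun (x_gen q)) ((comb M q + comb M (Suc q)) / 2) (comb M (Suc q))
           (comb (Suc M) (Suc q)) (comb (Suc M) (Suc (Suc q)))"
    and "q < i \<Longrightarrow> i < M \<Longrightarrow> maps_linearly (inverse_fun (x_gen q)) (comb M i) (comb M (Suc i))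
           (comb (Suc M) (Suc i)) (comb (Suc M) (Suc (Suc i)))"
proof -
  let ?Y = "inverse_fun (x_gen q)"
  show "maps_linearly ?Y (comb M i) (comb M (Suc i)) (comb (Suc M) i) (comb (Suc M) (Suc i))"
    if "i < q"
    unfolding maps_linearly_def
  proof
    fix u :: real assume u: "u \<in> {0..1}"
    have c: "comb M i = 1 - 1 / 2 ^ i" "comb M (Suc i) = 1 - 1 / 2 ^ Suc i"
      "comb (Suc M) i = 1 - 1 / 2 ^ i" "comb (Suc M) (Suc i) = 1 - 1 / 2 ^ Suc i"
      using assms that by (auto simp: comb_def)
    have "u * (1 / 2 ^ Suc i) \<le> 1 * (1 / 2 ^ Suc i)"
      using u by (intro mult_right_mono) auto
    moreover have "(1::real) / 2 ^ i = 2 * (1 / 2 ^ Suc i)" by simp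
    moreover have "(1::real) / 2 ^ q \<le> 1 / 2 ^ Suc i"
      using that by (intro divide_left_mono power_increasing) auto
    ultimately have "comb M i + u * (comb M (Suc i) - comb M i) \<le> 1 - 1 / 2 ^ q"
      unfolding c by (simp add: algebra_simps)
    then show "?Y (comb M i + u * (comb M (Suc i) - comb M i)) =
        comb (Suc M) i + u * (comb (Suc M) (Suc i) - comb (Suc M) i)"
      by (simp only: inverse_x_gen_below) (simp only: c)
  qed
  \<comment> \<open>With t = 1 - s / 2^q, leaf q is the range 1/2 \<le> s \<le> 1. Its halves are
    given by 1 - s in [0, 1/4] and in [1/4, 1/2], where \<open>x0_ext_inv\<close> is doubling and
    translation by 1/4.\<close>
  have c: "comb M q = 1 - 1 / 2 ^ q" "comb M (Suc q) = 1 - (1/2) / 2 ^ q"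
      "comb (Suc M) q = 1 - 1 / 2 ^ q" "comb (Suc M) (Suc q) = 1 - (1/2) / 2 ^ q"
      "comb (Suc M) (Suc (Suc q)) = 1 - (1/4) / 2 ^ q"
    using assms by (auto simp: comb_def)
  show "maps_linearly ?Y (comb M q) ((comb M q + comb M (Suc q)) / 2)
          (comb (Suc M) q) (comb (Suc M) (Suc q))"
    unfolding maps_linearly_def c
  proof
    fix u :: real assume u: "u \<in> {0..1}"
    have "1 - 1 / 2 ^ q + u * ((1 - 1 / 2 ^ q + (1 - 1/2 / 2 ^ q)) / 2 - (1 - 1 / 2 ^ q))
        = 1 - (1 - u / 4) / 2 ^ q" by (simp add: field_simps)
    moreover have "x0_ext_inv (1 - (1 - u / 4)) = u / 2" using u by (auto simp: x0_ext_inv_def)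
    ultimately show "?Y (1 - 1 / 2 ^ q + u * ((1 - 1 / 2 ^ q + (1 - 1/2 / 2 ^ q)) / 2 - (1 - 1 / 2 ^ q)))
        = 1 - 1 / 2 ^ q + u * (1 - 1/2 / 2 ^ q - (1 - 1 / 2 ^ q))"
      by (simp only: inverse_x_gen_at) (simp add: field_simps)
  qed
  show "maps_linearly ?Y ((comb M q + comb M (Suc q)) / 2) (comb M (Suc q))
           (comb (Suc M) (Suc q)) (comb (Suc M) (Suc (Suc q)))"
    unfolding maps_linearly_def c
  proof
    fix u :: real assume u: "u \<in> {0..1}"
    have "(1 - 1 / 2 ^ q + (1 - 1/2 / 2 ^ q)) / 2 + u * ((1 - 1/2 / 2 ^ q) - (1 - 1 / 2 ^ q + (1 - 1/2 / 2 ^ q)) / 2)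
        = 1 - (3/4 - u / 4) / 2 ^ q" by (simp add: field_simps)
    moreover have "x0_ext_inv (1 - (3/4 - u / 4)) = 1/2 + u / 4"
      using u by (auto simp: x0_ext_inv_def)
    ultimately show "?Y ((1 - 1 / 2 ^ q + (1 - 1/2 / 2 ^ q)) / 2 + u * ((1 - 1/2 / 2 ^ q) - (1 - 1 / 2 ^ q + (1 - 1/2 / 2 ^ q)) / 2))
        = 1 - 1/2 / 2 ^ q + u * (1 - 1/4 / 2 ^ q - (1 - 1/2 / 2 ^ q))"
      by (simp only: inverse_x_gen_at) (simp add: field_simps)
  qed
  show "maps_linearly ?Y (comb M i) (comb M (Suc i)) (comb (Suc M) (Suc i)) (comb (Suc M) (Suc (Suc i)))"
    if i: "q < i" "i < M"
  proof -
    \<comment> \<open>To the right of leaf q the map halves the distance to 1, which moves every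
      comb point below 1 to the next one.\<close>
    have Y: "?Y t = 1/2 * t + 1/2" if t: "t \<in> {comb M i..comb M (Suc i)}" for t
    proof -
      have "(1::real) / 2 ^ i \<le> 1 / 2 ^ Suc q"
        using i by (intro divide_left_mono power_increasing) auto
      then have "1 - 1 / 2 ^ Suc q \<le> t" using t i by (auto simp: comb_def)
      moreover have "t \<le> 1" using t by (auto simp: comb_def split: if_splits)
      ultimately have "1/2 \<le> 1 - (1 - t) * 2 ^ q" "1 - (1 - t) * 2 ^ q \<le> 1"
        by (simp_all add: field_simps)
      then have "x0_ext_inv (1 - (1 - t) * 2 ^ q) = (1 - (1 - t) * 2 ^ q + 1) / 2"
        by (auto simp: x0_ext_inv_def)
      then have "?Y t = 1 - 1 / 2 ^ q + (1 - (1 - t) * 2 ^ q + 1) / 2 / 2 ^ q"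
        by (simp only: inverse_x_gen)
      then show ?thesis by (simp add: diff_divide_distrib add_divide_distrib)
    qed
    have le: "comb M i \<le> comb M (Suc i)" by (auto simp: comb_def field_simps)
    have "?Y (comb M i) = comb (Suc M) (Suc i)" "?Y (comb M (Suc i)) = comb (Suc M) (Suc (Suc i))"
      using le i by (auto simp: Y comb_def field_simps)
    then show ?thesis using affine_maps_linearly[of "comb M i" "comb M (Suc i)" ?Y "1/2" "1/2"] Y le by simp
  qed
qed

text \<open>Merging the siblings q and q + 1 leaves a partition with one interval fewer, which is
  mapped to a comb by induction. The merged interval becomes leaf q; after it is split again, the
  inverse of \<open>x_gen q\<close> restores the comb shape.\<close>

lemma partition_to_comb:
  assumes "std_partition N p"
  shows "\<exists>g\<in>F_gen. \<forall>i<N. maps_linearly g (p i) (p (Suc i)) (comb N i) (comb N (Suc i))"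
  using assms
proof (induction N arbitrary: p rule: less_induct)
  case (less N)
  have "N \<noteq> 0" using less.prems unfolding std_partition_def by (metis zero_neq_one)
  then consider "N = 1" | "N \<ge> 2" by linarith
  then show ?case
  proof cases
    case 1
    then have "p 0 = comb 1 0" "p (Suc 0) = comb 1 (Suc 0)"
      using less.prems by (auto simp: std_partition_def comb_def)
    then have "\<forall>i<N. maps_linearly id (p i) (p (Suc i)) (comb N i) (comb N (Suc i))"
      using 1 maps_linearly_id by simp
    then show ?thesis using F_gen_id by blast
  next
    case 2
    obtain q where q: "Suc (Suc q) \<le> N" "std_interval (p q) (p (Suc (Suc q)))"
        "p (Suc q) = (p q + p (Suc (Suc q))) / 2"
      using std_partition_siblings[OF less.prems 2] by blast
    define M where "M = N - 1"
    have N: "N = Suc M" and qM: "q < M" using q 2 by (auto simp: M_def)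
    define p' where "p' i = (if i \<le> q then p i else p (Suc i))" for i
    have "std_partition M p'"
      unfolding std_partition_def
    proof (intro conjI allI impI)
      fix i assume "i < M"
      then show "std_interval (p' i) (p' (Suc i))"
        using less.prems q(2) N by (cases i q rule: linorder_cases) (auto simp: p'_def std_partition_def)
    qed (use less.prems N qM in \<open>auto simp: p'_def std_partition_def\<close>)
    then obtain g where g: "g \<in> F_gen"
        "\<And>i. i < M \<Longrightarrow> maps_linearly g (p' i) (p' (Suc i)) (comb M i) (comb M (Suc i))"
      using less.IH[of M] N by blast
    have gq: "maps_linearly g (p q) (p (Suc q)) (comb M q) ((comb M q + comb M (Suc q)) / 2)"
      "maps_linearly g (p (Suc q)) (p (Suc (Suc q))) ((comb M q + comb M (Suc q)) / 2) (comb M (Suc q))"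
      unfolding q(3) using maps_linearly_halves[OF g(2)[OF qM]] by (simp_all add: p'_def)
    have gl: "maps_linearly g (p i) (p (Suc i)) (comb M i) (comb M (Suc i))" if "i < q" for i
      using g(2)[of i] that qM by (simp add: p'_def)
    have gr: "maps_linearly g (p (Suc i)) (p (Suc (Suc i))) (comb M i) (comb M (Suc i))"
      if "q < i" "i < M" for i
      using g(2)[of i] that by (simp add: p'_def)
    have split: "i < q \<or> i = q \<or> i = Suc q \<or> (\<exists>k. i = Suc k \<and> q < k \<and> k < M)" if "i < N" for i
      using that N by (cases i) auto
    show ?thesis
    proof (cases "Suc q = M")
      \<comment> \<open>Leaf q is the last one, and its halves are already the last two leaves of
        the larger comb.\<close>
      case True
      have last: "(comb M q + comb M (Suc q)) / 2 = comb N (Suc q)" "comb M (Suc q) = comb N (Suc (Suc q))"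
        using True N by (auto simp: comb_def field_simps)
      have below: "comb M i = comb N i" if "i \<le> q" for i using that True N by (simp add: comb_def)
      have "maps_linearly g (p i) (p (Suc i)) (comb N i) (comb N (Suc i))" if "i < N" for i
        using split[OF that]
      proof (elim disjE exE conjE)
        assume "i < q" then show ?thesis using gl below by simp
      next
        assume "i = q" then show ?thesis using gq last below by simp
      next
        assume "i = Suc q" then show ?thesis using gq last by simp
      qed (use True in auto)
      then show ?thesis using g(1) by blast
    next
      case False
      then have qM': "Suc q < M" using qM by simp
      let ?h = "inverse_fun (x_gen q) \<circ> g"
      note Y = inverse_x_gen_comb[OF qM']
      have "maps_linearly ?h (p i) (p (Suc i)) (comb N i) (comb N (Suc i))" if "i < N" for i
        using split[OF that]
      proof (elim disjE exE conjE)
        assume "i < q" then show ?thesis using maps_linearly_comp[OF gl Y(1)] N by simp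
      next
        assume "i = q" then show ?thesis using maps_linearly_comp[OF gq(1) Y(2)] N by simp
      next
        assume "i = Suc q" then show ?thesis using maps_linearly_comp[OF gq(2) Y(3)] N by simp
      next
        fix k assume "i = Suc k" "q < k" "k < M"
        then show ?thesis using maps_linearly_comp[OF gr Y(4)] N by simp
      qed
      moreover have "?h \<in> F_gen" by (intro F_gen_comp F_gen_inverse x_gen_F_gen g(1))
      ultimately show ?thesis by blast
    qed
  qed
qed

text \<open>Grid intervals of length 2^(-n) go to intervals of length 2^(-e), e = n - k, shifted by
  \<open>c\<close>. If 2^m is a denominator of \<open>c\<close>, then n \<ge> |k| + m gives e \<ge>
  m, and the shift is a multiple of 2^(-e).\<close>

lemma affine_piece_std:
  assumes c: "c \<in> dyadic" and f: "\<forall>t\<in>{a..b}. f t = 2 powi k * t + c"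
  shows "\<exists>n0. \<forall>n\<ge>n0. \<forall>i::int. a \<le> i / 2 ^ n \<longrightarrow> (real_of_int i + 1) / 2 ^ n \<le> b \<longrightarrow>
    std_interval (f (i / 2 ^ n)) (f ((real_of_int i + 1) / 2 ^ n))"
proof -
  obtain z :: int and m where z: "c = z / 2 ^ m" using c unfolding dyadic_def by auto
  have "std_interval (f (i / 2 ^ n)) (f ((real_of_int i + 1) / 2 ^ n))"
    if n: "n \<ge> nat \<bar>k\<bar> + m" and i: "a \<le> i / 2 ^ n" "(real_of_int i + 1) / 2 ^ n \<le> b" for n and i :: int
  proof -
    define e where "e = nat (int n - k)"
    have e: "int e = int n - k" "m \<le> e" using n unfolding e_def by auto
    have "(2::real) powi k * 2 powi int e = 2 powi int n"
      by (subst power_int_add[symmetric]) (use e in auto)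
    then have pow: "(2::real) powi k = 2 ^ n / 2 ^ e" by (simp add: field_simps)
    have me: "(2::real) ^ e = 2 ^ m * 2 ^ (e - m)" using e(2) by (simp flip: power_add)
    have c': "c = of_int (z * 2 ^ (e - m)) / 2 ^ e" by (simp add: z me)
    have "real_of_int i / 2 ^ n \<le> (real_of_int i + 1) / 2 ^ n" by (intro divide_right_mono) auto
    then have "i / 2 ^ n \<in> {a..b}" "(real_of_int i + 1) / 2 ^ n \<in> {a..b}" using i by auto
    then have "f (i / 2 ^ n) = 2 powi k * (i / 2 ^ n) + c"
      "f ((real_of_int i + 1) / 2 ^ n) = 2 powi k * ((real_of_int i + 1) / 2 ^ n) + c"
      using f by blast+
    moreover have "2 powi k * (x / 2 ^ n) = x / 2 ^ e" for x :: real by (simp add: pow)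
    ultimately have "f (i / 2 ^ n) = i / 2 ^ e + c" "f ((real_of_int i + 1) / 2 ^ n) = (real_of_int i + 1) / 2 ^ e + c"
      by (simp_all only:)
    then have "f (i / 2 ^ n) = of_int (i + z * 2 ^ (e - m)) / 2 ^ e"
      "f ((real_of_int i + 1) / 2 ^ n) = (of_int (i + z * 2 ^ (e - m)) + 1) / 2 ^ e"
      by (simp_all add: c' add_divide_distrib)
    then show ?thesis unfolding std_interval_def by blast
  qed
  note std = this
  show ?thesis by (intro exI[of _ "nat \<bar>k\<bar> + m"] allI impI) (rule std)
qed

lemma dyadic_common_denominator:
  assumes "finite D" "D \<subseteq> dyadic"
  shows "\<exists>n. \<forall>d\<in>D. \<exists>k::int. d = k / 2 ^ n"
proof -
  have "\<forall>d\<in>D. \<forall>\<^sub>F n in sequentially. \<exists>k::int. d = k / 2 ^ n"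
  proof
    fix d assume "d \<in> D"
    then obtain z :: int and m where z: "d = z / 2 ^ m" using assms(2) unfolding dyadic_def by auto
    have "\<exists>k::int. d = k / 2 ^ n" if "n \<ge> m" for n
    proof -
      have me: "(2::real) ^ n = 2 ^ m * 2 ^ (n - m)" using that by (simp flip: power_add)
      show ?thesis by (rule exI[of _ "z * 2 ^ (n - m)"]) (simp add: z me)
    qed
    then show "\<forall>\<^sub>F n in sequentially. \<exists>k::int. d = k / 2 ^ n"
      unfolding eventually_sequentially by blast
  qed
  then have "\<forall>\<^sub>F n in sequentially. \<forall>d\<in>D. \<exists>k::int. d = k / 2 ^ n"
    using assms(1) by (simp add: eventually_ball_finite)
  then show ?thesis by (rule eventually_happens'[OF sequentially_bot])
qed

text \<open>Two scales are used: all breakpoints lie on the coarse grid, so \<open>f\<close> is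
  affine on each of its intervals, and the fine grid is chosen beyond the bounds of
  \<open>affine_piece_std\<close> for these finitely many pieces.\<close>

lemma F_ext_std_partition:
  assumes f: "f \<in> F_ext"
  shows "\<exists>n. \<forall>i<2 ^ n. std_interval (f (real i / 2 ^ n)) (f (real (Suc i) / 2 ^ n)) \<and>
    maps_linearly f (real i / 2 ^ n) (real (Suc i) / 2 ^ n) (f (real i / 2 ^ n)) (f (real (Suc i) / 2 ^ n))"
proof -
  obtain D where D: "D \<subseteq> dyadic" "finite D" "pl_on D f"
    using F_ext_PL2[OF f] unfolding PL2_def by auto
  obtain n where n: "\<forall>d\<in>D. \<exists>k::int. d = k / 2 ^ n"
    using dyadic_common_denominator[OF D(2,1)] by blast
  have piece: "\<exists>k. \<exists>c\<in>dyadic. \<forall>t\<in>{real i / 2 ^ n..real (Suc i) / 2 ^ n}. f t = 2 powi k * t + c" for i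
  proof -
    have "{real i / 2 ^ n<..<real (Suc i) / 2 ^ n} \<inter> D = {}"
    proof (rule ccontr)
      assume "{real i / 2 ^ n<..<real (Suc i) / 2 ^ n} \<inter> D \<noteq> {}"
      then obtain d where d: "d \<in> D" "real i / 2 ^ n < d" "d < real (Suc i) / 2 ^ n" by auto
      then obtain k :: int where "d = k / 2 ^ n" using n by blast
      then have "real_of_int (int i) < real_of_int k" "real_of_int k < real_of_int (int (Suc i))"
        using d by (simp_all add: divide_less_cancel)
      then have "int i < k" "k < int (Suc i)" by (simp_all only: of_int_less_iff)
      then show False by simp
    qed
    moreover have "real i / 2 ^ n < real (Suc i) / 2 ^ n" by (intro divide_strict_right_mono) auto
    ultimately show ?thesis using D(3) unfolding pl_on_def by blast
  qed
  have "\<forall>j\<in>{..<2 ^ n}. \<forall>\<^sub>F N in sequentially. \<forall>i::int. real j / 2 ^ n \<le> i / 2 ^ N \<longrightarrow>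
      (i + 1) / 2 ^ N \<le> real (Suc j) / 2 ^ n \<longrightarrow> std_interval (f (i / 2 ^ N)) (f ((i + 1) / 2 ^ N))"
  proof
    fix j
    obtain k c where "c \<in> dyadic" "\<forall>t\<in>{real j / 2 ^ n..real (Suc j) / 2 ^ n}. f t = 2 powi k * t + c"
      using piece[of j] by blast
    then show "\<forall>\<^sub>F N in sequentially. \<forall>i::int. real j / 2 ^ n \<le> i / 2 ^ N \<longrightarrow>
      (i + 1) / 2 ^ N \<le> real (Suc j) / 2 ^ n \<longrightarrow> std_interval (f (i / 2 ^ N)) (f ((i + 1) / 2 ^ N))"
      unfolding eventually_sequentially by (rule affine_piece_std)
  qed
  then have "\<forall>\<^sub>F N in sequentially. \<forall>j\<in>{..<2 ^ n}. \<forall>i::int. real j / 2 ^ n \<le> i / 2 ^ N \<longrightarrow>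
      (i + 1) / 2 ^ N \<le> real (Suc j) / 2 ^ n \<longrightarrow> std_interval (f (i / 2 ^ N)) (f ((i + 1) / 2 ^ N))"
    by (subst eventually_ball_finite_distrib) simp_all
  moreover have "\<forall>\<^sub>F N in sequentially. N \<ge> n" by (rule eventually_ge_at_top)
  ultimately have "\<exists>N. N \<ge> n \<and> (\<forall>j\<in>{..<2 ^ n}. \<forall>i::int. real j / 2 ^ n \<le> i / 2 ^ N \<longrightarrow>
      (i + 1) / 2 ^ N \<le> real (Suc j) / 2 ^ n \<longrightarrow> std_interval (f (i / 2 ^ N)) (f ((i + 1) / 2 ^ N)))"
    by (intro eventually_happens'[OF sequentially_bot] eventually_conj)
  then obtain N where N: "N \<ge> n" "\<forall>j\<in>{..<2 ^ n}. \<forall>i::int. real j / 2 ^ n \<le> i / 2 ^ N \<longrightarrow>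
      (i + 1) / 2 ^ N \<le> real (Suc j) / 2 ^ n \<longrightarrow> std_interval (f (i / 2 ^ N)) (f ((i + 1) / 2 ^ N))"
    by blast
  show ?thesis
  proof (intro exI[of _ N] allI impI)
    fix i :: nat assume i: "i < 2 ^ N"
    \<comment> \<open>The coarse interval that contains the fine interval i.\<close>
    define j where "j = i div 2 ^ (N - n)"
    have pow: "(2::nat) ^ N = 2 ^ n * 2 ^ (N - n)" using N(1) by (simp flip: power_add)
    then have rpow: "(2::real) ^ N = 2 ^ n * 2 ^ (N - n)" using N(1) by (simp flip: power_add)
    have j: "j < 2 ^ n" unfolding j_def using i pow by (simp add: less_mult_imp_div_less)
    have "j * 2 ^ (N - n) \<le> i" unfolding j_def by simp
    then have "real (j * 2 ^ (N - n)) \<le> real i" by (simp only: of_nat_le_iff)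
    then have lo: "real j / 2 ^ n \<le> real i / 2 ^ N" by (simp add: rpow field_simps)
    have "i < Suc j * 2 ^ (N - n)" unfolding j_def using dividend_less_div_times[of "2 ^ (N - n)" i] by (simp add: algebra_simps)
    then have "real (Suc i) \<le> real (Suc j * 2 ^ (N - n))" by (simp only: of_nat_le_iff Suc_leI)
    then have "real (Suc i) / 2 ^ N \<le> real (Suc j * 2 ^ (N - n)) / 2 ^ N"
      by (rule divide_right_mono) simp
    also have "\<dots> = real (Suc j) / 2 ^ n"
      unfolding rpow of_nat_mult by (simp del: of_nat_Suc)
    finally have hi: "real (Suc i) / 2 ^ N \<le> real (Suc j) / 2 ^ n" .
    have "std_interval (f (real i / 2 ^ N)) (f (real (Suc i) / 2 ^ N))"
      using N(2)[rule_format, of j "int i"] j lo hi by (simp add: add.commute)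
    moreover have "real i / 2 ^ N \<le> real (Suc i) / 2 ^ N" by (intro divide_right_mono) auto
    moreover obtain k c where "\<forall>t\<in>{real j / 2 ^ n..real (Suc j) / 2 ^ n}. f t = 2 powi k * t + c"
      using piece[of j] by blast
    ultimately show "std_interval (f (real i / 2 ^ N)) (f (real (Suc i) / 2 ^ N)) \<and>
        maps_linearly f (real i / 2 ^ N) (real (Suc i) / 2 ^ N) (f (real i / 2 ^ N)) (f (real (Suc i) / 2 ^ N))"
      using lo hi by (intro conjI affine_maps_linearly[of _ _ _ "2 powi k" c]) auto
  qed
qed

text \<open>A uniform partition and its image under \<open>f\<close> have equally many intervals, so
  g and h in \<open>F_gen\<close> map them to the same comb. Then h \<circ> f and g agree on every
  interval, and f is the inverse of h composed with g.\<close>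

lemma F_ext_F_gen:
  assumes f: "f \<in> F_ext" shows "f \<in> F_gen"
proof -
  obtain n where n: "\<And>i. i < 2 ^ n \<Longrightarrow> std_interval (f (real i / 2 ^ n)) (f (real (Suc i) / 2 ^ n))"
    "\<And>i. i < 2 ^ n \<Longrightarrow> maps_linearly f (real i / 2 ^ n) (real (Suc i) / 2 ^ n) (f (real i / 2 ^ n)) (f (real (Suc i) / 2 ^ n))"
    using F_ext_std_partition[OF f] by blast
  define N :: nat where "N = 2 ^ n"
  define p where "p i = real i / 2 ^ n" for i
  have "std_partition N p"
    unfolding std_partition_def
  proof (intro conjI allI impI)
    fix i
    show "std_interval (p i) (p (Suc i))"
      unfolding std_interval_def p_def by (intro exI[of _ "int i"] exI[of _ n]) (simp add: add.commute)
  qed (auto simp: p_def N_def)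
  then obtain g where g: "g \<in> F_gen" "\<forall>i<N. maps_linearly g (p i) (p (Suc i)) (comb N i) (comb N (Suc i))"
    using partition_to_comb by blast
  have "std_partition N (\<lambda>i. f (p i))"
    unfolding std_partition_def
    using n(1) F_ext_ends(1)[OF f, of 0] F_ext_ends(2)[OF f, of 1] by (simp add: p_def N_def)
  then obtain h where h: "h \<in> F_gen"
      "\<forall>i<N. maps_linearly h (f (p i)) (f (p (Suc i))) (comb N i) (comb N (Suc i))"
    using partition_to_comb by blast
  have hP: "h \<in> PL2" using h(1) F_ext_PL2 unfolding F_gen_def by blast
  have "h (f t) = g t" if t: "t \<in> {0..1}" for t
  proof -
    have "\<exists>i<N. \<exists>u\<in>{0..1}. t = p i + u * (p (Suc i) - p i)"
    \<comment> \<open>The floor used for t < 1 would give the index N here; 1 is instead the right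
      end, u = 1, of the last interval.\<close>
    proof (cases "t = 1")
      case True
      have "real N = 2 ^ n" "N > 0" by (auto simp: N_def)
      then have "N - 1 < N" "t = p (N - 1) + 1 * (p (Suc (N - 1)) - p (N - 1))" using True by (auto simp: p_def)
      moreover have "(1::real) \<in> {0..1}" by simp
      ultimately show ?thesis by blast
    next
      case False
      define i where "i = nat \<lfloor>t * 2 ^ n\<rfloor>"
      have i: "real i = of_int \<lfloor>t * 2 ^ n\<rfloor>" using t by (simp add: i_def)
      have le: "real i \<le> t * 2 ^ n" unfolding i by simp
      have "t * 2 ^ n < 1 * 2 ^ n" using False t by (intro mult_strict_right_mono) auto
      from order.strict_trans1[OF le this] have "real i < real N" by (simp add: N_def)
      moreover have "t * 2 ^ n - real i \<in> {0..1}" unfolding i by simp linarith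
      moreover have "t = p i + (t * 2 ^ n - real i) * (p (Suc i) - p i)" by (simp add: p_def field_simps)
      ultimately show ?thesis by (metis of_nat_less_iff)
    qed
    then obtain i u where iu: "i < N" "u \<in> {0..1}" "t = p i + u * (p (Suc i) - p i)" by blast
    have "maps_linearly f (p i) (p (Suc i)) (f (p i)) (f (p (Suc i)))"
      using n(2)[of i] iu(1) by (simp add: p_def N_def)
    then have "maps_linearly (h \<circ> f) (p i) (p (Suc i)) (comb N i) (comb N (Suc i))"
      by (rule maps_linearly_comp) (use h iu in blast)
    then show ?thesis using g iu unfolding maps_linearly_def by simp
  qed
  then have "f t = (inverse_fun h \<circ> g) t" if "t \<in> {0..1}" for t
    using PL2_inv(1)[OF hP, of "f t"] that by simp
  then have "restr f = restr (inverse_fun h \<circ> g)" by (rule restrict_ext)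
  then show ?thesis
    using F_gen_comp[OF F_gen_inverse[OF h(1)] g(1)] f unfolding F_gen_def by simp
qed

lemma generate_x0_x1: "generate thompson_F {x0, x1} = carrier thompson_F"
proof
  show "generate thompson_F {x0, x1} \<subseteq> carrier thompson_F"
    by (rule group.generate_incl[OF group_thompson_F x0_x1_carrier])
  show "carrier thompson_F \<subseteq> generate thompson_F {x0, x1}"
    using F_ext_F_gen unfolding carrier_thompson_F F_gen_def by blast
qed

section \<open>Generic paths\<close>

lemma two_power_int_eq_1_iff: "(2::real) powi k = 1 \<longleftrightarrow> k = 0"
  using power_int_strict_increasing[of k 0 "2::real"] power_int_strict_increasing[of 0 k "2::real"]
  by (cases k "0::int" rule: linorder_cases) auto

text \<open>Fixing 0 keeps negative points negative; the bounded support can be brought close to 0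
  by a homothety.\<close>

definition PL2_neg :: "(real \<Rightarrow> real) set" where
  "PL2_neg = {f \<in> PL2. (\<forall>t\<ge>0. f t = t) \<and> (\<exists>B. \<forall>t\<le>B. f t = t)}"

lemma PL2_neg_PL2: "f \<in> PL2_neg \<Longrightarrow> f \<in> PL2"
  by (simp add: PL2_neg_def)

lemma PL2_neg_negative:
  assumes "f \<in> PL2_neg" shows "f t < 0 \<longleftrightarrow> t < 0"
proof -
  have "f 0 = 0" using assms by (simp add: PL2_neg_def)
  then show ?thesis using PL2_less[OF PL2_neg_PL2[OF assms], of t 0] by simp
qed

lemma PL2_neg_id: "id \<in> PL2_neg"
  using PL2_id by (auto simp: PL2_neg_def)

lemma PL2_neg_comp:
  assumes "f \<in> PL2_neg" "g \<in> PL2_neg" shows "f \<circ> g \<in> PL2_neg"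
proof -
  obtain B C where "\<forall>t\<le>B. f t = t" "\<forall>t\<le>C. g t = t" using assms unfolding PL2_neg_def by auto
  then have "\<forall>t\<le>min B C. (f \<circ> g) t = t" by simp
  moreover have "\<forall>t\<ge>0. (f \<circ> g) t = t" using assms by (simp add: PL2_neg_def)
  ultimately show ?thesis using PL2_comp[OF assms[THEN PL2_neg_PL2]] unfolding PL2_neg_def by blast
qed

lemma PL2_neg_inverse:
  assumes "f \<in> PL2_neg" shows "inverse_fun f \<in> PL2_neg"
proof -
  have f: "f \<in> PL2" using assms by (rule PL2_neg_PL2)
  have fix_inv: "inverse_fun f t = t" if "f t = t" for t
    using PL2_inv(1)[OF f, of t] that by simp
  then show ?thesis using assms PL2_inv_mem[OF f] unfolding PL2_neg_def by blast
qed

text \<open>A copy of \<open>x0_ext\<close> on a small dyadic interval around z pushes every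
  interior point strictly to the left. The orbit of z is therefore infinite, and some power carries
  z out of \<open>S\<close>.\<close>

lemma exists_bump:
  fixes z :: real
  assumes P: "finite P" "z \<notin> P" and z: "z < 0" and S: "finite S"
  shows "\<exists>f\<in>PL2_neg. (\<forall>t\<in>P. f t = t) \<and> f z \<notin> S"
proof -
  let ?D = "insert 0 P"
  have D: "finite ?D" using P by simp
  obtain l where l: "l < z" "{l<..<z} \<inter> ?D = {}" using gap_left[OF D] by blast
  obtain r where r: "z < r" "{z<..<r} \<inter> ?D = {}" using gap_right[OF D] by blast
  have "r \<le> 0" using gap_notin[OF r(2), of 0] z by force
  obtain k where k: "(1/2) ^ k < min (z - l) (r - z)"
    using real_arch_pow_inv[of "min (z - l) (r - z)" "1/2"] l r by auto
  \<comment> \<open>The grid has half the length of the interval: \<open>a\<close> is the last grid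
    point strictly left of z, so z is at most half an interval away and lies inside (a, b).\<close>
  define a where "a = (real_of_int \<lceil>z * 2 ^ Suc k\<rceil> - 1) / 2 ^ Suc k"
  define b where "b = a + 1 / 2 ^ k"
  have a_dyadic: "a \<in> dyadic" using dyadic_frac[of "\<lceil>z * 2 ^ Suc k\<rceil> - 1" "Suc k"] by (simp add: a_def)
  have "of_int \<lceil>z * 2 ^ Suc k\<rceil> - 1 < z * 2 ^ Suc k" "z * 2 ^ Suc k \<le> of_int \<lceil>z * 2 ^ Suc k\<rceil>"
    by linarith+
  then have az: "a < z" "z \<le> a + 1 / 2 ^ Suc k"
    unfolding a_def by (simp_all add: field_simps)
  have k': "1 / 2 ^ k < z - l" "1 / 2 ^ k < r - z" using k by (simp_all add: power_one_over)
  have "(1::real) / 2 ^ k = 2 * (1 / 2 ^ Suc k)" "(0::real) < 1 / 2 ^ Suc k" by simp_all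
  then have ab: "l < a" "a < z" "z < b" "b < r" using az k' unfolding b_def by linarith+
  define f where "f = rescale a k x0_ext"
  have f: "f \<in> PL2" unfolding f_def by (rule rescale_PL2[OF a_dyadic x0_ext_PL2])
  have f_out: "f t = t" if "t \<notin> {a<..<b}" for t
  proof -
    have "(t - a) * 2 ^ k \<le> 0 \<or> 1 \<le> (t - a) * 2 ^ k"
      using that unfolding b_def by (auto simp: mult_le_0_iff field_simps)
    then have "x0_ext ((t - a) * 2 ^ k) = (t - a) * 2 ^ k" by (auto simp: x0_ext_def)
    then show ?thesis by (simp add: f_def rescale_def)
  qed
  have f_in: "f t < t" if "t \<in> {a<..<b}" for t
  proof -
    have "0 < (t - a) * 2 ^ k" "(t - a) * 2 ^ k < 1"
      using that unfolding b_def by (auto simp: field_simps)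
    then have "x0_ext ((t - a) * 2 ^ k) < (t - a) * 2 ^ k" by (auto simp: x0_ext_def)
    then have "x0_ext ((t - a) * 2 ^ k) / 2 ^ k < (t - a) * 2 ^ k / 2 ^ k"
      by (rule divide_strict_right_mono) simp
    then show ?thesis by (simp add: f_def rescale_def)
  qed
  have f_maps: "f t \<in> {a<..<b}" if "t \<in> {a<..<b}" for t
    using that PL2_less[OF f, of a t] PL2_less[OF f, of t b] f_out[of a] f_out[of b] by simp
  have orbit: "(f ^^ j) z \<in> {a<..<b}" for j
    by (induction j) (use ab f_maps in auto)
  have "(f ^^ Suc j) z < (f ^^ j) z" for j using f_in[OF orbit[of j]] by simp
  then have "strict_mono (\<lambda>j. - (f ^^ j) z)" by (simp add: strict_mono_Suc_iff)
  from strict_mono_eq[OF this] have "inj (\<lambda>j. (f ^^ j) z)" by (simp add: inj_def)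
  then have "infinite (range (\<lambda>j. (f ^^ j) z))" by (rule range_inj_infinite)
  then have "\<not> range (\<lambda>j. (f ^^ j) z) \<subseteq> S" using S finite_subset by blast
  then obtain j where j: "(f ^^ j) z \<notin> S" by blast
  have pow_out: "(f ^^ j) t = t" if "t \<notin> {a<..<b}" for t
    by (induction j) (simp_all add: f_out[OF that])
  have "f ^^ j \<in> PL2"
  proof (induction j)
    case 0 show ?case by (simp only: funpow.simps PL2_id)
  next
    case (Suc j) show ?case by (simp only: funpow.simps PL2_comp[OF f Suc])
  qed
  moreover have "(f ^^ j) t = t" if "t \<ge> 0" for t
    by (rule pow_out) (use that ab(4) \<open>r \<le> 0\<close> in simp)
  moreover have "(f ^^ j) t = t" if "t \<le> a" for t
    by (rule pow_out) (use that in simp)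
  ultimately have "f ^^ j \<in> PL2_neg" unfolding PL2_neg_def by blast
  moreover have "(f ^^ j) t = t" if t: "t \<in> P" for t
  proof (rule pow_out)
    have "t \<notin> {l<..<z}" "t \<notin> {z<..<r}" "t \<noteq> z" using l r P(2) t by blast+
    then show "t \<notin> {a<..<b}" using ab by auto
  qed
  ultimately show ?thesis using j by blast
qed

text \<open>A bump applied after \<open>G\<close> moves the value at y and fixes the values on
  \<open>E\<close>, which differ from it by injectivity.\<close>

lemma modify_value:
  assumes G: "G \<in> PL2_neg" and E: "finite E" "y \<notin> E" and y: "y < 0" and S: "finite S"
  shows "\<exists>G'\<in>PL2_neg. (\<forall>e\<in>E. G' e = G e) \<and> G' y \<notin> S"
proof -
  have "G y \<notin> G ` E" using E(2) PL2_eq[OF PL2_neg_PL2[OF G]] by auto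
  moreover have "G y < 0" using y PL2_neg_negative[OF G] by simp
  ultimately obtain f where f: "f \<in> PL2_neg" "\<forall>t\<in>G ` E. f t = t" "f (G y) \<notin> S"
    using exists_bump[OF finite_imageI[OF E(1)] _ _ S] by blast
  then show ?thesis using PL2_neg_comp[OF f(1) G] by (intro bexI[of _ "f \<circ> G"]) auto
qed

text \<open>The inverse of a bump f is applied before \<open>G\<close>: the inverse of the new map
  is f after the inverse of \<open>G\<close>, so f moves the preimage of y while fixing
  \<open>E\<close>.\<close>

lemma modify_preimage:
  assumes G: "G \<in> PL2_neg" and E: "finite E" "y \<notin> G ` E" and y: "y < 0" and S: "finite S"
  shows "\<exists>G'\<in>PL2_neg. (\<forall>e\<in>E. G' e = G e) \<and> inverse_fun G' y \<notin> S"
proof -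
  have "inverse_fun G y \<notin> E" using E(2) PL2_inv(2)[OF PL2_neg_PL2[OF G], of y] by (metis imageI)
  moreover have "inverse_fun G y < 0" using y PL2_neg_negative[OF PL2_neg_inverse[OF G]] by simp
  ultimately obtain f where f: "f \<in> PL2_neg" "\<forall>t\<in>E. f t = t" "f (inverse_fun G y) \<notin> S"
    using exists_bump[OF E(1) _ _ S] by blast
  have fP: "f \<in> PL2" "G \<in> PL2" using f(1) G PL2_neg_PL2 by auto
  have "inverse_fun (G \<circ> inverse_fun f) y = f (inverse_fun G y)"
    using PL2_bij[OF fP(2)] PL2_bij[OF PL2_inv_mem[OF fP(1)]] PL2_bij[OF fP(1)]
    by (simp add: o_inv_distrib inv_inv_eq)
  moreover have "inverse_fun f e = e" if "e \<in> E" for e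
    using PL2_inv(1)[OF fP(1), of e] f(2) that by simp
  ultimately show ?thesis
    using f(3) PL2_neg_comp[OF G PL2_neg_inverse[OF f(1)]]
    by (intro bexI[of _ "G \<circ> inverse_fun f"]) auto
qed

section \<open>Tracks of points under words in G and scalings\<close>

definition sign_fun :: "(real \<Rightarrow> real) \<Rightarrow> bool \<Rightarrow> real \<Rightarrow> real" where
  "sign_fun G e = (if e then G else inverse_fun G)"

text \<open>The letter (e, a) stands for scaling by 2 powi a followed by G or, if e is False, by its
  inverse.  The last letter of a word acts first.\<close>

primrec track :: "(real \<Rightarrow> real) \<Rightarrow> (bool \<times> int) list \<Rightarrow> real \<Rightarrow> real" where
  "track G [] x = x"
| "track G (l # w) x = sign_fun G (fst l) (2 powi snd l * track G w x)"

text \<open>The values of G at these points determine the track of x.\<close>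

primrec track_args :: "(real \<Rightarrow> real) \<Rightarrow> (bool \<times> int) list \<Rightarrow> real \<Rightarrow> real set" where
  "track_args G [] x = {}"
| "track_args G (l # w) x =
     insert (if fst l then 2 powi snd l * track G w x else track G (l # w) x) (track_args G w x)"

text \<open>A letter is compared with the one to its right, which acts before it, and its scaling
  stands between the two signs. Only opposite signs with a trivial scaling between them are
  excluded; equal signs with trivial scaling build up powers of G.\<close>

abbreviation reduced :: "(bool \<times> int) list \<Rightarrow> bool" where
  "reduced \<equiv> successively (\<lambda>l l'. fst l = fst l' \<or> snd l \<noteq> 0)"

text \<open>For a negative letter the maps are compared at the preimage of y under \<open>G\<close>:
  if \<open>G'\<close> also takes the value y there, the preimages coincide.\<close>

lemma sign_fun_eqI:
  assumes "G \<in> PL2" "G' \<in> PL2"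
    and "G' (if e then y else sign_fun G e y) = G (if e then y else sign_fun G e y)"
  shows "sign_fun G' e y = sign_fun G e y"
  using assms(3) PL2_inv[OF assms(1), of y] PL2_inv(1)[OF assms(2), of "inverse_fun G y"]
  by (cases e) (auto simp: sign_fun_def)

lemma track_cong:
  assumes G: "G \<in> PL2" "G' \<in> PL2" and "\<forall>e\<in>track_args G w x. G' e = G e"
  shows "track G' w x = track G w x" "track_args G' w x = track_args G w x"
proof -
  have "track G' w x = track G w x \<and> track_args G' w x = track_args G w x"
    using assms(3)
  proof (induction w)
    case (Cons l w)
    then have "sign_fun G' (fst l) (2 powi snd l * track G w x) = sign_fun G (fst l) (2 powi snd l * track G w x)"
      by (intro sign_fun_eqI G) auto
    then show ?case using Cons by (cases "fst l") auto
  qed simp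
  then show "track G' w x = track G w x" "track_args G' w x = track_args G w x" by blast+
qed

lemma track_negative:
  assumes "G \<in> PL2_neg" "x < 0" shows "track G w x < 0"
proof (induction w)
  case (Cons l w)
  then show ?case
    using PL2_neg_negative[OF assms(1)] PL2_neg_negative[OF PL2_neg_inverse[OF assms(1)]]
    by (auto simp: sign_fun_def mult_less_0_iff)
qed (use assms in simp)

text \<open>Abert's argument: G is changed one letter at a time, keeping its values on the finite set E
  that contains everything used so far, so that the end of the track stays generic.  A letter can
  be appended because its argument is new: reducedness excludes undoing the previous letter.\<close>

lemma exists_generic_track:
  assumes "reduced w" "G \<in> PL2_neg" "finite E" "finite A"
  shows "\<exists>G' E' x. G' \<in> PL2_neg \<and> finite E' \<and> E \<subseteq> E' \<and> (\<forall>e\<in>E. G' e = G e) \<and> x < 0 \<and>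
    track_args G' w x \<subseteq> E' \<and> (w \<noteq> [] \<longrightarrow> (\<forall>k\<in>A. 2 powi k * track G' w x \<noteq> x)) \<and>
    (\<forall>k\<in>A. \<forall>e. w = [] \<or> k \<noteq> 0 \<or> fst (hd w) = e \<longrightarrow>
       2 powi k * track G' w x \<notin> (if e then E' else G' ` E'))"
  using assms
\<comment> \<open>\<open>A\<close> collects the scalings that may follow the track; the induction
  step adds the scaling of the new letter to it. The last clause of the claim says that a next
  letter which does not cancel has a fresh argument: outside \<open>E'\<close> for the map itself,
  outside the image of \<open>E'\<close> for its inverse.\<close>
proof (induction w arbitrary: A)
  case Nil
  \<comment> \<open>The starting points that some scaling in \<open>A\<close> takes to a used
    argument or value.\<close>
  let ?V = "(\<lambda>(k, v). v / 2 powi k) ` (A \<times> (E \<union> G ` E))"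
  have "finite ?V" using Nil by auto
  then have "infinite ({..<0} - ?V)" by (simp add: infinite_Iio)
  then have "{..<0} - ?V \<noteq> {}" by (rule infinite_imp_nonempty)
  then obtain x where x: "x \<in> {..<0} - ?V" by blast
  have "2 powi k * x \<notin> E \<union> G ` E" if "k \<in> A" for k
  proof
    assume "2 powi k * x \<in> E \<union> G ` E"
    then have "(\<lambda>(k, v). v / 2 powi k) (k, 2 powi k * x) \<in> ?V" using that by blast
    then show False using x by simp
  qed
  then show ?case using Nil x by (intro exI[of _ G] exI[of _ E] exI[of _ x]) auto
next
  case (Cons l w)
  obtain \<epsilon> a where l: "l = (\<epsilon>, a)" by (cases l)
  have red: "reduced w" "w = [] \<or> a \<noteq> 0 \<or> fst (hd w) = \<epsilon>"
    using Cons.prems(1) by (cases w; auto simp: l)+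
  obtain G' E' x where IH: "G' \<in> PL2_neg" "finite E'" "E \<subseteq> E'" "\<forall>e\<in>E. G' e = G e" "x < 0"
      "track_args G' w x \<subseteq> E'"
      "\<forall>k\<in>insert a A. \<forall>e. w = [] \<or> k \<noteq> 0 \<or> fst (hd w) = e \<longrightarrow>
         2 powi k * track G' w x \<notin> (if e then E' else G' ` E')"
    using Cons.IH[OF red(1) Cons.prems(2,3), of "insert a A"] Cons.prems(4) by auto
  define y where "y = 2 powi a * track G' w x"
  have y: "y < 0" "y \<notin> (if \<epsilon> then E' else G' ` E')"
    using track_negative[OF IH(1,5)] IH(7) red(2) by (auto simp: y_def mult_less_0_iff)
  \<comment> \<open>If the new end point z avoids \<open>S\<close>, then for k in \<open>A\<close>
    the point 2^k * z differs from the start x, from the current argument y and from all arguments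
    and values used before.\<close>
  define S where "S = (\<lambda>(k, v). v / 2 powi k) ` (A \<times> insert x (insert y (E' \<union> G' ` E')))"
  have S: "finite S" unfolding S_def using Cons.prems(4) IH(2) by auto
  have "\<exists>G''\<in>PL2_neg. (\<forall>e\<in>E'. G'' e = G' e) \<and> sign_fun G'' \<epsilon> y \<notin> S"
    using modify_value[OF IH(1,2) _ y(1) S] modify_preimage[OF IH(1,2) _ y(1) S] y(2)
    by (cases \<epsilon>) (auto simp: sign_fun_def)
  then obtain G'' where G'': "G'' \<in> PL2_neg" "\<forall>e\<in>E'. G'' e = G' e" "sign_fun G'' \<epsilon> y \<notin> S" by blast
  have "\<forall>e\<in>track_args G' w x. G'' e = G' e" using G''(2) IH(6) by blast
  note cong = track_cong[OF PL2_neg_PL2[OF IH(1)] PL2_neg_PL2[OF G''(1)] this]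
  define z where "z = sign_fun G'' \<epsilon> y"
  have trk: "track G'' (l # w) x = z" using cong by (simp add: l z_def y_def)
  have z0: "z < 0" using track_negative[OF G''(1) IH(5), of "l # w"] trk by simp
  define E'' where "E'' = insert (if \<epsilon> then y else z) E'"
  have args: "track_args G'' (l # w) x \<subseteq> E''"
    using IH(6) cong trk by (auto simp: E''_def l y_def)
  have img: "G'' ` E'' = insert (if \<epsilon> then z else y) (G' ` E')"
  proof -
    have "G'' ` E' = G' ` E'" using G''(2) by (intro image_cong) auto
    moreover have "G'' (if \<epsilon> then y else z) = (if \<epsilon> then z else y)"
      using PL2_inv(2)[OF PL2_neg_PL2[OF G''(1)], of y] by (simp add: z_def sign_fun_def)
    ultimately show ?thesis unfolding E''_def by simp
  qed
  have avoid: "2 powi k * z \<notin> insert x (insert y (E' \<union> G' ` E'))" if "k \<in> A" for k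
  proof
    assume "2 powi k * z \<in> insert x (insert y (E' \<union> G' ` E'))"
    then have "(\<lambda>(k, v). v / 2 powi k) (k, 2 powi k * z) \<in> S" unfolding S_def using that by blast
    then show False using G''(3) by (simp add: z_def)
  qed
  \<comment> \<open>The point z is itself among those to be avoided exactly when the next letter has
    the opposite sign, and then the scaling between the letters is nontrivial.\<close>
  have move: "2 powi k * z \<noteq> z" if "k \<noteq> 0" for k :: int
    using that z0 by (simp add: two_power_int_eq_1_iff)
  have "2 powi k * z \<notin> (if e then E'' else G'' ` E'')" if "k \<in> A" "k \<noteq> 0 \<or> \<epsilon> = e" for k e
    using avoid[OF that(1)] move[of k] that(2) unfolding img unfolding E''_def
    by (cases e; cases \<epsilon>) auto
  then have "\<forall>k\<in>A. \<forall>e. l # w = [] \<or> k \<noteq> 0 \<or> fst (hd (l # w)) = e \<longrightarrow>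
       2 powi k * track G'' (l # w) x \<notin> (if e then E'' else G'' ` E'')"
    unfolding trk by (simp add: l)
  moreover have "\<forall>k\<in>A. 2 powi k * track G'' (l # w) x \<noteq> x" unfolding trk using avoid by blast
  moreover have "finite E''" "E \<subseteq> E''" unfolding E''_def using IH(2,3) by auto
  moreover have "\<forall>e\<in>E. G'' e = G e" using IH(3,4) G''(2) by (metis subsetD)
  ultimately show ?case
    using G''(1) IH(5) args by (intro exI[of _ G''] exI[of _ E''] exI[of _ x]) simp
qed

text \<open>For the pair (c, w): following the track of w by the scaling with factor 2^(-c) moves x.
  That scaling will be the germ of the leading element of F.\<close>

definition track_witness :: "(real \<Rightarrow> real) \<Rightarrow> int \<times> (bool \<times> int) list \<Rightarrow> real \<Rightarrow> bool" where
  "track_witness G cw x \<longleftrightarrow> x < 0 \<and> track G (snd cw) x \<noteq> 2 powi fst cw * x"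

definition reduced_nonempty :: "int \<times> (bool \<times> int) list \<Rightarrow> bool" where
  "reduced_nonempty cw \<longleftrightarrow> snd cw \<noteq> [] \<and> reduced (snd cw)"

text \<open>The words are treated one after another. \<open>E\<close> contains all arguments used by
  the witnesses found so far, so a later change of the map that keeps its values on \<open>E\<close>
  leaves their tracks intact.\<close>

lemma exists_generic_tracks:
  "\<exists>G\<in>PL2_neg. \<exists>E. finite E \<and>
     (\<forall>cw\<in>set ws. reduced_nonempty cw \<longrightarrow> (\<exists>x. track_witness G cw x \<and> track_args G (snd cw) x \<subseteq> E))"
proof (induction ws)
  case Nil
  show ?case using PL2_neg_id by auto
next
  case (Cons cw ws)
  then obtain G E where G: "G \<in> PL2_neg" "finite E"
    and IH: "\<forall>cw\<in>set ws. reduced_nonempty cw \<longrightarrow> (\<exists>x. track_witness G cw x \<and> track_args G (snd cw) x \<subseteq> E)"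
    by blast
  show ?case
  proof (cases "reduced_nonempty cw")
    case False
    then show ?thesis using G IH by auto
  next
    case True
    then obtain G' E' x where G': "G' \<in> PL2_neg" "finite E'" "E \<subseteq> E'" "\<forall>e\<in>E. G' e = G e" "x < 0"
        "track_args G' (snd cw) x \<subseteq> E'" "2 powi (- fst cw) * track G' (snd cw) x \<noteq> x"
      using exists_generic_track[OF _ G, of "snd cw" "{- fst cw}"] unfolding reduced_nonempty_def by auto
    have "track G' (snd cw) x \<noteq> 2 powi fst cw * x" using G'(7) by (auto simp: power_int_minus field_simps)
    then have new: "track_witness G' cw x" using G'(5) by (simp add: track_witness_def)
    have "\<exists>x. track_witness G' cw' x \<and> track_args G' (snd cw') x \<subseteq> E'"
      if cw': "cw' \<in> set ws" "reduced_nonempty cw'" for cw'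
    proof -
      obtain x' where x': "track_witness G cw' x'" "track_args G (snd cw') x' \<subseteq> E" using IH cw' by blast
      then have "\<forall>e\<in>track_args G (snd cw') x'. G' e = G e" using G'(4) by blast
      note cong = track_cong[OF PL2_neg_PL2[OF G(1)] PL2_neg_PL2[OF G'(1)] this]
      show ?thesis using x' G'(3) cong by (intro exI[of _ x']) (auto simp: track_witness_def)
    qed
    then show ?thesis using G'(1,2,6) new by (intro bexI[of _ G'] exI[of _ E']) auto
  qed
qed

text \<open>Scalings commute with division by 2^K, so conjugating \<open>G\<close> by this homothety
  conjugates the whole track.\<close>

lemma track_rescale:
  assumes "G \<in> PL2"
  shows "track (rescale 0 K G) w (x / 2 ^ K) = track G w x / 2 ^ K"
proof (induction w)
  case (Cons l w)
  have "sign_fun (rescale 0 K G) e = rescale 0 K (sign_fun G e)" for e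
    by (cases e) (simp_all only: sign_fun_def inverse_rescale[OF assms] if_True if_False)
  then show ?case by (simp add: Cons) (simp add: rescale_def)
qed simp

text \<open>A single B bounds the support of a generic map and every intermediate position of
  finitely many tracks; a homothety with B / 2^K < 1 / (n + 1) brings all of them into the window.
  The suffixes \<open>drop j\<close> are the positions at which germs will be applied.\<close>

lemma exists_small_generic:
  "\<exists>L\<in>PL2. (\<forall>u. u \<notin> {- 1 / Suc n<..<0} \<longrightarrow> L u = u) \<and>
    (\<forall>cw\<in>set ws. reduced_nonempty cw \<longrightarrow>
      (\<exists>x. track_witness L cw x \<and> (\<forall>j\<le>length (snd cw). - 1 / Suc n < track L (drop j (snd cw)) x)))"
proof -
  obtain G where G: "G \<in> PL2_neg"
    and wit: "\<forall>cw\<in>set ws. reduced_nonempty cw \<longrightarrow> (\<exists>x. track_witness G cw x)"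
    using exists_generic_tracks[of ws] by blast
  obtain B0 where B0: "\<forall>t\<le>B0. G t = t" using G unfolding PL2_neg_def by auto
  have "\<forall>cw\<in>set ws. \<forall>\<^sub>F B in at_top. reduced_nonempty cw \<longrightarrow>
      (\<exists>x. track_witness G cw x \<and> (\<forall>j\<in>{..length (snd cw)}. - B < track G (drop j (snd cw)) x))"
  proof
    fix cw assume cw: "cw \<in> set ws"
    show "\<forall>\<^sub>F B in at_top. reduced_nonempty cw \<longrightarrow>
      (\<exists>x. track_witness G cw x \<and> (\<forall>j\<in>{..length (snd cw)}. - B < track G (drop j (snd cw)) x))"
    proof (cases "reduced_nonempty cw")
      case True
      then obtain x where x: "track_witness G cw x" using wit cw by blast
      have "\<forall>\<^sub>F B in at_top. \<forall>j\<in>{..length (snd cw)}. - B < track G (drop j (snd cw)) x"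
      proof (rule eventually_ball_finite, simp, rule ballI)
        fix j
        have "\<forall>\<^sub>F B in at_top. - track G (drop j (snd cw)) x < B" by (rule eventually_gt_at_top)
        then show "\<forall>\<^sub>F B in at_top. - B < track G (drop j (snd cw)) x"
          by eventually_elim simp
      qed
      then show ?thesis by eventually_elim (use x in blast)
    qed simp
  qed
  then have "\<forall>\<^sub>F B in at_top. \<forall>cw\<in>set ws. reduced_nonempty cw \<longrightarrow>
      (\<exists>x. track_witness G cw x \<and> (\<forall>j\<in>{..length (snd cw)}. - B < track G (drop j (snd cw)) x))"
    by (intro eventually_ball_finite) simp_all
  moreover have "\<forall>\<^sub>F B in at_top. - B0 < B" by (rule eventually_gt_at_top)
  ultimately have "\<forall>\<^sub>F B in at_top. - B0 < B \<and> (\<forall>cw\<in>set ws. reduced_nonempty cw \<longrightarrow>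
      (\<exists>x. track_witness G cw x \<and> (\<forall>j\<in>{..length (snd cw)}. - B < track G (drop j (snd cw)) x)))"
    by eventually_elim blast
  then obtain B where B: "- B0 < B" "\<forall>cw\<in>set ws. reduced_nonempty cw \<longrightarrow>
      (\<exists>x. track_witness G cw x \<and> (\<forall>j\<in>{..length (snd cw)}. - B < track G (drop j (snd cw)) x))"
    using eventually_happens'[OF trivial_limit_at_top_linorder] by blast
  obtain K where "B * Suc n < 2 ^ K" using real_arch_pow[of 2 "B * Suc n"] by auto
  then have K: "B / 2 ^ K < 1 / Suc n" by (simp add: field_simps)
  define L where "L = rescale 0 K G"
  have L: "L \<in> PL2" unfolding L_def by (rule rescale_PL2[OF _ PL2_neg_PL2[OF G]]) simp
  have L_track: "track L w (x / 2 ^ K) = track G w x / 2 ^ K" for w x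
    unfolding L_def by (rule track_rescale[OF PL2_neg_PL2[OF G]])
  have less: "- 1 / Suc n < t / 2 ^ K" if "- B < t" for t
  proof -
    have "- B / 2 ^ K < t / 2 ^ K" using that by (intro divide_strict_right_mono) simp_all
    then show ?thesis using K by simp
  qed
  have "L u = u" if u: "u \<notin> {- 1 / Suc n<..<0}" for u
  proof -
    have "u * 2 ^ K \<le> B0 \<or> 0 \<le> u * 2 ^ K"
      using u less[of "u * 2 ^ K"] B(1) by (cases "u < 0") (auto simp: not_less)
    then have "G (u * 2 ^ K) = u * 2 ^ K" using B0 G by (auto simp: PL2_neg_def)
    then show ?thesis by (simp add: L_def rescale_def)
  qed
  moreover have "\<exists>x. track_witness L cw x \<and> (\<forall>j\<le>length (snd cw). - 1 / Suc n < track L (drop j (snd cw)) x)"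
    if cw: "cw \<in> set ws" "reduced_nonempty cw" for cw
  proof -
    obtain x where x: "track_witness G cw x" "\<forall>j\<in>{..length (snd cw)}. - B < track G (drop j (snd cw)) x"
      using B(2) cw by blast
    have "track_witness L cw (x / 2 ^ K)" using x(1) by (simp add: track_witness_def L_track divide_less_0_iff)
    moreover have "\<forall>j\<le>length (snd cw). - 1 / Suc n < track L (drop j (snd cw)) (x / 2 ^ K)"
      unfolding L_track using x(2) less by simp
    ultimately show ?thesis by blast
  qed
  ultimately show ?thesis using L by blast
qed

section \<open>The diagonal sequence of generic maps\<close>

abbreviation nth_exponents :: "nat \<Rightarrow> int \<times> (bool \<times> int) list" where
  "nth_exponents \<equiv> from_nat"

text \<open>The type of pairs is countable, so each pair has an index, and every \<open>L n\<close>
  from this index on handles it.\<close>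

lemma exists_generic_sequence:
  "\<exists>L. \<forall>n. L n \<in> PL2 \<and> (\<forall>u. u \<notin> {- 1 / Suc n<..<0} \<longrightarrow> L n u = u) \<and>
    (\<forall>i\<le>n. reduced_nonempty (nth_exponents i) \<longrightarrow>
      (\<exists>x. track_witness (L n) (nth_exponents i) x \<and>
         (\<forall>j\<le>length (snd (nth_exponents i)).
            - 1 / Suc n < track (L n) (drop j (snd (nth_exponents i))) x)))"
proof (rule choice, rule allI)
  fix n
  show "\<exists>L. L \<in> PL2 \<and> (\<forall>u. u \<notin> {- 1 / Suc n<..<0} \<longrightarrow> L u = u) \<and>
    (\<forall>i\<le>n. reduced_nonempty (nth_exponents i) \<longrightarrow>
      (\<exists>x. track_witness L (nth_exponents i) x \<and>
         (\<forall>j\<le>length (snd (nth_exponents i)).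
            - 1 / Suc n < track L (drop j (snd (nth_exponents i))) x)))"
  proof -
    have mem: "nth_exponents i \<in> set (map nth_exponents [0..<Suc n])" if "i \<le> n" for i
      using that unfolding set_map by (intro imageI) (simp del: upt_Suc add: less_Suc_eq_le)
    obtain L where L: "L \<in> PL2" "\<forall>u. u \<notin> {- 1 / Suc n<..<0} \<longrightarrow> L u = u"
        "\<forall>cw\<in>set (map nth_exponents [0..<Suc n]). reduced_nonempty cw \<longrightarrow>
           (\<exists>x. track_witness L cw x \<and> (\<forall>j\<le>length (snd cw). - 1 / Suc n < track L (drop j (snd cw)) x))"
      using exists_small_generic[of n "map nth_exponents [0..<Suc n]"] by (elim bexE conjE)
    show ?thesis
      using L(1,2) L(3)[rule_format, OF mem] by (intro exI[of _ L] conjI allI impI) simp_all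
  qed
qed

section \<open>Presented groups\<close>

lemma words_simps [simp]:
  "[] \<in> words X" "l # w \<in> words X \<longleftrightarrow> fst l \<in> X \<and> w \<in> words X"
  "u @ v \<in> words X \<longleftrightarrow> u \<in> words X \<and> v \<in> words X"
  by (auto simp: words_def mem_Times_iff)

lemma presentation_rel_words:
  "(u, v) \<in> presentation_rel X Rel \<Longrightarrow> u \<in> words X \<and> v \<in> words X"
  by (induction rule: presentation_rel.induct) auto

lemma presentation_rel_equiv: "equiv (words X) (presentation_rel X Rel)"
proof (rule equivI)
  show "presentation_rel X Rel \<subseteq> words X \<times> words X"
    using presentation_rel_words by fast
  show "refl_on (words X) (presentation_rel X Rel)"
    by (rule refl_onI) (rule presentation_rel.refl)
  show "sym (presentation_rel X Rel)"
    by (rule symI) (rule presentation_rel.sym)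
  show "trans (presentation_rel X Rel)"
    by (rule transI) (rule presentation_rel.trans)
qed

lemma presentation_rel_context:
  "(u, v) \<in> presentation_rel X Rel \<Longrightarrow> p \<in> words X \<Longrightarrow> q \<in> words X \<Longrightarrow>
   (p @ u @ q, p @ v @ q) \<in> presentation_rel X Rel"
  by (intro presentation_rel.append) (auto intro: presentation_rel.refl)

definition word_class :: "'x set \<Rightarrow> ('x word \<times> 'x word) set \<Rightarrow> 'x word \<Rightarrow> 'x word set" where
  "word_class X Rel w = presentation_rel X Rel `` {w}"

lemma word_class_eq_iff:
  "u \<in> words X \<Longrightarrow> v \<in> words X \<Longrightarrow>
   word_class X Rel u = word_class X Rel v \<longleftrightarrow> (u, v) \<in> presentation_rel X Rel"
  unfolding word_class_def by (rule eq_equiv_class_iff[OF presentation_rel_equiv])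

lemma carrier_presented_group: "carrier (presented_group X Rel) = word_class X Rel ` words X"
  by (auto simp: presented_group_def word_class_def quotient_def)

lemma word_class_carrier: "w \<in> words X \<Longrightarrow> word_class X Rel w \<in> carrier (presented_group X Rel)"
  unfolding carrier_presented_group by (rule imageI)

lemma one_presented_group: "\<one>\<^bsub>presented_group X Rel\<^esub> = word_class X Rel []"
  by (simp add: presented_group_def word_class_def)

lemma mult_presented_group:
  assumes "u \<in> words X" "v \<in> words X"
  shows "word_class X Rel u \<otimes>\<^bsub>presented_group X Rel\<^esub> word_class X Rel v = word_class X Rel (u @ v)"
proof -
  have "congruent2 (presentation_rel X Rel) (presentation_rel X Rel)
      (\<lambda>u v. presentation_rel X Rel `` {u @ v})"
    by (intro congruent2I' equiv_class_eq[OF presentation_rel_equiv] presentation_rel.append)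
  from UN_equiv_class2[OF presentation_rel_equiv presentation_rel_equiv this assms]
  show ?thesis by (simp add: presented_group_def word_class_def)
qed

definition inverse_word :: "'x word \<Rightarrow> 'x word" where
  "inverse_word w = rev (map (\<lambda>(x, p). (x, \<not> p)) w)"

lemma inverse_word_words [simp]: "inverse_word w \<in> words X \<longleftrightarrow> w \<in> words X"
  by (induction w) (auto simp: inverse_word_def)

lemma inverse_word_cancel:
  assumes "w \<in> words X" shows "(inverse_word w @ w, []) \<in> presentation_rel X Rel"
  using assms
proof (induction w)
  case Nil
  show ?case by (simp add: inverse_word_def presentation_rel.refl)
next
  case (Cons l w)
  obtain x p where l: "l = (x, p)" by (cases l)
  have x: "x \<in> X" and w: "w \<in> words X" using Cons.prems by (auto simp: l)
  have "([(x, \<not> p), (x, p)], []) \<in> presentation_rel X Rel"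
    using presentation_rel.cancel[OF x, of "\<not> p"] by simp
  from presentation_rel_context[OF this inverse_word_words[THEN iffD2, OF w] w]
  have "(inverse_word (l # w) @ l # w, inverse_word w @ w) \<in> presentation_rel X Rel"
    by (simp add: l inverse_word_def)
  then show ?case using Cons.IH[OF w] by (rule presentation_rel.trans)
qed

lemma group_presented_group: "group (presented_group X Rel)"
proof (rule groupI)
  fix x y assume "x \<in> carrier (presented_group X Rel)" "y \<in> carrier (presented_group X Rel)"
  then show "x \<otimes>\<^bsub>presented_group X Rel\<^esub> y \<in> carrier (presented_group X Rel)"
    by (auto simp: carrier_presented_group mult_presented_group)
next
  fix x y z assume "x \<in> carrier (presented_group X Rel)" "y \<in> carrier (presented_group X Rel)"
    "z \<in> carrier (presented_group X Rel)"
  then show "x \<otimes>\<^bsub>presented_group X Rel\<^esub> y \<otimes>\<^bsub>presented_group X Rel\<^esub> z =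
      x \<otimes>\<^bsub>presented_group X Rel\<^esub> (y \<otimes>\<^bsub>presented_group X Rel\<^esub> z)"
    by (auto simp: carrier_presented_group mult_presented_group)
next
  fix x assume "x \<in> carrier (presented_group X Rel)"
  then obtain w where w: "w \<in> words X" "x = word_class X Rel w" by (auto simp: carrier_presented_group)
  have "word_class X Rel (inverse_word w) \<otimes>\<^bsub>presented_group X Rel\<^esub> x = \<one>\<^bsub>presented_group X Rel\<^esub>"
    using w inverse_word_cancel[OF w(1)]
    by (simp add: mult_presented_group one_presented_group word_class_eq_iff)
  then show "\<exists>y\<in>carrier (presented_group X Rel). y \<otimes>\<^bsub>presented_group X Rel\<^esub> x = \<one>\<^bsub>presented_group X Rel\<^esub>"
    using w by (intro bexI[of _ "word_class X Rel (inverse_word w)"]) (auto intro: word_class_carrier)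
next
  show "\<one>\<^bsub>presented_group X Rel\<^esub> \<in> carrier (presented_group X Rel)"
    by (simp add: one_presented_group word_class_carrier)
next
  fix x assume "x \<in> carrier (presented_group X Rel)"
  then show "\<one>\<^bsub>presented_group X Rel\<^esub> \<otimes>\<^bsub>presented_group X Rel\<^esub> x = x"
    by (auto simp: carrier_presented_group mult_presented_group one_presented_group)
qed

lemma inv_presented_group:
  assumes "w \<in> words X"
  shows "inv\<^bsub>presented_group X Rel\<^esub> (word_class X Rel w) = word_class X Rel (inverse_word w)"
proof (rule group.inv_equality[OF group_presented_group])
  show "word_class X Rel (inverse_word w) \<otimes>\<^bsub>presented_group X Rel\<^esub> word_class X Rel w = \<one>\<^bsub>presented_group X Rel\<^esub>"
    using assms inverse_word_cancel[OF assms]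
    by (simp add: mult_presented_group one_presented_group word_class_eq_iff)
qed (use assms in \<open>auto intro: word_class_carrier\<close>)

section \<open>Values of words and change of generators\<close>

lemma word_value_Nil [simp]: "word_value G s [] = \<one>\<^bsub>G\<^esub>"
  by (simp add: word_value_def)

lemma word_value_Cons [simp]:
  "word_value G s (l # w) = (if snd l then s (fst l) else inv\<^bsub>G\<^esub> (s (fst l))) \<otimes>\<^bsub>G\<^esub> word_value G s w"
  by (simp add: word_value_def case_prod_unfold)

lemma word_value_closed:
  assumes "group G" "s ` X \<subseteq> carrier G" "w \<in> words X"
  shows "word_value G s w \<in> carrier G"
proof -
  interpret group G by fact
  show ?thesis using assms(2,3) by (induction w) auto
qed

lemma word_value_append:
  assumes "group G" "s ` X \<subseteq> carrier G" "u \<in> words X" "v \<in> words X"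
  shows "word_value G s (u @ v) = word_value G s u \<otimes>\<^bsub>G\<^esub> word_value G s v"
proof -
  interpret group G by fact
  show ?thesis using assms(2-4)
  proof (induction u)
    case Nil
    then show ?case using word_value_closed[OF assms(1,2)] by simp
  next
    case (Cons l u)
    then have "s (fst l) \<in> carrier G" "word_value G s u \<in> carrier G" "word_value G s v \<in> carrier G"
      using word_value_closed[OF assms(1,2)] by auto
    then show ?case using Cons by (simp add: m_assoc)
  qed
qed

definition map_word :: "('x \<Rightarrow> 'y) \<Rightarrow> 'x word \<Rightarrow> 'y word" where
  "map_word f = map (\<lambda>(x, p). (f x, p))"

lemma map_word_simps [simp]: "map_word f [] = []" "map_word f (l # w) = (f (fst l), snd l) # map_word f w"
  by (simp_all add: map_word_def case_prod_unfold)

lemma map_word_words: "f ` I \<subseteq> X \<Longrightarrow> w \<in> words I \<Longrightarrow> map_word f w \<in> words X"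
  by (induction w) auto

lemma word_value_map_word: "word_value G s (map_word f w) = word_value G (\<lambda>i. s (f i)) w"
  by (induction w) auto

lemma word_value_presented_group:
  assumes "w \<in> words X"
  shows "word_value (presented_group X Rel) (\<lambda>x. word_class X Rel [(x, True)]) w = word_class X Rel w"
  using assms
proof (induction w)
  case Nil
  then show ?case by (simp add: one_presented_group)
next
  case (Cons l w)
  obtain x p where l: "l = (x, p)" by (cases l)
  have x: "x \<in> X" and w: "w \<in> words X" using Cons.prems by (auto simp: l)
  have "(if p then word_class X Rel [(x, True)] else inv\<^bsub>presented_group X Rel\<^esub> word_class X Rel [(x, True)])
      = word_class X Rel [(x, p)]"
    using x by (auto simp: inv_presented_group inverse_word_def)
  then show ?case using Cons.IH[OF w] x w by (cases p) (simp_all add: l mult_presented_group)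
qed

section \<open>Normal forms in a centralizing HNN-extension\<close>

abbreviation hnn_rel ::
  "('a, 'b) monoid_scheme \<Rightarrow> 'a set \<Rightarrow> ('a option word \<times> 'a option word) set" where
  "hnn_rel G H \<equiv> presentation_rel (hnn_gens G) (hnn_rels G H)"

abbreviation base_letter :: "'a \<Rightarrow> 'a option \<times> bool" where
  "base_letter a \<equiv> (Some a, True)"

lemma hnn_gens_simps [simp]: "None \<in> hnn_gens G" "Some a \<in> hnn_gens G \<longleftrightarrow> a \<in> carrier G"
  by (auto simp: hnn_gens_def)

lemma hnn_rel_mult:
  assumes "group G" "a \<in> carrier G" "b \<in> carrier G"
  shows "([base_letter a, base_letter b], [base_letter (a \<otimes>\<^bsub>G\<^esub> b)]) \<in> hnn_rel G H"
proof -
  interpret group G by fact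
  show ?thesis using assms(2,3)
    by (intro presentation_rel.relation) (auto simp: hnn_rels_def)
qed

text \<open>The multiplication table does not mention the empty word; it yields 1 * 1 = 1, from
  which one factor is cancelled.\<close>

lemma hnn_rel_one:
  assumes "group G" shows "([base_letter \<one>\<^bsub>G\<^esub>], []) \<in> hnn_rel G H"
proof -
  interpret group G by fact
  let ?i = "(Some \<one>\<^bsub>G\<^esub>, False)" and ?o = "base_letter \<one>\<^bsub>G\<^esub>"
  have c: "([?i, ?o], []) \<in> hnn_rel G H"
    using presentation_rel.cancel[of "Some \<one>\<^bsub>G\<^esub>" "hnn_gens G" False] by simp
  have "([?i, ?o, ?o], [?i, ?o]) \<in> hnn_rel G H"
    using presentation_rel_context[OF hnn_rel_mult[OF assms, of "\<one>\<^bsub>G\<^esub>" "\<one>\<^bsub>G\<^esub>"], of "[?i]" "[]"] by simp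
  moreover have "([?i, ?o, ?o], [?o]) \<in> hnn_rel G H"
    using presentation_rel_context[OF c, of "[]" "[?o]"] by simp
  ultimately show ?thesis using c by (meson presentation_rel.sym presentation_rel.trans)
qed

text \<open>The word formed by the formal inverse of a, then a, then the inverse of a in
  \<open>G\<close> is evaluated in two ways.\<close>

lemma hnn_rel_inv:
  assumes "group G" "a \<in> carrier G"
  shows "([(Some a, False)], [base_letter (inv\<^bsub>G\<^esub> a)]) \<in> hnn_rel G H"
proof -
  interpret group G by fact
  let ?i = "(Some a, False)" and ?b = "base_letter (inv\<^bsub>G\<^esub> a)"
  have "([?i, base_letter a, ?b], [?i]) \<in> hnn_rel G H"
  proof -
    have "([?i, base_letter a, ?b], [?i, base_letter \<one>\<^bsub>G\<^esub>]) \<in> hnn_rel G H"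
      using presentation_rel_context[OF hnn_rel_mult[OF assms, of "inv\<^bsub>G\<^esub> a"], of "[?i]" "[]"] assms(2) by simp
    moreover have "([?i, base_letter \<one>\<^bsub>G\<^esub>], [?i]) \<in> hnn_rel G H"
      using presentation_rel_context[OF hnn_rel_one[OF assms(1)], of "[?i]" "[]"] assms(2) by simp
    ultimately show ?thesis by (rule presentation_rel.trans)
  qed
  moreover have "([?i, base_letter a, ?b], [?b]) \<in> hnn_rel G H"
    using presentation_rel_context[OF presentation_rel.cancel[of "Some a" "hnn_gens G" False], of "[]" "[?b]"] assms(2)
    by simp
  ultimately show ?thesis by (meson presentation_rel.sym presentation_rel.trans)
qed

text \<open>The presentation contains only t h t^(-1) = h; conjugating by t^(-1) gives the other
  sign.\<close>

lemma hnn_rel_stable: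
  assumes "group G" "H \<subseteq> carrier G" "h \<in> H"
  shows "([(None, e), base_letter h, (None, \<not> e)], [base_letter h]) \<in> hnn_rel G H"
proof -
  have h: "h \<in> carrier G" using assms by blast
  let ?t = "(None, True)" and ?t' = "(None, False)"
  have pos: "([?t, base_letter h, ?t'], [base_letter h]) \<in> hnn_rel G H"
    using h assms(3) by (intro presentation_rel.relation) (auto simp: hnn_rels_def)
  have "([?t', ?t, base_letter h, ?t', ?t], [?t', base_letter h, ?t]) \<in> hnn_rel G H"
    using presentation_rel_context[OF pos, of "[?t']" "[?t]"] by simp
  moreover have "([?t', ?t, base_letter h, ?t', ?t], [base_letter h, ?t', ?t]) \<in> hnn_rel G H"
    using presentation_rel_context[OF presentation_rel.cancel[of None "hnn_gens G" False], of "[]" "[base_letter h, ?t', ?t]"] h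
    by simp
  moreover have "([base_letter h, ?t', ?t], [base_letter h]) \<in> hnn_rel G H"
    using presentation_rel_context[OF presentation_rel.cancel[of None "hnn_gens G" False], of "[base_letter h]" "[]"] h
    by simp
  ultimately have "([?t', base_letter h, ?t], [base_letter h]) \<in> hnn_rel G H"
    by (meson presentation_rel.sym presentation_rel.trans)
  then show ?thesis using pos by (cases e) auto
qed

text \<open>The word t^(e_1) a_1 t^(e_2) a_2 ... with exponents 1 or -1. Elements a_i equal to 1 are
  allowed, which accommodates powers of t.\<close>

primrec hnn_syllables :: "(bool \<times> 'a) list \<Rightarrow> 'a option word" where
  "hnn_syllables [] = []"
| "hnn_syllables (l # ls) = (None, fst l) # base_letter (snd l) # hnn_syllables ls"

text \<open>No pinch t^e h t^(-e) with h in \<open>H\<close> occurs; the element after the last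
  stable letter is unrestricted.\<close>

abbreviation hnn_reduced :: "'a set \<Rightarrow> (bool \<times> 'a) list \<Rightarrow> bool" where
  "hnn_reduced H \<equiv> successively (\<lambda>l l'. fst l = fst l' \<or> snd l \<notin> H)"

lemma hnn_syllables_words [simp]:
  "hnn_syllables ls \<in> words (hnn_gens G) \<longleftrightarrow> snd ` set ls \<subseteq> carrier G"
  by (induction ls) auto

text \<open>Letters are put in front one by one. A base letter is multiplied into f; a stable letter
  turns f into the element of a new first syllable, unless this creates a pinch, which is then
  replaced by f.\<close>

lemma hnn_normal_form:
  assumes G: "group G" "H \<subseteq> carrier G" and "w \<in> words (hnn_gens G)"
  shows "\<exists>f ls. f \<in> carrier G \<and> snd ` set ls \<subseteq> carrier G \<and> hnn_reduced H ls \<and>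
    (w, base_letter f # hnn_syllables ls) \<in> hnn_rel G H"
  using assms(3)
proof (induction w)
  case Nil
  interpret group G by fact
  show ?case
    by (intro exI[of _ "\<one>\<^bsub>G\<^esub>"] exI[of _ "[]"]) (use hnn_rel_one[OF G(1)] in \<open>auto intro: presentation_rel.sym\<close>)
next
  case (Cons l w)
  interpret group G by fact
  obtain x p where l: "l = (x, p)" by (cases l)
  obtain f ls where f: "f \<in> carrier G" and ls: "snd ` set ls \<subseteq> carrier G" "hnn_reduced H ls"
    and wf: "(w, base_letter f # hnn_syllables ls) \<in> hnn_rel G H"
    using Cons by auto
  have lw: "(l # w, l # base_letter f # hnn_syllables ls) \<in> hnn_rel G H"
    using presentation_rel_context[OF wf, of "[l]" "[]"] Cons.prems by simp
  show ?case
  proof (cases x)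
    case (Some a)
    then have a: "a \<in> carrier G" using Cons.prems by (simp add: l)
    define b where "b = (if p then a else inv\<^bsub>G\<^esub> a)"
    have b: "b \<in> carrier G" using a by (simp add: b_def)
    have "([l], [base_letter b]) \<in> hnn_rel G H"
      using hnn_rel_inv[OF G(1) a] presentation_rel.refl[of "[l]"] a by (auto simp: l Some b_def)
    from presentation_rel_context[OF this, of "[]" "base_letter f # hnn_syllables ls"]
    have 1: "(l # base_letter f # hnn_syllables ls, base_letter b # base_letter f # hnn_syllables ls) \<in> hnn_rel G H"
      using f ls by simp
    have 2: "(base_letter b # base_letter f # hnn_syllables ls, base_letter (b \<otimes>\<^bsub>G\<^esub> f) # hnn_syllables ls) \<in> hnn_rel G H"
      using presentation_rel_context[OF hnn_rel_mult[OF G(1) b f], of "[]" "hnn_syllables ls"] ls by simp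
    have "(l # w, base_letter (b \<otimes>\<^bsub>G\<^esub> f) # hnn_syllables ls) \<in> hnn_rel G H"
      using presentation_rel.trans[OF lw presentation_rel.trans[OF 1 2]] .
    then show ?thesis using b f ls by blast
  next
    case None
    show ?thesis
    proof (cases "hnn_reduced H ((p, f) # ls)")
      case True
      have "([], [base_letter \<one>\<^bsub>G\<^esub>]) \<in> hnn_rel G H" using hnn_rel_one[OF G(1)] by (rule presentation_rel.sym)
      from presentation_rel_context[OF this, of "[]" "hnn_syllables ((p, f) # ls)"]
      have "(l # base_letter f # hnn_syllables ls, base_letter \<one>\<^bsub>G\<^esub> # hnn_syllables ((p, f) # ls)) \<in> hnn_rel G H"
        using f ls by (simp add: l None)
      from presentation_rel.trans[OF lw this] show ?thesis
        using True f ls by (intro exI[of _ "\<one>\<^bsub>G\<^esub>"] exI[of _ "(p, f) # ls"]) auto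
    next
      case False
      then obtain q f' ls' where ls': "ls = (q, f') # ls'" "q = (\<not> p)" "f \<in> H"
        using ls by (cases ls) auto
      have f': "f' \<in> carrier G" "snd ` set ls' \<subseteq> carrier G" "hnn_reduced H ls'"
        using ls by (cases ls'; auto simp: ls')+
      have 1: "(l # base_letter f # hnn_syllables ls, base_letter f # base_letter f' # hnn_syllables ls') \<in> hnn_rel G H"
        using presentation_rel_context[OF hnn_rel_stable[OF G ls'(3), of p], of "[]" "base_letter f' # hnn_syllables ls'"] f'
        by (simp add: l None ls')
      have 2: "(base_letter f # base_letter f' # hnn_syllables ls', base_letter (f \<otimes>\<^bsub>G\<^esub> f') # hnn_syllables ls') \<in> hnn_rel G H"
        using presentation_rel_context[OF hnn_rel_mult[OF G(1) f f'(1)], of "[]" "hnn_syllables ls'"] f' by simp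
      have "(l # w, base_letter (f \<otimes>\<^bsub>G\<^esub> f') # hnn_syllables ls') \<in> hnn_rel G H"
        using presentation_rel.trans[OF lw presentation_rel.trans[OF 1 2]] .
      then show ?thesis using f f' by blast
    qed
  qed
qed

text \<open>Defined on words rather than on classes, as substituting \<open>g\<close> for the stable
  letter respects the relations t h = h t only if \<open>g\<close> commutes with h.\<close>

definition hnn_value :: "('a, 'b) monoid_scheme \<Rightarrow> 'a \<Rightarrow> 'a option word \<Rightarrow> 'a" where
  "hnn_value G g = word_value G (\<lambda>x. case x of None \<Rightarrow> g | Some a \<Rightarrow> a)"

lemma hnn_value_closed:
  assumes "group G" "g \<in> carrier G" "w \<in> words (hnn_gens G)"
  shows "hnn_value G g w \<in> carrier G"
  unfolding hnn_value_def
  by (rule word_value_closed[OF assms(1) _ assms(3)]) (use assms(2) in \<open>auto simp: hnn_gens_def\<close>)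

text \<open>A derivation of a relation uses only finitely many of the relations t h = h t.\<close>

lemma hnn_rel_eventually:
  fixes g :: "nat \<Rightarrow> 'a"
  assumes G: "group G" "\<And>n. g n \<in> carrier G"
    and H: "H \<subseteq> carrier G" "\<And>h. h \<in> H \<Longrightarrow> \<forall>\<^sub>F n in sequentially. g n \<otimes>\<^bsub>G\<^esub> h = h \<otimes>\<^bsub>G\<^esub> g n"
    and uv: "(u, v) \<in> hnn_rel G H"
  shows "\<forall>\<^sub>F n in sequentially. hnn_value G (g n) u = hnn_value G (g n) v"
  using uv
proof (induction rule: presentation_rel.induct)
  case (sym u v)
  from sym.IH show ?case by eventually_elim simp
next
  case (trans u v w)
  from trans.IH show ?case by eventually_elim simp
next
  case (append u u' v v')
  have "hnn_value G (g n) (u @ v) = hnn_value G (g n) u \<otimes>\<^bsub>G\<^esub> hnn_value G (g n) v"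
    "hnn_value G (g n) (u' @ v') = hnn_value G (g n) u' \<otimes>\<^bsub>G\<^esub> hnn_value G (g n) v'" for n
    using append.hyps[THEN presentation_rel_words] G(2)
    by (auto simp: hnn_value_def hnn_gens_def intro!: word_value_append[OF G(1), of _ "hnn_gens G"])
  note app = this
  from append.IH show ?case by eventually_elim (simp add: app)
next
  case (cancel x p)
  interpret group G by fact
  show ?case using cancel G(2) by (cases p; cases x) (auto simp: hnn_value_def)
next
  case (relation u v)
  interpret group G by fact
  from relation(1) consider
    (mult) a b where "u = [base_letter a, base_letter b]" "v = [base_letter (a \<otimes>\<^bsub>G\<^esub> b)]" "a \<in> carrier G" "b \<in> carrier G"
    | (stable) h where "u = [(None, True), base_letter h, (None, False)]" "v = [base_letter h]" "h \<in> H"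
    unfolding hnn_rels_def by blast
  then show ?case
  proof cases
    case mult
    then show ?thesis by (simp add: hnn_value_def m_assoc)
  next
    case stable
    then have h: "h \<in> carrier G" using H(1) by blast
    from H(2)[OF stable(3)] show ?thesis
    proof eventually_elim
      case (elim n)
      have "g n \<otimes>\<^bsub>G\<^esub> (h \<otimes>\<^bsub>G\<^esub> inv\<^bsub>G\<^esub> (g n)) = g n \<otimes>\<^bsub>G\<^esub> h \<otimes>\<^bsub>G\<^esub> inv\<^bsub>G\<^esub> (g n)" using h G(2)[of n] by (simp add: m_assoc)
      also have "\<dots> = h" unfolding elim using h G(2)[of n] by (simp add: m_assoc)
      finally show ?case using h G(2)[of n] by (simp add: stable hnn_value_def)
    qed
  qed
qed simp

section \<open>The HNN-extension is generated by the marking\<close>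

lemma hnn_base_mult:
  assumes "group G" "a \<in> carrier G" "b \<in> carrier G"
  shows "hnn_base G H (a \<otimes>\<^bsub>G\<^esub> b) = hnn_base G H a \<otimes>\<^bsub>hnn_centralizing G H\<^esub> hnn_base G H b"
proof -
  interpret group G by fact
  show ?thesis
    using hnn_rel_mult[OF assms, of H, THEN presentation_rel.sym] assms(2,3)
    by (simp add: hnn_base_def hnn_centralizing_def mult_presented_group word_class_eq_iff
        flip: word_class_def)
qed

lemma hnn_base_word_class: "hnn_base G H a = word_class (hnn_gens G) (hnn_rels G H) [base_letter a]"
  by (simp add: hnn_base_def word_class_def)

lemma hnn_stable_word_class: "hnn_stable G H = word_class (hnn_gens G) (hnn_rels G H) [(None, True)]"
  by (simp add: hnn_stable_def word_class_def)

lemma hnn_carrier: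
  "a \<in> carrier G \<Longrightarrow> hnn_base G H a \<in> carrier (hnn_centralizing G H)"
  "hnn_stable G H \<in> carrier (hnn_centralizing G H)"
  unfolding hnn_base_word_class hnn_stable_word_class hnn_centralizing_def
  by (auto intro!: word_class_carrier)

text \<open>The base map is a homomorphism and so carries generation of \<open>G\<close> by
  \<open>S\<close> over to all base letters; with the stable letter they give every word.\<close>

lemma generate_hnn_centralizing:
  assumes G: "group G" and S: "S \<subseteq> carrier G" "generate G S = carrier G"
  shows "generate (hnn_centralizing G H) (insert (hnn_stable G H) (hnn_base G H ` S))
    = carrier (hnn_centralizing G H)" (is "generate ?K ?T = _")
proof
  interpret G: group G by fact
  interpret K: group ?K unfolding hnn_centralizing_def by (rule group_presented_group)
  have T: "?T \<subseteq> carrier ?K" using hnn_carrier(2) S(1) by (auto intro!: hnn_carrier(1))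
  then show "generate ?K ?T \<subseteq> carrier ?K" by (rule K.generate_incl)
  have hom: "group_hom G ?K (hnn_base G H)"
    by (intro group_hom.intro group_hom_axioms.intro homI G K.group_axioms hnn_carrier hnn_base_mult)
  have base: "hnn_base G H a \<in> generate ?K ?T" if "a \<in> carrier G" for a
  proof -
    have "a \<in> generate G S" using that S(2) by simp
    then show ?thesis
    proof (induction rule: generate.induct)
      case one
      then show ?case using generate.one[of ?K ?T] by (simp add: group_hom.hom_one[OF hom])
    next
      case (incl h)
      then show ?case by (intro generate.incl) simp
    next
      case (inv h)
      then show ?case using generate.inv[of "hnn_base G H h" ?T ?K] S(1)
        by (auto simp: group_hom.hom_inv[OF hom])
    next
      case (eng h1 h2)
      have "h1 \<in> carrier G" "h2 \<in> carrier G"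
        using eng.hyps S by auto
      then show ?case using generate.eng[OF eng.IH] by (simp add: group_hom.hom_mult[OF hom])
    qed
  qed
  have stable: "hnn_stable G H \<in> generate ?K ?T" by (intro generate.incl) simp
  have letter: "word_class (hnn_gens G) (hnn_rels G H) [(x, True)] \<in> generate ?K ?T" if "x \<in> hnn_gens G" for x
    using that base stable unfolding hnn_base_word_class hnn_stable_word_class by (cases x) auto
  show "carrier ?K \<subseteq> generate ?K ?T"
  proof
    fix y assume "y \<in> carrier ?K"
    then obtain w where w: "w \<in> words (hnn_gens G)" "y = word_class (hnn_gens G) (hnn_rels G H) w"
      by (auto simp: hnn_centralizing_def carrier_presented_group)
    have "word_value ?K (\<lambda>x. word_class (hnn_gens G) (hnn_rels G H) [(x, True)]) w \<in> generate ?K ?T"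
      using w(1)
    proof (induction w)
      case Nil
      show ?case using generate.one by simp
    next
      case (Cons l w)
      then have l: "word_class (hnn_gens G) (hnn_rels G H) [(fst l, True)] \<in> generate ?K ?T"
        using letter by simp
      then have "(if snd l then word_class (hnn_gens G) (hnn_rels G H) [(fst l, True)]
          else inv\<^bsub>?K\<^esub> word_class (hnn_gens G) (hnn_rels G H) [(fst l, True)]) \<in> generate ?K ?T"
        using K.generate_m_inv_closed[OF T l] by simp
      moreover have "word_value ?K (\<lambda>x. word_class (hnn_gens G) (hnn_rels G H) [(x, True)]) w \<in> generate ?K ?T"
        using Cons by simp
      ultimately show ?case unfolding word_value_Cons by (rule generate.eng)
    qed
    then show "y \<in> generate ?K ?T"
      unfolding w(2) using word_value_presented_group[OF w(1), of "hnn_rels G H"]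
      by (simp only: hnn_centralizing_def)
  qed
qed

section \<open>Germs at 1\<close>

lemma thompson_mult_apply:
  assumes "a \<in> carrier thompson_F" "b \<in> carrier thompson_F" "t \<in> {0..1}"
  shows "(a \<otimes>\<^bsub>thompson_F\<^esub> b) t = a (b t)"
proof -
  obtain f g where fg: "f \<in> F_ext" "g \<in> F_ext" "a = restr f" "b = restr g"
    using assms by (auto simp: carrier_thompson_F)
  then show ?thesis using assms(3) F_ext_in_unit[OF fg(2), of t] by (simp add: thompson_mult)
qed

lemma thompson_in_unit:
  assumes "a \<in> carrier thompson_F" "t \<in> {0..1}" shows "a t \<in> {0..1}"
  using assms F_ext_in_unit by (auto simp: carrier_thompson_F simp del: atLeastAtMost_iff)

definition has_germ :: "(real \<Rightarrow> real) \<Rightarrow> int \<Rightarrow> real \<Rightarrow> bool" where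
  "has_germ a k d \<longleftrightarrow> 0 < d \<and> d \<le> 1 \<and> (\<forall>u\<in>{-d..0}. a (1 + u) = 1 + 2 powi k * u)"

text \<open>On the last affine piece the fixed point 1 forces the constant term 1 - 2^k, so the
  piece is a scaling with centre 1.\<close>

lemma has_germ_exists:
  assumes "a \<in> carrier thompson_F"
  shows "\<exists>k d. has_germ a k d"
proof -
  obtain f where f: "f \<in> F_ext" "a = restr f" using assms by (auto simp: carrier_thompson_F)
  obtain l k c where l: "l < 1" "\<forall>s\<in>{l..1}. f s = 2 powi k * s + c"
    using PL2_affine_left[OF F_ext_PL2[OF f(1)], of 1] by blast
  have "f 1 = 1" using F_ext_ends(2)[OF f(1)] by simp
  moreover have "f 1 = 2 powi k * 1 + c" using l by (intro l(2)[rule_format]) simp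
  ultimately have c: "c = 1 - 2 powi k" by simp
  have "a (1 + u) = 1 + 2 powi k * u" if "u \<in> {- min 1 (1 - l)..0}" for u
  proof -
    have "1 + u \<in> {0..1}" "1 + u \<in> {l..1}" using that by (auto simp: min_def split: if_splits)
    then have "f (1 + u) = 2 powi k * (1 + u) + c" "a (1 + u) = f (1 + u)"
      using l(2) f(2) by (blast, simp)
    then show ?thesis by (simp add: c algebra_simps)
  qed
  then have "has_germ a k (min 1 (1 - l))" using l(1) by (auto simp: has_germ_def)
  then show ?thesis by blast
qed

lemma H1_iff_germ:
  assumes "a \<in> carrier thompson_F"
  shows "a \<in> H1 \<longleftrightarrow> (\<exists>d>0. d \<le> 1 \<and> (\<forall>u\<in>{-d..0}. a (1 + u) = 1 + u))"
proof
  assume "a \<in> H1"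
  then have "1 \<notin> closure (supp a)" by (simp add: H1_def)
  then obtain e where e: "e > 0" "\<forall>y\<in>supp a. e \<le> dist y 1"
    by (auto simp: closure_approachable not_less)
  have "a (1 + u) = 1 + u" if "u \<in> {- min 1 (e / 2)..0}" for u
  proof (rule ccontr)
    assume "a (1 + u) \<noteq> 1 + u"
    then have "1 + u \<in> supp a" using that by (auto simp: supp_def)
    then have "e \<le> \<bar>u\<bar>" using e(2) by (force simp: dist_real_def)
    moreover have "\<bar>u\<bar> \<le> e / 2" using that by (auto simp: min_def split: if_splits)
    ultimately show False using e(1) by simp
  qed
  then show "\<exists>d>0. d \<le> 1 \<and> (\<forall>u\<in>{-d..0}. a (1 + u) = 1 + u)"
    using e(1) by (intro exI[of _ "min 1 (e / 2)"]) auto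
next
  assume "\<exists>d>0. d \<le> 1 \<and> (\<forall>u\<in>{-d..0}. a (1 + u) = 1 + u)"
  then obtain d where d: "d > 0" "\<forall>u\<in>{-d..0}. a (1 + u) = 1 + u" by blast
  have "supp a \<subseteq> {..1 - d}"
  proof
    fix t assume t: "t \<in> supp a"
    show "t \<in> {..1 - d}"
    proof (rule ccontr)
      assume "t \<notin> {..1 - d}"
      then have "t - 1 \<in> {-d..0}" using t by (auto simp: supp_def)
      then have "a (1 + (t - 1)) = 1 + (t - 1)" using d(2) by blast
      then show False using t by (simp add: supp_def)
    qed
  qed
  then have "closure (supp a) \<subseteq> {..1 - d}" by (rule closure_minimal) simp
  then have "1 \<notin> closure (supp a)" using d(1) by auto
  then show "a \<in> H1" using assms by (simp add: H1_def)
qed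

section \<open>The approximating sequence\<close>

lemma rescale_F_ext:
  assumes "L \<in> PL2" "\<forall>u. u \<notin> {-d<..<0} \<longrightarrow> L u = u" "d \<le> 1"
  shows "rescale 1 0 L \<in> F_ext"
proof -
  have "rescale 1 0 L t = t" if "t \<notin> {0<..<1}" for t
    using that assms(2,3) by (auto simp: rescale_def)
  then show ?thesis using rescale_PL2[OF _ assms(1), of 1 0] by (simp add: F_ext_def)
qed

lemma restr_rescale_apply: "1 + s \<in> {0..1} \<Longrightarrow> restr (rescale 1 0 L) (1 + s) = 1 + L s"
  by (simp add: rescale_def)

text \<open>By the bound on the suffixes, each element of F is applied to a point within distance d
  of 1, where it equals its germ. The scaled point may leave this window, but there \<open>L\<close>
  is the identity, and the next bound again concerns the point reached.\<close>

lemma hnn_value_syllables_track: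
  assumes L: "L \<in> PL2" "\<forall>u. u \<notin> {-d<..<0} \<longrightarrow> L u = u" and d: "d \<le> 1"
    and ls: "snd ` set ls \<subseteq> carrier thompson_F" "\<forall>l\<in>set ls. has_germ (snd l) (\<kappa> (snd l)) (\<delta> (snd l)) \<and> d \<le> \<delta> (snd l)"
    and x: "x < 0" "\<forall>j\<le>length ls. - d < track L (drop j (map (\<lambda>l. (fst l, \<kappa> (snd l))) ls)) x"
  shows "hnn_value thompson_F (restr (rescale 1 0 L)) (hnn_syllables ls) (1 + x)
    = 1 + track L (map (\<lambda>l. (fst l, \<kappa> (snd l))) ls) x"
  using ls x(2)
proof (induction ls)
  case Nil
  then show ?case using x(1) d by (simp add: hnn_value_def thompson_one)
next
  case (Cons l ls)
  have Lneg: "L \<in> PL2_neg"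
    unfolding PL2_neg_def using L by (auto intro!: exI[of _ "-d"])
  let ?g = "restr (rescale 1 0 L)" and ?w = "map (\<lambda>l. (fst l, \<kappa> (snd l))) ls"
  let ?v = "hnn_value thompson_F ?g (hnn_syllables ls)" and ?u = "track L ?w x"
  have F: "rescale 1 0 L \<in> F_ext" by (rule rescale_F_ext[OF L d])
  have Linv: "inverse_fun L \<in> PL2" "\<forall>u. u \<notin> {-d<..<0} \<longrightarrow> inverse_fun L u = u"
    using PL2_inv_mem[OF L(1)] L(2) PL2_inv(1)[OF L(1)] by metis+
  have g: "?g \<in> carrier thompson_F" using F by (rule restr_carrier)
  have a: "snd l \<in> carrier thompson_F" using Cons.prems(1) by simp
  have v: "?v \<in> carrier thompson_F"
    using Cons.prems(1) by (intro hnn_value_closed[OF group_thompson_F g]) simp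
  have u: "- d < ?u" "?u < 0"
    using Cons.prems(3)[rule_format, of 1] track_negative[OF Lneg x(1)] by auto
  have IH: "?v (1 + x) = 1 + ?u"
  proof (rule Cons.IH)
    show "\<forall>j\<le>length ls. - d < track L (drop j ?w) x"
      using Cons.prems(3)[rule_format, of "Suc j" for j] by simp
  qed (use Cons.prems in auto)
  \<comment> \<open>With all letters dropped the track is at x itself, so the bound for the full
    length places 1 + x in [0, 1].\<close>
  have x01: "1 + x \<in> {0..1}" using Cons.prems(3)[rule_format, of "length (l # ls)"] x(1) d by simp
  have gl: "(if fst l then ?g else inv\<^bsub>thompson_F\<^esub> ?g) = restr (rescale 1 0 (sign_fun L (fst l)))"
    using F by (simp add: sign_fun_def thompson_inv inverse_rescale[OF L(1)])
  have glF: "restr (rescale 1 0 (sign_fun L (fst l))) \<in> carrier thompson_F"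
    using restr_carrier rescale_F_ext[OF L d] rescale_F_ext[OF Linv d] by (simp add: sign_fun_def)
  have "snd l (1 + ?u) = 1 + 2 powi \<kappa> (snd l) * ?u"
    using Cons.prems(2) u by (auto simp: has_germ_def)
  moreover have unit: "snd l (1 + ?u) \<in> {0..1}"
    by (rule thompson_in_unit[OF a]) (use u d in auto)
  ultimately have y: "1 + 2 powi \<kappa> (snd l) * ?u \<in> {0..1}" "snd l (?v (1 + x)) = 1 + 2 powi \<kappa> (snd l) * ?u"
    using IH by simp_all
  interpret F: group thompson_F by (rule group_thompson_F)
  have val: "hnn_value thompson_F ?g (hnn_syllables (l # ls)) =
      restr (rescale 1 0 (sign_fun L (fst l))) \<otimes>\<^bsub>thompson_F\<^esub> (snd l \<otimes>\<^bsub>thompson_F\<^esub> ?v)"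
    by (simp only: hnn_value_def hnn_syllables.simps word_value_Cons fst_conv snd_conv option.case if_True gl)
  have "hnn_value thompson_F ?g (hnn_syllables (l # ls)) (1 + x) =
      restr (rescale 1 0 (sign_fun L (fst l))) (snd l (?v (1 + x)))"
    unfolding val thompson_mult_apply[OF glF F.m_closed[OF a v] x01] thompson_mult_apply[OF a v x01] ..
  also have "\<dots> = 1 + sign_fun L (fst l) (2 powi \<kappa> (snd l) * ?u)"
    unfolding y(2) by (rule restr_rescale_apply[OF y(1)])
  finally show ?case by (simp only: list.map track.simps fst_conv snd_conv)
qed

text \<open>The two maps have disjoint supports: one is the identity up to 1 - e, the other from
  there on, and both preserve the two sides of 1 - e.\<close>

lemma rescale_commutes_H1:
  assumes L: "L \<in> PL2" "\<forall>u. u \<notin> {-d<..<0} \<longrightarrow> L u = u" "d \<le> e"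
    and h: "h \<in> carrier thompson_F" "e \<le> 1" "\<forall>u\<in>{-e..0}. h (1 + u) = 1 + u"
  shows "restr (rescale 1 0 L) \<otimes>\<^bsub>thompson_F\<^esub> h = h \<otimes>\<^bsub>thompson_F\<^esub> restr (rescale 1 0 L)"
proof -
  let ?g = "rescale 1 0 L"
  have "d \<le> 1" using L(3) h(2) by simp
  then have g: "?g \<in> F_ext" by (rule rescale_F_ext[OF L(1,2)])
  obtain f where f: "f \<in> F_ext" "h = restr f" using h(1) by (auto simp: carrier_thompson_F)
  have g_low: "?g t = t" if "t \<le> 1 - e" for t using that L(2,3) by (simp add: rescale_def)
  have f_high: "f t = t" if "1 - e \<le> t" for t
  proof (cases "t \<le> 1")
    case True
    then have "h (1 + (t - 1)) = 1 + (t - 1)" using that by (intro h(3)[rule_format]) simp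
    then show ?thesis using True that h(2) by (simp add: f(2))
  next
    case False
    then show ?thesis using F_ext_ends(2)[OF f(1), of t] by simp
  qed
  have "?g (f t) = f (?g t)" for t
  proof (cases "t \<le> 1 - e")
    case True
    then have "f t \<le> 1 - e" using PL2_le[OF F_ext_PL2[OF f(1)], of t "1 - e"] f_high[of "1 - e"] by simp
    then show ?thesis using True g_low by simp
  next
    case False
    then have "1 - e \<le> ?g t" using PL2_le[OF F_ext_PL2[OF g], of "1 - e" t] g_low[of "1 - e"] by simp
    then show ?thesis using False f_high by simp
  qed
  then have "?g \<circ> f = f \<circ> ?g" by auto
  then show ?thesis using f g by (simp add: thompson_mult)
qed

lemma eventually_inverse_Suc_le: "0 < e \<Longrightarrow> \<forall>\<^sub>F n in sequentially. 1 / real (Suc n) \<le> e"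
proof -
  assume "0 < e"
  then obtain N where N: "N \<noteq> 0" "inverse (real N) < e" using real_arch_inverse[of e] by auto
  show ?thesis
    unfolding eventually_sequentially
  proof (intro exI[of _ N] allI impI)
    fix n assume "N \<le> n"
    then have "1 / real (Suc n) \<le> 1 / real N" using N(1) by (intro divide_left_mono) auto
    then show "1 / real (Suc n) \<le> e" using N(2) by (simp add: inverse_eq_divide)
  qed
qed

locale generic_sequence =
  fixes L :: "nat \<Rightarrow> real \<Rightarrow> real"
  assumes L_PL2: "L n \<in> PL2"
    and L_support: "u \<notin> {- (1 / Suc n)<..<0} \<Longrightarrow> L n u = u"
    and L_generic: "i \<le> n \<Longrightarrow> reduced_nonempty (nth_exponents i) \<Longrightarrow>
      \<exists>x. track_witness (L n) (nth_exponents i) x \<and>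
         (\<forall>j\<le>length (snd (nth_exponents i)). - (1 / Suc n) < track (L n) (drop j (snd (nth_exponents i))) x)"
begin

definition g :: "nat \<Rightarrow> real \<Rightarrow> real" where
  "g n = restr (rescale 1 0 (L n))"

lemma g_carrier: "g n \<in> carrier thompson_F"
  unfolding g_def by (intro restr_carrier rescale_F_ext[OF L_PL2, of "1 / Suc n"]) (use L_support in simp_all)

lemma g_commutes_H1:
  assumes "h \<in> H1"
  shows "\<forall>\<^sub>F n in sequentially. g n \<otimes>\<^bsub>thompson_F\<^esub> h = h \<otimes>\<^bsub>thompson_F\<^esub> g n"
proof -
  have h: "h \<in> carrier thompson_F" using assms by (simp add: H1_def)
  then obtain e where e: "e > 0" "e \<le> 1" "\<forall>u\<in>{-e..0}. h (1 + u) = 1 + u"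
    using assms H1_iff_germ by blast
  from eventually_inverse_Suc_le[OF e(1)] show ?thesis
  proof eventually_elim
    case (elim n)
    then show ?case
      unfolding g_def
      by (intro rescale_commutes_H1[OF L_PL2 _ elim h e(2,3)]) (use L_support in blast)
  qed
qed

text \<open>Replacing elements of F by the exponents of their germs turns \<open>hnn_reduced\<close>
  into \<open>reduced\<close>, since an element with exponent 0 lies in \<open>H1\<close>. Once n
  passes the index of the exponent data and 1 / (n + 1) is below all germ radii, the witness gives a
  point near 1 that the word moves.\<close>

lemma reduced_word_nontrivial:
  assumes f: "f \<in> carrier thompson_F" and ls: "ls \<noteq> []" "snd ` set ls \<subseteq> carrier thompson_F" "hnn_reduced H1 ls"
  shows "\<forall>\<^sub>F n in sequentially.
    hnn_value thompson_F (g n) (base_letter f # hnn_syllables ls) \<noteq> \<one>\<^bsub>thompson_F\<^esub>"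
proof -
  obtain \<kappa> \<delta> where germ: "\<And>a. a \<in> carrier thompson_F \<Longrightarrow> has_germ a (\<kappa> a) (\<delta> a)"
    using has_germ_exists by metis
  \<comment> \<open>f acts last, with slope 2^(\<kappa> f) at 1; the word moves 1 + x if the track
    of x does not end at 2^(- \<kappa> f) * x.\<close>
  define cw where "cw = (- \<kappa> f, map (\<lambda>l. (fst l, \<kappa> (snd l))) ls)"
  have "successively (\<lambda>l l'. fst l = fst l' \<or> \<kappa> (snd l) \<noteq> 0) ls"
  proof (rule successively_mono[OF ls(3)])
    fix l l' :: "bool \<times> (real \<Rightarrow> real)"
    assume l: "l \<in> set ls" "fst l = fst l' \<or> snd l \<notin> H1"
    then have c: "snd l \<in> carrier thompson_F" using ls(2) by auto
    have "snd l \<in> H1" if "\<kappa> (snd l) = 0"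
      using germ[OF c] that H1_iff_germ[OF c] by (auto simp: has_germ_def)
    then show "fst l = fst l' \<or> \<kappa> (snd l) \<noteq> 0" using l(2) by auto
  qed
  then have "reduced (snd cw)" by (simp add: cw_def successively_map)
  then have red: "reduced_nonempty cw" using ls(1) by (simp add: reduced_nonempty_def cw_def)
  define D where "D = Min (\<delta> ` insert f (snd ` set ls))"
  have le: "D \<le> \<delta> a" if "a \<in> insert f (snd ` set ls)" for a
    unfolding D_def using that by (intro Min_le) auto
  have "D \<in> \<delta> ` insert f (snd ` set ls)" unfolding D_def by (intro Min_in) auto
  then have "D > 0" using germ f ls(2) by (auto simp: has_germ_def)
  from eventually_inverse_Suc_le[OF this] eventually_ge_at_top[of "to_nat cw"] show ?thesis
  proof eventually_elim
    case (elim n)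
    obtain x where x: "track_witness (L n) cw x"
        "\<forall>j\<le>length (snd cw). - (1 / Suc n) < track (L n) (drop j (snd cw)) x"
      using L_generic[OF elim(2)] red by auto
    have x0: "x < 0" "track (L n) (snd cw) x \<noteq> 2 powi (- \<kappa> f) * x"
      using x(1) by (auto simp: track_witness_def cw_def)
    let ?v = "hnn_value thompson_F (g n) (hnn_syllables ls)" and ?u = "track (L n) (snd cw) x"
    have v: "?v \<in> carrier thompson_F"
      using ls(2) by (intro hnn_value_closed[OF group_thompson_F g_carrier]) simp
    have "?v (1 + x) = 1 + track (L n) (map (\<lambda>l. (fst l, \<kappa> (snd l))) ls) x"
      unfolding g_def
    proof (rule hnn_value_syllables_track[where \<delta> = \<delta> and d = "1 / Suc n"])
      show "\<forall>l\<in>set ls. has_germ (snd l) (\<kappa> (snd l)) (\<delta> (snd l)) \<and> 1 / Suc n \<le> \<delta> (snd l)"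
        using germ ls(2) le elim(1) by (metis image_eqI insertCI order.trans subsetD)
      show "\<forall>u. u \<notin> {- (1 / real (Suc n))<..<0} \<longrightarrow> L n u = u" using L_support by blast
      show "\<forall>j\<le>length ls. - (1 / real (Suc n)) < track (L n) (drop j (map (\<lambda>l. (fst l, \<kappa> (snd l))) ls)) x"
        using x(2) by (simp add: cw_def)
    qed (use L_PL2 ls(2) x0(1) in simp_all)
    then have v_x: "?v (1 + x) = 1 + ?u" by (simp add: cw_def)
    have "- (1 / Suc n) < ?u" using x(2)[rule_format, of 0] by simp
    have "L n \<in> PL2_neg"
      unfolding PL2_neg_def using L_PL2 L_support by (auto intro!: exI[of _ "- (1 / Suc n)"])
    then have "?u < 0" using x0(1) by (rule track_negative)
    have x01: "1 + x \<in> {0..1}"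
    proof -
      have "- (1 / Suc n) < x" using x(2)[rule_format, of "length (snd cw)"] by simp
      moreover have "1 / real (Suc n) \<le> 1" by simp
      ultimately have "- 1 \<le> x" by linarith
      then show ?thesis using x0(1) by simp
    qed
    have u: "?u \<in> {- \<delta> f..0}"
      using \<open>- (1 / Suc n) < ?u\<close> \<open>?u < 0\<close> elim(1) le[of f] by auto
    have "hnn_value thompson_F (g n) (base_letter f # hnn_syllables ls) (1 + x) = f (?v (1 + x))"
      using thompson_mult_apply[OF f v x01] by (simp add: hnn_value_def)
    also have "\<dots> = 1 + 2 powi \<kappa> f * ?u"
      unfolding v_x using germ[OF f] u by (simp add: has_germ_def)
    also have "\<dots> \<noteq> 1 + x"
      using x0(2) by (auto simp: power_int_minus field_simps)
    finally show ?case using x01 by (auto simp: thompson_one)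
  qed
qed

lemma relation_eventually_iff:
  assumes w: "w \<in> words (hnn_gens thompson_F)"
  shows "\<forall>\<^sub>F n in sequentially. hnn_value thompson_F (g n) w = \<one>\<^bsub>thompson_F\<^esub> \<longleftrightarrow>
    (w, []) \<in> hnn_rel thompson_F H1"
proof -
  interpret F: group thompson_F by (rule group_thompson_F)
  have H1: "H1 \<subseteq> carrier thompson_F" by (auto simp: H1_def)
  have rel_ev: "\<forall>\<^sub>F n in sequentially. hnn_value thompson_F (g n) u = hnn_value thompson_F (g n) v"
    if "(u, v) \<in> hnn_rel thompson_F H1" for u v
    using group_thompson_F g_carrier H1 g_commutes_H1 that by (rule hnn_rel_eventually)
  show ?thesis
  proof (cases "(w, []) \<in> hnn_rel thompson_F H1")
    case True
    from rel_ev[OF this] show ?thesis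
      by eventually_elim (use True in \<open>simp add: hnn_value_def\<close>)
  next
    case False
    obtain f ls where f: "f \<in> carrier thompson_F" and ls: "snd ` set ls \<subseteq> carrier thompson_F" "hnn_reduced H1 ls"
      and nf: "(w, base_letter f # hnn_syllables ls) \<in> hnn_rel thompson_F H1"
      using hnn_normal_form[OF group_thompson_F H1 w] by blast
    have "\<forall>\<^sub>F n in sequentially.
        hnn_value thompson_F (g n) (base_letter f # hnn_syllables ls) \<noteq> \<one>\<^bsub>thompson_F\<^esub>"
    proof (cases "ls = []")
      case True
      \<comment> \<open>If f were 1, the normal form and hence w would be trivial in the
        HNN-extension.\<close>
      have "f \<noteq> \<one>\<^bsub>thompson_F\<^esub>"
        using False nf True hnn_rel_one[OF group_thompson_F, of H1] by (auto dest: presentation_rel.trans)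
      then show ?thesis using f True by (simp add: hnn_value_def)
    next
      case False
      then show ?thesis using f ls by (intro reduced_word_nontrivial)
    qed
    with rel_ev[OF nf] show ?thesis
      by eventually_elim (use False in simp)
  qed
qed

section \<open>Relations of bounded length in the marked groups\<close>

definition hnn_marking :: "nat \<Rightarrow> (real \<Rightarrow> real) option" where
  "hnn_marking i = [None, Some x0, Some x1] ! i"

lemma hnn_marking_gens: "hnn_marking ` {..<3} \<subseteq> hnn_gens thompson_F"
  using x0_x1_carrier by (auto simp: hnn_marking_def less_Suc_eq numeral_3_eq_3)

lemma relations_upto_F:
  "relations_upto R (thompson_F, [g n, x0, x1]) =
    {w \<in> words {..<3}. length w \<le> R \<and> hnn_value thompson_F (g n) (map_word hnn_marking w) = \<one>\<^bsub>thompson_F\<^esub>}"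
proof -
  have "word_value thompson_F (\<lambda>i. [g n, x0, x1] ! i) w = hnn_value thompson_F (g n) (map_word hnn_marking w)"
    if "w \<in> words {..<3}" for w
    using that unfolding hnn_value_def word_value_map_word
    by (induction w) (auto simp: hnn_marking_def less_Suc_eq numeral_3_eq_3)
  then show ?thesis by (auto simp: relations_upto_def numeral_3_eq_3)
qed

lemma relations_upto_hnn:
  "relations_upto R (hnn_centralizing thompson_F H1,
      [hnn_stable thompson_F H1, hnn_base thompson_F H1 x0, hnn_base thompson_F H1 x1]) =
    {w \<in> words {..<3}. length w \<le> R \<and> (map_word hnn_marking w, []) \<in> hnn_rel thompson_F H1}"
proof -
  let ?cls = "word_class (hnn_gens thompson_F) (hnn_rels thompson_F H1)"
  have "word_value (hnn_centralizing thompson_F H1)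
        (\<lambda>i. [hnn_stable thompson_F H1, hnn_base thompson_F H1 x0, hnn_base thompson_F H1 x1] ! i) w
      = ?cls (map_word hnn_marking w)"
    if w: "w \<in> words {..<3}" for w
  proof -
    have "word_value (hnn_centralizing thompson_F H1)
        (\<lambda>i. [hnn_stable thompson_F H1, hnn_base thompson_F H1 x0, hnn_base thompson_F H1 x1] ! i) w
      = word_value (hnn_centralizing thompson_F H1) (\<lambda>i. ?cls [(hnn_marking i, True)]) w"
      using w by (induction w)
        (auto simp: hnn_marking_def hnn_base_word_class hnn_stable_word_class less_Suc_eq numeral_3_eq_3)
    also have "\<dots> = ?cls (map_word hnn_marking w)"
      using word_value_presented_group[OF map_word_words[OF hnn_marking_gens w]]
      by (simp add: hnn_centralizing_def word_value_map_word)
    finally show ?thesis .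
  qed
  moreover have "?cls (map_word hnn_marking w) = \<one>\<^bsub>hnn_centralizing thompson_F H1\<^esub> \<longleftrightarrow>
      (map_word hnn_marking w, []) \<in> hnn_rel thompson_F H1" if "w \<in> words {..<3}" for w
    using map_word_words[OF hnn_marking_gens that]
    by (simp add: hnn_centralizing_def one_presented_group word_class_eq_iff)
  moreover have "length [hnn_stable thompson_F H1, hnn_base thompson_F H1 x0, hnn_base thompson_F H1 x1] = 3"
    by simp
  ultimately show ?thesis unfolding relations_upto_def prod.case by (intro Collect_cong) metis
qed

lemma finite_words_upto: "finite {w \<in> words {..<3::nat}. length w \<le> R}"
proof -
  have "{w \<in> words {..<3::nat}. length w \<le> R} = {w. set w \<subseteq> {..<3} \<times> UNIV \<and> length w \<le> R}"
    by (auto simp: words_def)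
  then show ?thesis by (simp add: finite_lists_length_le)
qed

text \<open>Words of length at most R over three generators are finitely many, so the eventual
  equivalences for the single words hold simultaneously from some n on.\<close>

lemma relations_upto_eventually:
  "\<forall>\<^sub>F n in sequentially. relations_upto R (thompson_F, [g n, x0, x1]) =
    relations_upto R (hnn_centralizing thompson_F H1,
      [hnn_stable thompson_F H1, hnn_base thompson_F H1 x0, hnn_base thompson_F H1 x1])"
proof -
  have "\<forall>\<^sub>F n in sequentially. \<forall>w\<in>{w \<in> words {..<3}. length w \<le> R}.
      hnn_value thompson_F (g n) (map_word hnn_marking w) = \<one>\<^bsub>thompson_F\<^esub> \<longleftrightarrow>
      (map_word hnn_marking w, []) \<in> hnn_rel thompson_F H1"
    using relation_eventually_iff map_word_words[OF hnn_marking_gens]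
    by (intro eventually_ball_finite finite_words_upto) simp
  then show ?thesis
    by eventually_elim (auto simp: relations_upto_F relations_upto_hnn)
qed

lemma marked_limit_g:
  "marked_limit 3 (\<lambda>n. (thompson_F, [g n, x0, x1]))
    (hnn_centralizing thompson_F H1,
     [hnn_stable thompson_F H1, hnn_base thompson_F H1 x0, hnn_base thompson_F H1 x1])"
    (is "marked_limit 3 ?M ?N")
  unfolding marked_limit_def
proof (intro conjI allI)
  interpret F: group thompson_F by (rule group_thompson_F)
  fix n
  have "carrier thompson_F \<subseteq> generate thompson_F {g n, x0, x1}"
    unfolding generate_x0_x1[symmetric] by (rule F.mono_generate) auto
  moreover have "{g n, x0, x1} \<subseteq> carrier thompson_F" using g_carrier x0_x1_carrier by simp
  moreover from this have "generate thompson_F {g n, x0, x1} \<subseteq> carrier thompson_F"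
    by (rule F.generate_incl)
  ultimately show "?M n \<in> marked_groups 3"
    using F.group_axioms by (simp add: marked_groups_def)
next
  have "group (hnn_centralizing thompson_F H1)"
    unfolding hnn_centralizing_def by (rule group_presented_group)
  moreover have "x0 \<in> carrier thompson_F" "x1 \<in> carrier thompson_F" using x0_x1_carrier by simp_all
  then have "{hnn_stable thompson_F H1, hnn_base thompson_F H1 x0, hnn_base thompson_F H1 x1}
      \<subseteq> carrier (hnn_centralizing thompson_F H1)"
    by (simp only: insert_subset hnn_carrier empty_subsetI simp_thms)
  ultimately show "?N \<in> marked_groups 3"
    using generate_hnn_centralizing[OF group_thompson_F x0_x1_carrier generate_x0_x1, of H1]
    by (simp add: marked_groups_def)
next
  show "(\<lambda>n. marked_dist (?M n) ?N) \<longlonglongrightarrow> 0"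
  proof (rule LIMSEQ_I)
    fix r :: real assume "r > 0"
    obtain R :: nat where R: "ln (1 / r) < R" using reals_Archimedean2 by blast
    have "exp (- real R) < r"
    proof -
      have "exp (- real R) < exp (- ln (1 / r))" using R by simp
      also have "\<dots> = r" using \<open>r > 0\<close> by (simp add: ln_div)
      finally show ?thesis .
    qed
    have "\<forall>\<^sub>F n in sequentially. norm (marked_dist (?M n) ?N - 0) < r"
      using relations_upto_eventually[of R]
    proof eventually_elim
      case (elim n)
      let ?E = "{exp (- real R) | R. relations_upto R (?M n) = relations_upto R ?N}"
      have mem: "exp (- real R) \<in> ?E" using elim by blast
      have "marked_dist (?M n) ?N \<le> exp (- real R)"
        unfolding marked_dist_def by (rule cInf_lower[OF mem]) (auto intro!: bdd_belowI[of _ 0])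
      moreover have "0 \<le> marked_dist (?M n) ?N"
        unfolding marked_dist_def by (rule cInf_greatest) (use mem in auto)
      ultimately show ?case using \<open>exp (- real R) < r\<close> by simp
    qed
    then show "\<exists>n0. \<forall>n\<ge>n0. norm (marked_dist (?M n) ?N - 0) < r"
      by (simp add: eventually_sequentially)
  qed
qed

end

theorem theorem3p8:
  shows "\<exists>g :: nat \<Rightarrow> (real \<Rightarrow> real).
    (\<forall>n. g n \<in> carrier thompson_F) \<and>
    marked_limit 3
      (\<lambda>n. (thompson_F, [g n, x0, x1]))
      (hnn_centralizing thompson_F H1,
       [hnn_stable thompson_F H1, hnn_base thompson_F H1 x0, hnn_base thompson_F H1 x1])"
proof -
  obtain L where L: "\<forall>n. L n \<in> PL2 \<and> (\<forall>u. u \<notin> {- 1 / Suc n<..<0} \<longrightarrow> L n u = u) \<and>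
    (\<forall>i\<le>n. reduced_nonempty (nth_exponents i) \<longrightarrow>
      (\<exists>x. track_witness (L n) (nth_exponents i) x \<and>
         (\<forall>j\<le>length (snd (nth_exponents i)).
            - 1 / Suc n < track (L n) (drop j (snd (nth_exponents i))) x)))"
    using exists_generic_sequence by (elim exE)
  interpret generic_sequence L
    using L by unfold_locales simp_all
  show ?thesis using g_carrier marked_limit_g by blast
qed

end
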